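(* Let $m, n \geq 3$ both be odd. Then $\widetilde{\mathrm{cr}}_{h'(m,n)}(K_{m,n}) = 1$, where $h'(m,n) = \left\lfloor \frac{(m-2)(n-2)}{2} \right\rfloor$.
   Context: $N_k$ denotes the closed nonorientable surface obtained from the sphere by adding $k$ crosscaps (with $N_0$ the sphere by convention). A drawing of a graph in a surface is a locally injective map with vertices mapped to distinct points, no vertex in the interior of an edge, and finitely many crossings (identifications of interior points of two edges). $\widetilde{\mathrm{cr}}_k(G)$ is the minimum number of crossings over all drawings of $G$ in $N_k$. *)

theory Defs
  imports "HOL-Analysis.Analysis"
begin

definition quotient_top :: "'a topology \<Rightarrow> ('a \<times> 'a) set \<Rightarrow> 'a set topology" where
  "quotient_top X R = topology (\<lambda>U. U \<subseteq> topspace X // R \<and> openin X (\<Union>U))"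

definition disc :: "complex set" where
  "disc = cball 0 1"

text \<open>Boundary identifications. For k = 0 the whole boundary circle is collapsed to a point
  (giving the sphere). For k >= 1 the boundary circle is cut into 2k arcs of angle pi/k, and
  arc 2i is glued to arc 2i+1 by the rotation by pi/k (same direction), i.e. the polygon with
  boundary word a1 a1 a2 a2 ... ak ak.\<close>
definition glue :: "nat \<Rightarrow> (complex \<times> complex) set" where
  "glue k =
     (if k = 0 then {(z, w). cmod z = 1 \<and> cmod w = 1}
      else {(cis \<theta>, cis (\<theta> + pi / real k)) | \<theta> i.
              i < k \<and> 2 * pi * real i / real k \<le> \<theta> \<and>
              \<theta> \<le> 2 * pi * real i / real k + pi / real k})"

definition glue_rel :: "nat \<Rightarrow> (complex \<times> complex) set" where
  "glue_rel k = (glue k \<union> (glue k)\<inverse> \<union> Id_on disc)\<^sup>*"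

definition Nsurf :: "nat \<Rightarrow> complex set topology" where
  "Nsurf k = quotient_top (top_of_set disc) (glue_rel k)"

text \<open>A graph is given by a vertex set V and a set E of edges, each undirected edge
  being represented once as an ordered pair (u,v) with u, v in V. Points of the
  geometric realisation: vertices, and interior points (e,t), 0<t<1, of edges.\<close>
datatype 'v gpoint = GV 'v | GE "'v \<times> 'v" real

definition gpoints :: "'v set \<Rightarrow> ('v \<times> 'v) set \<Rightarrow> 'v gpoint set" where
  "gpoints V E = GV ` V \<union> {GE e t | e t. e \<in> E \<and> 0 < t \<and> t < 1}"

fun gnbhd :: "('v \<times> 'v) set \<Rightarrow> 'v gpoint \<Rightarrow> real \<Rightarrow> 'v gpoint set" where
  "gnbhd E (GV v) d =
     {GV v} \<union> {GE e t | e t. e \<in> E \<and> fst e = v \<and> 0 < t \<and> t < 1 \<and> t < d}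
            \<union> {GE e t | e t. e \<in> E \<and> snd e = v \<and> 0 < t \<and> t < 1 \<and> 1 - d < t}"
| "gnbhd E (GE e t) d = {GE e s | s. 0 < s \<and> s < 1 \<and> \<bar>s - t\<bar> < d}"

fun realize :: "('v \<Rightarrow> 'a) \<Rightarrow> ('v \<times> 'v \<Rightarrow> real \<Rightarrow> 'a) \<Rightarrow> 'v gpoint \<Rightarrow> 'a" where
  "realize p \<gamma> (GV v) = p v"
| "realize p \<gamma> (GE e t) = \<gamma> e t"

definition crossings :: "('v \<times> 'v) set \<Rightarrow> ('v \<times> 'v \<Rightarrow> real \<Rightarrow> 'a) \<Rightarrow> 'v gpoint set set" where
  "crossings E \<gamma> =
     {{GE e s, GE f t} | e f s t. e \<in> E \<and> f \<in> E \<and> 0 < s \<and> s < 1 \<and> 0 < t \<and> t < 1 \<and>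
        GE e s \<noteq> GE f t \<and> \<gamma> e s = \<gamma> f t}"

definition drawing ::
  "'a topology \<Rightarrow> 'v set \<Rightarrow> ('v \<times> 'v) set \<Rightarrow> ('v \<Rightarrow> 'a) \<Rightarrow> ('v \<times> 'v \<Rightarrow> real \<Rightarrow> 'a) \<Rightarrow> bool" where
  "drawing X V E p \<gamma> \<longleftrightarrow>
     p ` V \<subseteq> topspace X \<and> inj_on p V \<and>
     (\<forall>e\<in>E. continuous_map (top_of_set {0..1}) X (\<gamma> e) \<and>
             \<gamma> e 0 = p (fst e) \<and> \<gamma> e 1 = p (snd e)) \<and>
     (\<forall>e\<in>E. \<forall>t. 0 < t \<and> t < 1 \<longrightarrow> \<gamma> e t \<notin> p ` V) \<and>
     (\<forall>x\<in>gpoints V E. \<exists>d>0. inj_on (realize p \<gamma>) (gnbhd E x d)) \<and>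
     finite (crossings E \<gamma>)"

definition ncr :: "nat \<Rightarrow> 'v set \<Rightarrow> ('v \<times> 'v) set \<Rightarrow> nat" where
  "ncr k V E = (LEAST c. \<exists>p \<gamma>. drawing (Nsurf k) V E p \<gamma> \<and> card (crossings E \<gamma>) = c)"

definition Kmn_V :: "nat \<Rightarrow> nat \<Rightarrow> (nat + nat) set" where
  "Kmn_V m n = Inl ` {..<m} \<union> Inr ` {..<n}"

definition Kmn_E :: "nat \<Rightarrow> nat \<Rightarrow> ((nat + nat) \<times> (nat + nat)) set" where
  "Kmn_E m n = {(Inl i, Inr j) | i j. i < m \<and> j < n}"

end

theory Submission
  imports Defs "HOL-Library.Sublist"
begin

text \<open>Lower bound. Suppose that the graph embeds in the surface. In a fine triangulation of the surface,
  the stars of the vertices thicken to disjoint connected sets of vertices of the triangulation, joined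
  by an edge of the triangulation for every edge of the graph. Cutting along
  spanning trees of these sets and along the joining edges divides the triangles into at least
  \<chi> - (m + n) + m n classes. The boundary of each class is an even set of edges and
  therefore runs through at least four of the m n joining edges, each of which borders at most two
  classes. For \<chi> = 2 - k this contradicts 2 k < (m - 2) (n - 2).

  Upper bound. A disc carrying part of the graph is enlarged step by step, the open ends along its
  boundary being rearranged by crosscaps, each of which reverses a segment of the ends. A suitable
  sequence of ((m - 2) (n - 2) - 1) / 2 reversals and one exchange of neighbouring ends, which costs
  one crossing, completes the graph.\<close>

section \<open>Reversal games\<close>

text \<open>The bounds leave no room: the face count amounts to (m - 2) (n - 2) \<le> 2 k, while
  here (m - 2) (n - 2) = 2 k + 1. For m = 2 p + 3 and n = 2 q + 3 this k is (m - 2) q + p, and the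
  game stays within it because one reversal completes two edges: when a new vertex passes a pair of
  old ones, one edge closes just before the reversal and one just after it. All vertices
  \<open>Inl i\<close> but the first and the last pass q pairs, the last but one of the vertices
  \<open>Inr j\<close> passes p pairs, and what parity leaves over is the one exchange.

  The drawing must consist of explicit maps into a disc with a fixed boundary word, although the
  game reverses arbitrary segments. Each position is therefore kept in a normal form in which the
  crosscaps follow one another along a circle and all open ends come after them.

  The edges of a given embedding are arbitrary continuous arcs, so no faces are formed on the
  surface itself. Only connectedness, and positive distances between disjoint closed sets, pass to
  the triangulation; the rest is counting mod 2.\<close>

text \<open>A strand is an edge directed away from one of its ends, (e, False) from the first one and
  (e, True) from the second one. A position of the game is a disc that contains vertices, the strands
  A leaving them, and k crosscaps, with the open ends of the unfinished strands listed along its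
  boundary; passing through a crosscap reverses a segment of open ends, and one crossing is allowed.\<close>

type_synonym 'v strand = "('v \<times> 'v) \<times> bool"

definition opp :: "'v strand \<Rightarrow> 'v strand" where
  "opp s = (fst s, \<not> snd s)"

definition vtx :: "'v strand \<Rightarrow> 'v" where
  "vtx s = (if snd s then snd (fst s) else fst (fst s))"

inductive game :: "'v strand set \<Rightarrow> nat \<Rightarrow> bool \<Rightarrow> 'v strand list \<Rightarrow> bool" where
  start: "game {} 0 False []"
| ins: "game A k x (P @ Q) \<Longrightarrow> distinct T \<Longrightarrow> \<forall>s\<in>set T. vtx s = v \<Longrightarrow> v \<notin> vtx ` A
    \<Longrightarrow> game (A \<union> set T) k x (P @ T @ Q)"
| join: "game A k x (P @ s # opp s # Q) \<Longrightarrow> game A k x (P @ Q)"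
| rev: "game A k x (P @ S @ Q) \<Longrightarrow> game A (Suc k) x (P @ rev S @ Q)"
| swap: "game A k False (P @ s # s' # Q) \<Longrightarrow> fst s \<noteq> fst s' \<Longrightarrow> game A k True (P @ s' # s # Q)"

subsection \<open>Noncrossing words\<close>

text \<open>Without alternating labels the points of equal label on a circle have pairwise disjoint
  convex hulls. \<open>X\<close> is the one exempt pair of labels; the empty set exempts nothing,
  since \<open>{a, b}\<close> is never empty.\<close>

definition nc :: "'b set \<Rightarrow> 'b list \<Rightarrow> bool" where
  "nc X xs \<longleftrightarrow> (\<forall>a b. a \<noteq> b \<longrightarrow> {a, b} \<noteq> X \<longrightarrow> \<not> subseq [a, b, a, b] xs)"

lemma subseq_filter_out:
  assumes "subseq zs (u @ w @ v)" "set zs \<inter> set w = {}" "(set u \<union> set v) \<inter> set w = {}"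
  shows "subseq zs (u @ v)"
proof -
  have "subseq (filter (\<lambda>z. z \<notin> set w) zs) (filter (\<lambda>z. z \<notin> set w) (u @ w @ v))"
    using assms(1) by (rule subseq_filter)
  moreover have "filter (\<lambda>z. z \<notin> set w) zs = zs"
    using assms(2) by (auto intro!: filter_True)
  moreover have "filter (\<lambda>z. z \<notin> set w) u = u" "filter (\<lambda>z. z \<notin> set w) v = v"
    using assms(3) by (auto intro!: filter_True)
  ultimately show ?thesis by simp
qed

lemma filter_neq: "c \<notin> set u \<Longrightarrow> filter (\<lambda>z. z \<noteq> c) u = u"
  by (induction u) auto

lemma subseq_set: "subseq xs ys \<Longrightarrow> set xs \<subseteq> set ys"
  by (induction rule: list_emb.induct) auto

lemma not_subseq_block:
  assumes "subseq [x, b, x] (u @ replicate d x @ v)" "b \<noteq> x" "x \<notin> set u" "x \<notin> set v"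
  shows False
proof -
  obtain p q where pq: "[x, b, x] = p @ q" "subseq p u" "subseq q (replicate d x @ v)"
    using assms(1) by (auto simp: subseq_append_iff)
  have "p = []"
    using pq(1) subseq_set[OF pq(2)] assms(3) by (cases p) auto
  then obtain p' q' where pq': "[x, b, x] = p' @ q'" "subseq p' (replicate d x)" "subseq q' v"
    using pq by (auto simp: subseq_append_iff)
  have "set p' \<subseteq> {x}" using subseq_set[OF pq'(2)] by (auto split: if_splits)
  moreover have "x \<notin> set q'" using subseq_set[OF pq'(3)] assms(4) by auto
  ultimately show False using pq'(1) assms(2)
    by (auto simp: Cons_eq_append_conv)
qed

text \<open>An alternation with the new letter would need another letter between two of its
  occurrences, which are contiguous; any other alternation survives the deletion of the
  block.\<close>

lemma nc_insert_block:
  assumes "nc X (u @ v)" "x \<notin> set u" "x \<notin> set v"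
  shows "nc X (u @ replicate d x @ v)"
  unfolding nc_def
proof (intro allI impI notI)
  fix a b assume ab: "a \<noteq> b" "{a, b} \<noteq> X" "subseq [a, b, a, b] (u @ replicate d x @ v)"
  consider "a = x" | "b = x" | "a \<noteq> x" "b \<noteq> x" by auto
  then show False
  proof cases
    case 1
    have "subseq [a, b, a] [a, b, a, b]" by simp
    then have "subseq [a, b, a] (u @ replicate d x @ v)"
      using ab(3) by (rule subseq_order.order_trans)
    then show False using not_subseq_block[of x b u d v] assms 1 ab(1) by auto
  next
    case 2
    have "subseq [b, a, b] [a, b, a, b]" using ab(1) by simp
    then have "subseq [b, a, b] (u @ replicate d x @ v)"
      using ab(3) by (rule subseq_order.order_trans)
    then show False using not_subseq_block[of x a u d v] assms 2 ab(1) by auto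
  next
    case 3
    have "subseq [a, b, a, b] (u @ v)"
      by (rule subseq_filter_out[OF ab(3)]) (use 3 assms in auto)
    then show False using assms(1) ab unfolding nc_def by blast
  qed
qed

text \<open>Inserted from the outside inwards: each letter is a block of length two, and the
  remaining letters go between its two occurrences.\<close>

lemma nc_insert_palindrome:
  assumes "nc X (u @ v)" "distinct zs" "set zs \<inter> (set u \<union> set v) = {}"
  shows "nc X (u @ zs @ rev zs @ v)"
  using assms
proof (induction zs arbitrary: u v)
  case (Cons z zs)
  have "nc X (u @ replicate 2 z @ v)"
    by (rule nc_insert_block) (use Cons.prems in auto)
  then have "nc X ((u @ [z]) @ ([z] @ v))" by (simp add: numeral_2_eq_2)
  then have "nc X ((u @ [z]) @ zs @ rev zs @ ([z] @ v))"
    by (rule Cons.IH) (use Cons.prems in auto)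
  then show ?case by simp
qed simp

text \<open>An alternation other than the exempt one avoids a or avoids c. Deleting that letter
  leaves a word in which the other one is a block.\<close>

lemma nc_insert_crossing:
  assumes "nc {} (u @ v)" "a \<noteq> c" "a \<notin> set u \<union> set v" "c \<notin> set u \<union> set v"
  shows "nc {a, c} (u @ [a, c, a, c] @ v)"
  unfolding nc_def
proof (intro allI impI notI)
  fix p q assume pq: "p \<noteq> q" "{p, q} \<noteq> {a, c}" "subseq [p, q, p, q] (u @ [a, c, a, c] @ v)"
  have del_c: "subseq ws (u @ [a, a] @ v)" if "subseq ws (u @ [a, c, a, c] @ v)" "c \<notin> set ws" for ws
  proof -
    have "subseq (filter (\<lambda>z. z \<noteq> c) ws) (filter (\<lambda>z. z \<noteq> c) (u @ [a, c, a, c] @ v))"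
      using that(1) by (rule subseq_filter)
    moreover have "filter (\<lambda>z. z \<noteq> c) ws = ws" by (rule filter_True) (use that(2) in auto)
    moreover have "filter (\<lambda>z. z \<noteq> c) (u @ [a, c, a, c] @ v) = u @ [a, a] @ v"
      using assms by (simp add: filter_neq)
    ultimately show ?thesis by simp
  qed
  have del_a: "subseq ws (u @ [c, c] @ v)" if "subseq ws (u @ [a, c, a, c] @ v)" "a \<notin> set ws" for ws
  proof -
    have "subseq (filter (\<lambda>z. z \<noteq> a) ws) (filter (\<lambda>z. z \<noteq> a) (u @ [a, c, a, c] @ v))"
      using that(1) by (rule subseq_filter)
    moreover have "filter (\<lambda>z. z \<noteq> a) ws = ws" by (rule filter_True) (use that(2) in auto)
    moreover have "filter (\<lambda>z. z \<noteq> a) (u @ [a, c, a, c] @ v) = u @ [c, c] @ v"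
      using assms by (simp add: filter_neq)
    ultimately show ?thesis by simp
  qed
  have "nc {} (u @ replicate 2 a @ v)" "nc {} (u @ replicate 2 c @ v)"
    using assms by (auto intro!: nc_insert_block)
  then have nc2: "nc {} (u @ [a, a] @ v)" "nc {} (u @ [c, c] @ v)" by (auto simp: numeral_2_eq_2)
  have "c \<notin> {p, q} \<or> a \<notin> {p, q}" using pq(1,2) assms(2) by auto
  then show False
  proof
    assume "c \<notin> {p, q}"
    then have "subseq [p, q, p, q] (u @ [a, a] @ v)" using del_c[OF pq(3)] by auto
    then show False using nc2(1) pq(1) unfolding nc_def by blast
  next
    assume "a \<notin> {p, q}"
    then have "subseq [p, q, p, q] (u @ [c, c] @ v)" using del_a[OF pq(3)] by auto
    then show False using nc2(2) pq(1) unfolding nc_def by blast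
  qed
qed

subsection \<open>Words interspersed with nested caps\<close>

text \<open>The first list is the second one with nested matched pairs from C inserted.\<close>

inductive capx :: "('s \<times> 's) set \<Rightarrow> 's list \<Rightarrow> 's list \<Rightarrow> bool" for C where
  Nil: "capx C [] []"
| Thr: "capx C H T \<Longrightarrow> capx C (z # H) (z # T)"
| Cap: "capx C b [] \<Longrightarrow> capx C H T \<Longrightarrow> (x, y) \<in> C \<Longrightarrow> capx C (x # b @ y # H) T"

lemma capx_mono: "capx C H T \<Longrightarrow> C \<subseteq> C' \<Longrightarrow> capx C' H T"
  by (induction rule: capx.induct) (auto intro: capx.intros)

lemma capx_append: "capx C H T \<Longrightarrow> capx C H' T' \<Longrightarrow> capx C (H @ H') (T @ T')"
proof (induction rule: capx.induct)
  case (Cap b H T x y)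
  then have "capx C (x # b @ y # (H @ H')) (T @ T')" by (intro capx.Cap) auto
  then show ?case by simp
qed (auto intro: capx.intros)

lemma capx_refl: "capx C T T"
  by (induction T) (auto intro: capx.intros)

lemma capx_Cons: "capx C H (x # T) \<Longrightarrow> \<exists>b H'. H = b @ x # H' \<and> capx C b [] \<and> capx C H' T"
proof (induction H "x # T" rule: capx.induct)
  case (Thr H)
  then show ?case by (intro exI[of _ "[]"] exI[of _ H]) (auto intro: capx.intros)
next
  case (Cap b H a y)
  then obtain b' H' where *: "H = b' @ x # H'" "capx C b' []" "capx C H' T" by blast
  have "capx C (a # b @ y # b') []" using Cap * by (intro capx.Cap) auto
  then show ?case using * by (intro exI[of _ "a # b @ y # b'"] exI[of _ H']) auto
qed

text \<open>No cap encloses a through letter, so \<open>H\<close> can be cut between any two of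
  them.\<close>

lemma capx_split:
  "capx C H (T1 @ T2) \<Longrightarrow> \<exists>H1 H2. H = H1 @ H2 \<and> capx C H1 T1 \<and> capx C H2 T2"
proof (induction T1 arbitrary: H)
  case Nil
  then show ?case by (intro exI[of _ "[]"] exI[of _ H]) (auto intro: capx.intros)
next
  case (Cons x T1)
  then obtain b H' where *: "H = b @ x # H'" "capx C b []" "capx C H' (T1 @ T2)"
    using capx_Cons[of C H x "T1 @ T2"] by auto
  from Cons.IH[OF *(3)] obtain H1 H2 where **: "H' = H1 @ H2" "capx C H1 T1" "capx C H2 T2" by blast
  have "capx C (b @ x # H1) ([] @ x # T1)" using * ** by (intro capx_append capx.Thr)
  then show ?case using * ** by (intro exI[of _ "b @ x # H1"] exI[of _ H2]) auto
qed

lemma capx_set: "capx C H T \<Longrightarrow> set T \<subseteq> set H"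
  by (induction rule: capx.induct) auto

lemma capx_distinct: "capx C H T \<Longrightarrow> distinct H \<Longrightarrow> distinct T"
proof (induction rule: capx.induct)
  case (Thr H T z)
  then show ?case using capx_set[OF Thr(1)] by auto
qed auto

subsection \<open>Diagrams\<close>

text \<open>In the drawing of a position every strand s meets a fixed circle in points (s, 0), (s, 1), ...,
  (s, 2 * l s). Inside the circle, (s, 0) is joined to its vertex and (s, 2 * r - 1) to (s, 2 * r),
  which is what lab records. Outside, (s, 2 * r) is joined to (s, 2 * r + 1) by a cap from C or, if it
  occurs in some T of D, through the crosscap of that entry of D; (s, 2 * l s) is an open end or is
  joined to the last point of opp s. The set X holds the labels of the only two chords that may cross.\<close>

type_synonym 'v slot = "'v strand \<times> nat"

definition lab :: "'v slot \<Rightarrow> 'v + 'v strand \<times> nat" where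
  "lab x = (if snd x = 0 then Inl (vtx (fst x)) else Inr (fst x, (snd x + 1) div 2))"

abbreviation suc :: "'v slot \<Rightarrow> 'v slot" where
  "suc x \<equiv> (fst x, Suc (snd x))"

text \<open>The circle is read crosscap by crosscap. The images of \<open>T\<close> keep their
  order, because the two arcs of a pair are glued by a rotation; \<open>suc\<close> will correspond
  to adding the angle pi / k.\<close>

definition wd :: "('v slot list \<times> 'v slot list) list \<Rightarrow> 'v slot list \<Rightarrow> 'v slot list" where
  "wd D M = concat (map (\<lambda>(H, T). H @ map suc T) D) @ M"

definition capok :: "('v strand \<Rightarrow> nat) \<Rightarrow> 'v strand set \<Rightarrow> 'v slot \<times> 'v slot \<Rightarrow> bool" where
  "capok l F c \<longleftrightarrow> (case c of ((s, i), (s', j)) \<Rightarrow>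
     (s' = s \<and> even (min i j) \<and> (j = Suc i \<or> i = Suc j) \<and> max i j \<le> 2 * l s) \<or>
     (s' = opp s \<and> i = 2 * l s \<and> j = 2 * l s' \<and> s \<notin> F \<and> s' \<notin> F))"

definition diag ::
  "'v strand set \<Rightarrow> nat \<Rightarrow> bool \<Rightarrow> 'v strand list \<Rightarrow> ('v slot list \<times> 'v slot list) list \<Rightarrow>
   'v slot list \<Rightarrow> ('v strand \<Rightarrow> nat) \<Rightarrow> ('v slot \<times> 'v slot) set \<Rightarrow> ('v + 'v strand \<times> nat) set \<Rightarrow> bool"
where
  "diag A k x F D M l C X \<longleftrightarrow>
     length D = k \<and> distinct (wd D M) \<and> set (wd D M) = {(s, i). s \<in> A \<and> i \<le> 2 * l s} \<and>
     nc X (map lab (wd D M)) \<and>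
     (\<forall>(H, T)\<in>set D. capx C H T \<and> (\<forall>(s, i)\<in>set T. even i \<and> i < 2 * l s)) \<and>
     capx C M (map (\<lambda>s. (s, 2 * l s)) F) \<and>
     (\<forall>c\<in>C. capok l (set F) c \<and> fst (fst c) \<in> A \<and> fst (snd c) \<in> A) \<and>
     (if x then \<exists>s r s' r'. X = {Inr (s, r), Inr (s', r')} \<and> fst s \<noteq> fst s' else X = {})"

lemma diagD:
  assumes "diag A k x F D M l C X"
  shows "length D = k" "distinct (wd D M)" "set (wd D M) = {(s, i). s \<in> A \<and> i \<le> 2 * l s}"
    "nc X (map lab (wd D M))" "\<And>H T. (H, T) \<in> set D \<Longrightarrow> capx C H T"
    "\<And>H T s i. (H, T) \<in> set D \<Longrightarrow> (s, i) \<in> set T \<Longrightarrow> even i \<and> i < 2 * l s \<and> s \<in> A"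
    "capx C M (map (\<lambda>s. (s, 2 * l s)) F)"
    "\<And>c. c \<in> C \<Longrightarrow> capok l (set F) c \<and> fst (fst c) \<in> A \<and> fst (snd c) \<in> A"
    "if x then \<exists>s r s' r'. X = {Inr (s, r), Inr (s', r')} \<and> fst s \<noteq> fst s' else X = {}"
    "set F \<subseteq> A"
proof -
  note a = assms[unfolded diag_def]
  show "length D = k" by (rule a[THEN conjunct1])
  note a = a[THEN conjunct2]
  show "distinct (wd D M)" by (rule a[THEN conjunct1])
  note a = a[THEN conjunct2]
  show W: "set (wd D M) = {(s, i). s \<in> A \<and> i \<le> 2 * l s}" by (rule a[THEN conjunct1])
  note a = a[THEN conjunct2]
  show "nc X (map lab (wd D M))" by (rule a[THEN conjunct1])
  note a = a[THEN conjunct2]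
  note D = a[THEN conjunct1]
  note a = a[THEN conjunct2]
  show M: "capx C M (map (\<lambda>s. (s, 2 * l s)) F)" by (rule a[THEN conjunct1])
  note a = a[THEN conjunct2]
  note C = a[THEN conjunct1]
  show "if x then \<exists>s r s' r'. X = {Inr (s, r), Inr (s', r')} \<and> fst s \<noteq> fst s' else X = {}"
    by (rule a[THEN conjunct2])
  show H: "capx C H T" if "(H, T) \<in> set D" for H T using bspec[OF D that] by simp
  show "capok l (set F) c \<and> fst (fst c) \<in> A \<and> fst (snd c) \<in> A" if "c \<in> C" for c
    using bspec[OF C that] .
  have "set (map (\<lambda>s. (s, 2 * l s)) F) \<subseteq> set (wd D M)"
    using capx_set[OF M] by (auto simp: wd_def)
  then show "set F \<subseteq> A" unfolding W by auto
  show "even i \<and> i < 2 * l s \<and> s \<in> A" if T: "(H, T) \<in> set D" "(s, i) \<in> set T" for H T s i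
  proof -
    have "\<forall>(s, i)\<in>set T. even i \<and> i < 2 * l s" using bspec[OF D T(1)] by simp
    then have 1: "even i" "i < 2 * l s" using T(2) by auto
    have "(s, i) \<in> set H" using capx_set[OF H[OF T(1)]] T(2) by auto
    then have "(s, i) \<in> set (wd D M)" using T(1) by (force simp: wd_def)
    then show ?thesis using 1 unfolding W by auto
  qed
qed

lemma diagI:
  assumes "length D = k" "distinct (wd D M)" "set (wd D M) = {(s, i). s \<in> A \<and> i \<le> 2 * l s}"
    "nc X (map lab (wd D M))" "\<And>H T. (H, T) \<in> set D \<Longrightarrow> capx C H T"
    "\<And>H T s i. (H, T) \<in> set D \<Longrightarrow> (s, i) \<in> set T \<Longrightarrow> even i \<and> i < 2 * l s"
    "capx C M (map (\<lambda>s. (s, 2 * l s)) F)"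
    "\<And>c. c \<in> C \<Longrightarrow> capok l (set F) c \<and> fst (fst c) \<in> A \<and> fst (snd c) \<in> A"
    "if x then \<exists>s r s' r'. X = {Inr (s, r), Inr (s', r')} \<and> fst s \<noteq> fst s' else X = {}"
  shows "diag A k x F D M l C X"
  unfolding diag_def
proof (intro conjI)
  show "\<forall>(H, T)\<in>set D. capx C H T \<and> (\<forall>(s, i)\<in>set T. even i \<and> i < 2 * l s)"
    using assms(5,6) by blast
  show "\<forall>c\<in>C. capok l (set F) c \<and> fst (fst c) \<in> A \<and> fst (snd c) \<in> A"
    using assms(8) by blast
qed (rule assms)+

lemma opp_opp[simp]: "opp (opp s) = s" by (simp add: opp_def)
lemma fst_opp[simp]: "fst (opp s) = fst s" by (simp add: opp_def)
lemma opp_neq[simp]: "opp s \<noteq> s" "s \<noteq> opp s" by (auto simp: opp_def prod_eq_iff)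

section \<open>The moves of the game as changes of the diagram\<close>

lemma diag_start: "diag {} 0 False [] [] [] (\<lambda>_. 0) {} {}"
  by (auto simp: diag_def wd_def nc_def intro: capx.intros)

text \<open>The first points of the new strands are contiguous and carry one fresh label, that of
  the new vertex, so \<open>nc_insert_block\<close> applies. They enter \<open>M\<close> as through
  letters at the place where the list of open ends is cut.\<close>

lemma diag_ins:
  assumes d: "diag A k x (P @ Q) D M l C X" and T: "distinct T" "\<forall>s\<in>set T. vtx s = v" "v \<notin> vtx ` A"
  shows "\<exists>D M l C X. diag (A \<union> set T) k x (P @ T @ Q) D M l C X"
proof -
  note d = diagD[OF d]
  define l' where "l' = (\<lambda>s. if s \<in> set T then 0 else l s)"
  have TA: "set T \<inter> A = {}" using T by auto
  have l': "l' s = l s" if "s \<in> A" for s using that TA by (auto simp: l'_def)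
  from d(7) obtain M1 M2 where M: "M = M1 @ M2" "capx C M1 (map (\<lambda>s. (s, 2 * l s)) P)"
     "capx C M2 (map (\<lambda>s. (s, 2 * l s)) Q)"
    by (auto dest: capx_split)
  have PQ: "set P \<subseteq> A" "set Q \<subseteq> A"
    using d(10) by auto
  let ?N = "map (\<lambda>s. (s, 0)) T"
  let ?M = "M1 @ ?N @ M2"
  obtain u where u: "wd D M = (u @ M1) @ M2" "wd D ?M = (u @ M1) @ ?N @ M2"
    unfolding wd_def M(1) by simp
  have set_u: "set (u @ M1) \<union> set M2 = {(s, i). s \<in> A \<and> i \<le> 2 * l s}"
    using d(3) unfolding u(1) by auto
  have fresh: "set ?N \<inter> (set (u @ M1) \<union> set M2) = {}"
    unfolding set_u using TA by auto
  have "diag (A \<union> set T) k x (P @ T @ Q) D ?M l' C X"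
  proof (rule diagI)
    show "distinct (wd D ?M)"
      using d(2) fresh T(1) unfolding u by (auto simp: distinct_map inj_on_def)
    have "set (wd D ?M) = set ?N \<union> {(s, i). s \<in> A \<and> i \<le> 2 * l s}"
      unfolding u(2) using set_u by auto
    also have "\<dots> = {(s, i). s \<in> A \<union> set T \<and> i \<le> 2 * l' s}"
      using l' TA by (auto simp: l'_def)
    finally show "set (wd D ?M) = {(s, i). s \<in> A \<union> set T \<and> i \<le> 2 * l' s}" .
    have eq: "map lab ?N = replicate (length T) (Inl v)"
      using T(2) by (auto simp: lab_def map_replicate_const[symmetric])
    have "Inl v \<notin> lab ` (set (u @ M1) \<union> set M2)"
      unfolding set_u using T(3) by (auto simp: lab_def)
    then have "nc X (map lab (u @ M1) @ replicate (length T) (Inl v) @ map lab M2)"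
      using d(4) unfolding u(1) by (intro nc_insert_block) (auto simp: image_Un)
    then show "nc X (map lab (wd D ?M))" unfolding u(2) eq[symmetric] by simp
    show "even i \<and> i < 2 * l' s" if "(H, T) \<in> set D" "(s, i) \<in> set T" for H T s i
      using d(6)[OF that] l' by simp
    have 1: "map (\<lambda>s. (s, 2 * l' s)) P = map (\<lambda>s. (s, 2 * l s)) P"
      "map (\<lambda>s. (s, 2 * l' s)) Q = map (\<lambda>s. (s, 2 * l s)) Q"
      using PQ l' by auto
    have 2: "map (\<lambda>s. (s, 2 * l' s)) T = ?N" by (auto simp: l'_def)
    show "capx C ?M (map (\<lambda>s. (s, 2 * l' s)) (P @ T @ Q))"
      unfolding map_append 1 2 using M by (intro capx_append capx_refl)
    show "capok l' (set (P @ T @ Q)) c \<and> fst (fst c) \<in> A \<union> set T \<and> fst (snd c) \<in> A \<union> set T"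
      if "c \<in> C" for c
    proof -
      obtain s i s' j where c: "c = ((s, i), (s', j))" by (metis surj_pair)
      have "s \<in> A" "s' \<in> A" "s \<notin> set T" "s' \<notin> set T" using d(8)[OF that] TA unfolding c by auto
      then show ?thesis using d(8)[OF that] l' unfolding c capok_def by auto
    qed
    show "if x then \<exists>s r s' r'. X = {Inr (s, r), Inr (s', r')} \<and> fst s \<noteq> fst s' else X = {}"
      by (fact d(9))
  qed (fact d(1), fact d(5))
  then show ?thesis by blast
qed

text \<open>Only complete caps stand between the last points of two neighbouring open ends, so a new
  cap over them is properly nested. The word itself does not change.\<close>

lemma diag_join:
  assumes d: "diag A k x (P @ s # opp s # Q) D M l C X"
  shows "\<exists>D M l C X. diag A k x (P @ Q) D M l C X"
proof -
  note d = diagD[OF d]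
  let ?o = "\<lambda>s. (s, 2 * l s)"
  have "capx C M (map ?o P @ map ?o [s] @ map ?o (opp s # Q))" using d(7) by simp
  then obtain M1 M2 where M: "M = M1 @ M2" "capx C M1 (map ?o P)"
     "capx C M2 (?o s # ?o (opp s) # map ?o Q)"
    by (auto dest: capx_split)
  obtain b N where b1: "M2 = b @ ?o s # N" "capx C b []" "capx C N (?o (opp s) # map ?o Q)"
    using capx_Cons[OF M(3)] by blast
  obtain b' M3 where b2: "N = b' @ ?o (opp s) # M3" "capx C b' []" "capx C M3 (map ?o Q)"
    using capx_Cons[OF b1(3)] by blast
  have b: "M2 = b @ ?o s # b' @ ?o (opp s) # M3" "capx C b []" "capx C b' []" "capx C M3 (map ?o Q)"
    using b1 b2 by auto
  define C' where "C' = insert (?o s, ?o (opp s)) C"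
  have CC': "C \<subseteq> C'" by (auto simp: C'_def)
  have dF: "distinct (map ?o (P @ s # opp s # Q))"
    using capx_distinct[OF d(7)] d(2) by (auto simp: wd_def)
  have "diag A k x (P @ Q) D M l C' X"
  proof (rule diagI)
    show "capx C' H T" if "(H, T) \<in> set D" for H T
      using capx_mono[OF d(5)[OF that] CC'] .
    have "capx C' (?o s # b' @ ?o (opp s) # M3) (map ?o Q)"
      by (rule capx.Cap) (use b capx_mono CC' in \<open>auto simp: C'_def\<close>)
    then have "capx C' (M1 @ b @ (?o s # b' @ ?o (opp s) # M3)) (map ?o P @ [] @ map ?o Q)"
      by (intro capx_append) (use M b capx_mono CC' in auto)
    then show "capx C' M (map ?o (P @ Q))" unfolding M(1) b(1) by simp
    show "capok l (set (P @ Q)) c \<and> fst (fst c) \<in> A \<and> fst (snd c) \<in> A" if "c \<in> C'" for c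
    proof (cases "c \<in> C")
      case True
      then show ?thesis using d(8)[OF True] by (auto simp: capok_def)
    next
      case False
      then have "c = (?o s, ?o (opp s))" using that by (auto simp: C'_def)
      then show ?thesis using dF d(10) by (auto simp: capok_def distinct_map)
    qed
    show "even i \<and> i < 2 * l s" if "(H, T) \<in> set D" "(s, i) \<in> set T" for H T s i
      using d(6)[OF that] by simp
    show "if x then \<exists>s r s' r'. X = {Inr (s, r), Inr (s', r')} \<and> fst s \<noteq> fst s' else X = {}"
      by (fact d(9))
  qed (fact d(1), fact d(2), fact d(3), fact d(4))
  then show ?thesis by blast
qed

text \<open>Lengthening a strand moves only its last point. A cap at last points belongs to strands
  that are no longer open, and these keep their length.\<close>

lemma capok_mono:
  assumes "capok l F c" "\<And>t. l t \<le> l' t" "\<And>t. t \<notin> F \<Longrightarrow> l' t = l t"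
  shows "capok l' F c"
proof -
  obtain s i s' j where c: "c = ((s, i), (s', j))" by (metis surj_pair)
  have "2 * l s \<le> 2 * l' s" using assms(2)[of s] by simp
  then show ?thesis
    using assms(1) assms(3)[of s] assms(3)[of s'] unfolding c capok_def prod.case
    by (elim disjE) linarith+
qed

text \<open>All open ends have to come after the arcs of the new crosscap, so the strands of
  \<open>P\<close> must pass it as well. They pass it twice, which restores their order and costs
  four points each; those of \<open>S\<close> pass it once, which reverses them and costs two points
  each.\<close>

lemma diag_rev:
  assumes d: "diag A k x (P @ S @ Q) D M l C X"
  shows "\<exists>D M l C X. diag A (Suc k) x (P @ rev S @ Q) D M l C X"
proof -
  note d = diagD[OF d]
  define l' where "l' = (\<lambda>s. l s + (if s \<in> set P then 2 else if s \<in> set S then 1 else 0))"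
  let ?o = "\<lambda>s. (s, 2 * l s)"
  let ?o' = "\<lambda>s. (s, 2 * l' s)"
  have "capx C M (map ?o (P @ S) @ map ?o Q)" using d(7) by simp
  then obtain M1 M2 where M: "M = M1 @ M2" "capx C M1 (map ?o (P @ S))" "capx C M2 (map ?o Q)"
    by (blast dest: capx_split)
  have "distinct (map ?o (P @ S @ Q))"
    using capx_distinct[OF d(7)] d(2) by (simp add: wd_def)
  then have dis: "distinct (P @ S @ Q)" by (simp only: distinct_map)
  have PSQ: "set P \<subseteq> A" "set S \<subseteq> A" "set Q \<subseteq> A" using d(10) by auto
  have lP: "l' s = l s + 2" if "s \<in> set P" for s using that by (simp add: l'_def)
  have lS: "l' s = l s + 1" if "s \<in> set S" for s using that dis by (auto simp: l'_def)
  have lo: "l' s = l s" if "s \<notin> set P" "s \<notin> set S" for s using that by (simp add: l'_def)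
  \<comment> \<open>The strands of \<open>P\<close> come back to the first arc for their second
    passage. They arrive in reversed order, so that the chords leading there are nested.\<close>
  define R where "R = map (\<lambda>s. (s, 2 * l s + 2)) (rev P)"
  define T where "T = map ?o (P @ S) @ R"
  define D' where "D' = D @ [(M1 @ R, T)]"
  define M' where "M' = map ?o' (P @ rev S) @ M2"
  define N1 where "N1 = R @ map (\<lambda>s. (s, 2 * l s + 1)) P"
  define N2 where "N2 = map (\<lambda>s. (s, 2 * l s + 1)) S @ map (\<lambda>s. (s, 2 * l s + 3)) (rev P)
      @ map (\<lambda>s. (s, 2 * l s + 4)) P @ map (\<lambda>s. (s, 2 * l s + 2)) (rev S)"
  obtain u where u: "wd D M = (u @ M1) @ M2" "\<And>M. wd D M = u @ M"
    unfolding wd_def M(1) by simp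
  have w': "wd D' M' = (u @ M1) @ N1 @ N2 @ M2"
  proof -
    have "map suc T = map (\<lambda>s. (s, 2 * l s + 1)) P @ map (\<lambda>s. (s, 2 * l s + 1)) S
        @ map (\<lambda>s. (s, 2 * l s + 3)) (rev P)"
      by (simp add: T_def R_def)
    moreover have "map ?o' (P @ rev S) = map (\<lambda>s. (s, 2 * l s + 4)) P @ map (\<lambda>s. (s, 2 * l s + 2)) (rev S)"
      using lP lS by auto
    moreover have "wd D' M' = u @ (M1 @ R) @ map suc T @ M'"
      using u(2)[of "[]"] by (simp add: wd_def D'_def)
    ultimately show ?thesis by (simp add: M'_def N1_def N2_def)
  qed
  have set_u: "set (u @ M1) \<union> set M2 = {(s, i). s \<in> A \<and> i \<le> 2 * l s}"
    using d(3) unfolding u(1) by auto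
  have setN: "set (N1 @ N2) = {(s, i). s \<in> A \<and> 2 * l s < i \<and> i \<le> 2 * l' s}" (is "_ = ?N")
  proof (intro set_eqI iffI)
    fix y assume "y \<in> set (N1 @ N2)"
    then show "y \<in> ?N" using PSQ lP lS by (auto simp: N1_def N2_def R_def)
  next
    fix y assume "y \<in> ?N"
    then obtain s i where y: "y = (s, i)" "s \<in> A" "2 * l s < i" "i \<le> 2 * l' s" by auto
    show "y \<in> set (N1 @ N2)"
    proof (cases "s \<in> set P")
      case True
      then have "i = 2 * l s + 1 \<or> i = 2 * l s + 2 \<or> i = 2 * l s + 3 \<or> i = 2 * l s + 4"
        using y lP by auto
      then show ?thesis using True by (auto simp: N1_def N2_def R_def y(1))
    next
      case False
      then have S: "s \<in> set S" using y lo[of s] by (cases "s \<in> set S") auto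
      then have "i = 2 * l s + 1 \<or> i = 2 * l s + 2" using y lS by auto
      then show ?thesis using S by (auto simp: N1_def N2_def R_def y(1))
    qed
  qed
  have disN: "distinct (N1 @ N2)"
    using dis by (auto simp: N1_def N2_def R_def distinct_map inj_on_def)
  have "diag A (Suc k) x (P @ rev S @ Q) D' M' l' C X"
  proof (rule diagI)
    show "length D' = Suc k" using d(1) by (simp add: D'_def)
    have disj: "set (N1 @ N2) \<inter> (set (u @ M1) \<union> set M2) = {}"
      unfolding setN set_u by auto
    show "distinct (wd D' M')"
      using d(2) disj disN unfolding w' u(1) by auto
    have "set (wd D' M') = set (N1 @ N2) \<union> (set (u @ M1) \<union> set M2)"
      unfolding w' by auto
    also have "\<dots> = {(s, i). s \<in> A \<and> i \<le> 2 * l' s}"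
      unfolding setN set_u by (auto simp: l'_def)
    finally show "set (wd D' M') = {(s, i). s \<in> A \<and> i \<le> 2 * l' s}" .
    show "nc X (map lab (wd D' M'))"
    \<comment> \<open>In the labels both inserted words are palindromes: \<open>N1\<close> carries
      the chords of \<open>P\<close> between its two passages, \<open>N2\<close> the chords of
      \<open>S\<close> and \<open>P\<close> after the last passage.\<close>
    proof -
      define p1 where "p1 = map (\<lambda>s. Inr (s, l s + 1) :: 'a + 'a strand \<times> nat) P"
      define z2 where "z2 = map (\<lambda>s. Inr (s, l s + 1) :: 'a + 'a strand \<times> nat) S
          @ rev (map (\<lambda>s. Inr (s, l s + 2)) P)"
      have l1: "map lab N1 = rev p1 @ rev (rev p1)"
        by (simp add: N1_def R_def p1_def lab_def rev_map o_def)
      have l2: "map lab N2 = z2 @ rev z2"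
        by (simp add: N2_def z2_def lab_def rev_map o_def numeral_3_eq_3)
      have old: "Inr (s, r) \<notin> lab ` (set (u @ M1) \<union> set M2)" if "l s < r" for s r
        unfolding set_u using that by (auto simp: lab_def split: if_splits)
      have new: "set z \<inter> (set (map lab (u @ M1)) \<union> set (map lab M2)) = {}"
        if "set z \<subseteq> {Inr (s, r) | s r. l s < r}" for z
      proof -
        have "set (map lab (u @ M1)) \<union> set (map lab M2) = lab ` (set (u @ M1) \<union> set M2)" by auto
        then show ?thesis using that old by blast
      qed
      have p1: "set (rev p1) \<subseteq> {Inr (s, r) | s r. l s < r}" by (auto simp: p1_def)
      have z2: "set z2 \<subseteq> {Inr (s, r) | s r. l s < r}" by (auto simp: z2_def)
      have pz: "set (rev p1) \<inter> set z2 = {}" using dis by (auto simp: p1_def z2_def)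
      have "nc X (map lab (u @ M1) @ map lab M2)" using d(4) unfolding u(1) by simp
      then have "nc X (map lab (u @ M1) @ z2 @ rev z2 @ map lab M2)"
      proof (rule nc_insert_palindrome)
        show "distinct z2" using dis by (auto simp: z2_def distinct_map inj_on_def)
        show "set z2 \<inter> (set (map lab (u @ M1)) \<union> set (map lab M2)) = {}"
          by (rule new[OF z2])
      qed
      then have "nc X (map lab (u @ M1) @ rev p1 @ rev (rev p1) @ z2 @ rev z2 @ map lab M2)"
      proof (rule nc_insert_palindrome)
        show "distinct (rev p1)" using dis by (auto simp: p1_def distinct_map inj_on_def)
        show "set (rev p1) \<inter> (set (map lab (u @ M1)) \<union> set (z2 @ rev z2 @ map lab M2)) = {}"
          using new[OF p1] pz by auto
      qed
      then show ?thesis unfolding w' map_append l1 l2 by simp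
    qed
    show "capx C H T'" if "(H, T') \<in> set D'" for H T'
    proof -
      have "capx C (M1 @ R) T" unfolding T_def using M by (intro capx_append capx_refl)
      then show ?thesis using that d(5) by (auto simp: D'_def)
    qed
    show "even i \<and> i < 2 * l' s" if "(H, T') \<in> set D'" "(s, i) \<in> set T'" for H T' s i
    proof (cases "(H, T') \<in> set D")
      case True
      then show ?thesis using d(6)[OF True that(2)] by (auto simp: l'_def)
    next
      case False
      then have "(s, i) \<in> set T" using that by (auto simp: D'_def)
      then show ?thesis using lP lS by (auto simp: T_def R_def)
    qed
    have 1: "map ?o Q = map ?o' Q"
    proof (rule map_cong[OF refl])
      fix t assume "t \<in> set Q"
      then have "t \<notin> set P" "t \<notin> set S" using dis by auto
      then show "?o t = ?o' t" using lo by simp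
    qed
    have "capx C M' (map ?o' (P @ rev S) @ map ?o' Q)"
      unfolding M'_def using M(3) unfolding 1 by (intro capx_append capx_refl)
    then show "capx C M' (map ?o' (P @ rev S @ Q))" by simp
    show "capok l' (set (P @ rev S @ Q)) c \<and> fst (fst c) \<in> A \<and> fst (snd c) \<in> A" if "c \<in> C" for c
    proof -
      have 1: "set (P @ rev S @ Q) = set (P @ S @ Q)" by auto
      have "capok l' (set (P @ S @ Q)) c"
        by (rule capok_mono[of l]) (use d(8)[OF that] in \<open>auto simp: l'_def\<close>)
      then show ?thesis using d(8)[OF that] unfolding 1 by simp
    qed
    show "if x then \<exists>s r s' r'. X = {Inr (s, r), Inr (s', r')} \<and> fst s \<noteq> fst s' else X = {}"
      by (fact d(9))
  qed
  then show ?thesis by blast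
qed

text \<open>Two open ends are exchanged by wiggling both of them: each strand returns to the circle
  through a cap and leaves it again, so that the two strands cross in chords.\<close>

lemma diag_swap:
  assumes d: "diag A k False (P @ s # s' # Q) D M l C X" and ss': "fst s \<noteq> fst s'"
  shows "\<exists>D M l C X. diag A k True (P @ s' # s # Q) D M l C X"
proof -
  note d = diagD[OF d]
  let ?o = "\<lambda>s. (s, 2 * l s)"
  define l' where "l' = l(s := l s + 1, s' := l s' + 1)"
  let ?o' = "\<lambda>s. (s, 2 * l' s)"
  have neq: "s \<noteq> s'" using ss' by auto
  have "capx C M (map ?o P @ ?o s # ?o s' # map ?o Q)" using d(7) by simp
  then obtain M1 N0 where M0: "M = M1 @ N0" "capx C M1 (map ?o P)" "capx C N0 (?o s # ?o s' # map ?o Q)"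
    by (auto dest: capx_split)
  obtain b1 N where b1: "N0 = b1 @ ?o s # N" "capx C b1 []" "capx C N (?o s' # map ?o Q)"
    using capx_Cons[OF M0(3)] by blast
  obtain b M3 where b2: "N = b @ ?o s' # M3" "capx C b []" "capx C M3 (map ?o Q)"
    using capx_Cons[OF b1(3)] by blast
  define B where "B = M1 @ b1 @ ?o s # b"
  define E where "E = ?o s' # M3"
  define I where "I = [(s, 2 * l s + 1), (s', 2 * l s' + 2), (s, 2 * l s + 2), (s', 2 * l s' + 1)]"
  have ME: "M = B @ E" unfolding M0(1) b1(1) b2(1) B_def E_def by simp
  have "distinct (map ?o (P @ s # s' # Q))"
    using capx_distinct[OF d(7)] d(2) by (simp add: wd_def)
  then have dis: "distinct (P @ s # s' # Q)" by (simp only: distinct_map)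
  have inA: "s \<in> A" "s' \<in> A" using d(10) by auto
  define C' where "C' = C \<union> {(?o s, (s, 2 * l s + 1)), ((s', 2 * l s' + 1), ?o s')}"
  have CC': "C \<subseteq> C'" by (auto simp: C'_def)
  have X: "X = {}" using d(9) by simp
  define a where "a = (Inr (s, l s + 1) :: 'a + 'a strand \<times> nat)"
  define c where "c = (Inr (s', l s' + 1) :: 'a + 'a strand \<times> nat)"
  obtain u where u: "wd D M = (u @ B) @ E" "\<And>M. wd D M = u @ M"
    unfolding wd_def ME by simp
  have set_u: "set (u @ B) \<union> set E = {(s, i). s \<in> A \<and> i \<le> 2 * l s}"
    using d(3) unfolding u(1) by auto
  have w: "wd D (B @ I @ E) = (u @ B) @ I @ E" using u(2) by simp
  have dBE: "distinct ((u @ B) @ E)" using d(2) unfolding u(1) .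
  have l'ge: "l t \<le> l' t" for t by (auto simp: l'_def)
  have "diag A k True (P @ s' # s # Q) D (B @ I @ E) l' C' {a, c}"
  proof (rule diagI)
    have fresh: "set I \<inter> (set (u @ B) \<union> set E) = {}" unfolding set_u I_def by auto
    show "distinct (wd D (B @ I @ E))"
      using dBE fresh neq unfolding w by (auto simp: I_def)
    have "set (wd D (B @ I @ E)) = set I \<union> (set (u @ B) \<union> set E)" unfolding w by auto
    also have "\<dots> = {(t, i). t \<in> A \<and> i \<le> 2 * l' t}"
    proof (rule set_eqI)
      fix y :: "'a slot"
      obtain t i where y: "y = (t, i)" by (cases y)
      show "y \<in> set I \<union> (set (u @ B) \<union> set E) \<longleftrightarrow> y \<in> {(t, i). t \<in> A \<and> i \<le> 2 * l' t}"
        unfolding set_u y using inA neq by (cases "t = s"; cases "t = s'") (auto simp: I_def l'_def)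
    qed
    finally show "set (wd D (B @ I @ E)) = {(t, i). t \<in> A \<and> i \<le> 2 * l' t}" .
    have "nc {a, c} (map lab (u @ B) @ [a, c, a, c] @ map lab E)"
    proof (rule nc_insert_crossing)
      show "nc {} (map lab (u @ B) @ map lab E)" using d(4) X unfolding u(1) by simp
      show "a \<noteq> c" using neq by (simp add: a_def c_def)
      have old: "Inr (t, r) \<notin> lab ` (set (u @ B) \<union> set E)" if "l t < r" for t r
        unfolding set_u using that by (auto simp: lab_def split: if_splits)
      show "a \<notin> set (map lab (u @ B)) \<union> set (map lab E)"
        "c \<notin> set (map lab (u @ B)) \<union> set (map lab E)"
        using old[of s "l s + 1"] old[of s' "l s' + 1"] by (auto simp: a_def c_def image_Un)
    qed
    moreover have "map lab I = [a, c, a, c]" by (simp add: I_def a_def c_def lab_def)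
    ultimately show "nc {a, c} (map lab (wd D (B @ I @ E)))" unfolding w by simp
    show "capx C' H T" if "(H, T) \<in> set D" for H T using capx_mono[OF d(5)[OF that] CC'] .
    show "even i \<and> i < 2 * l' t" if "(H, T) \<in> set D" "(t, i) \<in> set T" for H T t i
      using d(6)[OF that] l'ge[of t] by simp
    have 1: "map ?o P = map ?o' P" "map ?o Q = map ?o' Q" using dis by (auto simp: l'_def)
    have 2: "?o' s = (s, 2 * l s + 2)" "?o' s' = (s', 2 * l s' + 2)" using neq by (auto simp: l'_def)
    have c1: "capx C' (M1 @ b1) (map ?o' P @ [])"
      using M0(2) b1(2) CC' unfolding 1(1) by (intro capx_append) (auto intro: capx_mono)
    have c2: "capx C' ((s', 2 * l s' + 1) # [] @ ?o s' # M3) (map ?o' Q)"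
      using b2(3) CC' unfolding 1(2) by (intro capx.Cap capx.Nil) (auto intro: capx_mono simp: C'_def)
    have c3: "capx C' (?o s # b @ (s, 2 * l s + 1) # (?o' s' # ?o' s # ((s', 2 * l s' + 1) # [] @ ?o s' # M3)))
        (?o' s' # ?o' s # map ?o' Q)"
      by (rule capx.Cap[OF capx_mono[OF b2(2) CC'] capx.Thr[OF capx.Thr[OF c2]]]) (simp add: C'_def)
    show "capx C' (B @ I @ E) (map ?o' (P @ s' # s # Q))"
      using capx_append[OF c1 c3] by (simp add: B_def E_def I_def 2)
    show "capok l' (set (P @ s' # s # Q)) e \<and> fst (fst e) \<in> A \<and> fst (snd e) \<in> A" if "e \<in> C'" for e
    proof (cases "e \<in> C")
      case True
      have 1: "set (P @ s' # s # Q) = set (P @ s # s' # Q)" by auto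
      have "capok l' (set (P @ s # s' # Q)) e"
        by (rule capok_mono[of l]) (use d(8)[OF True] in \<open>auto simp: l'_def\<close>)
      then show ?thesis using d(8)[OF True] unfolding 1 by simp
    next
      case False
      then show ?thesis using that inA neq by (auto simp: C'_def capok_def l'_def)
    qed
    show "if True then \<exists>s r s' r'. {a, c} = {Inr (s, r), Inr (s', r')} \<and> fst s \<noteq> fst s' else {a, c} = {}"
      using ss' unfolding a_def c_def if_True by blast
    show "length D = k" by (fact d(1))
  qed
  then show ?thesis by blast
qed

lemma game_diag: "game A k x F \<Longrightarrow> \<exists>D M l C X. diag A k x F D M l C X"
proof (induction rule: game.induct)
  case start
  then show ?case using diag_start by blast
next
  case (ins A k x P Q T v)
  from ins.IH ins.hyps(2-) show ?case by (elim exE) (rule diag_ins)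
next
  case (join A k x P s Q)
  from join.IH show ?case by (elim exE) (rule diag_join)
next
  case (rev A k x P S Q)
  from rev.IH show ?case by (elim exE) (rule diag_rev)
next
  case (swap A k P s s' Q)
  from swap.IH swap.hyps(2) show ?case by (elim exE) (rule diag_swap)
qed

section \<open>Winning the game for complete bipartite graphs\<close>

text \<open>The order in which the strands leave the new vertex, computed backwards from the outcome
  \<open>T0\<close>. The first strand fits the end of the block to its left, the last one meets the
  front end of that block once the reversal has brought it there, and what lies between is turned
  round in passing.\<close>

fun TT :: "('x \<Rightarrow> 'v strand) \<Rightarrow> 'v strand list \<Rightarrow> ('x \<times> 'x) list \<Rightarrow> 'v strand list" where
  "TT c T0 [] = T0"
| "TT c T0 ((x, y) # ps) = opp (c y) # List.rev (TT c T0 ps) @ [opp (c x)]"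

text \<open>One reversal per pair of blocks: the strands of a vertex to the right of all blocks travel
  to the left past the pair, leaving one strand behind at either side.\<close>

lemma game_row:
  assumes "game A k X (P @ concat (map (\<lambda>(x, y). c x # L x @ List.rev (L y) @ [c y]) (List.rev ps)) @ TT c T0 ps @ Q)"
  shows "game A (k + length ps) X (P @ T0 @ concat (map (\<lambda>(x, y). L y @ List.rev (L x)) (List.rev ps)) @ Q)"
  using assms
proof (induction ps arbitrary: Q k)
  case (Cons p ps)
  obtain x y where p: "p = (x, y)" by (cases p)
  define B where "B = concat (map (\<lambda>(x, y). c x # L x @ List.rev (L y) @ [c y]) (List.rev ps))"
  let ?T = "TT c T0 ps"
  have "game A k X ((P @ B @ c x # L x @ List.rev (L y)) @ c y # opp (c y) # (List.rev ?T @ [opp (c x)] @ Q))"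
    using Cons.prems by (simp add: p B_def)
  then have "game A k X ((P @ B @ c x # L x @ List.rev (L y)) @ (List.rev ?T @ [opp (c x)] @ Q))"
    by (rule game.join)
  then have "game A k X ((P @ B) @ (c x # L x @ List.rev (L y) @ List.rev ?T) @ (opp (c x) # Q))"
    by simp
  then have "game A (Suc k) X ((P @ B) @ List.rev (c x # L x @ List.rev (L y) @ List.rev ?T) @ (opp (c x) # Q))"
    by (rule game.rev)
  then have "game A (Suc k) X ((P @ B @ ?T @ L y @ List.rev (L x)) @ c x # opp (c x) # Q)"
    by simp
  then have "game A (Suc k) X ((P @ B @ ?T @ L y @ List.rev (L x)) @ Q)"
    by (rule game.join)
  then have "game A (Suc k) X (P @ B @ ?T @ (L y @ List.rev (L x) @ Q))" by simp
  from Cons.IH[OF this[unfolded B_def]] show ?case by (simp add: p)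
qed simp

lemma mset_TT:
  "mset (TT c T0 ps) = mset (T0 @ map (\<lambda>x. opp (c x)) (concat (map (\<lambda>(x, y). [x, y]) ps)))"
  by (induction c T0 ps rule: TT.induct) auto

lemma set_TT:
  "set (TT c T0 ps) = set T0 \<union> (\<lambda>x. opp (c x)) ` set (concat (map (\<lambda>(x, y). [x, y]) ps))"
  using arg_cong[OF mset_TT, of set_mset c T0 ps] by (simp add: image_UN)

lemma distinct_TT:
  "distinct (TT c T0 ps) \<longleftrightarrow> distinct (T0 @ map (\<lambda>x. opp (c x)) (concat (map (\<lambda>(x, y). [x, y]) ps)))"
  by (rule mset_eq_imp_distinct_iff) (rule mset_TT)

text \<open>Matching ends cancel from the middle outwards.\<close>

lemma game_close:
  assumes "game A k X (P @ xs @ map opp (List.rev xs) @ Q)"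
  shows "game A k X (P @ Q)"
  using assms
proof (induction xs rule: rev_induct)
  case (snoc s xs)
  have "game A k X ((P @ xs) @ s # opp s # (map opp (List.rev xs) @ Q))" using snoc.prems by simp
  then have "game A k X ((P @ xs) @ (map opp (List.rev xs) @ Q))" by (rule game.join)
  then show ?case using snoc.IH by simp
qed simp

text \<open>The far vertex of each end is inserted right behind it and joined at once; the other
  strands of that vertex take the place of the end.\<close>

lemma game_attach:
  assumes "game A k X (P @ map e js @ Q)" "distinct js" "inj_on v (set js)"
    "\<And>j. j \<in> set js \<Longrightarrow> distinct (opp (e j) # blk j) \<and> (\<forall>s\<in>set (opp (e j) # blk j). vtx s = v j) \<and> v j \<notin> vtx ` A"
  shows "game (A \<union> (\<Union>j\<in>set js. set (opp (e j) # blk j))) k X (P @ concat (map blk js) @ Q)"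
  using assms
proof (induction js arbitrary: A P)
  case (Cons j js)
  let ?T = "opp (e j) # blk j"
  have "game A k X ((P @ [e j]) @ (map e js @ Q))" using Cons.prems(1) by simp
  then have "game (A \<union> set ?T) k X ((P @ [e j]) @ ?T @ (map e js @ Q))"
    by (rule game.ins[where v = "v j"]) (use Cons.prems(4)[of j] in auto)
  then have "game (A \<union> set ?T) k X (P @ e j # opp (e j) # (blk j @ map e js @ Q))" by simp
  then have "game (A \<union> set ?T) k X (P @ (blk j @ map e js @ Q))" by (rule game.join)
  then have 1: "game (A \<union> set ?T) k X ((P @ blk j) @ map e js @ Q)" by simp
  have "game (A \<union> set ?T \<union> (\<Union>j\<in>set js. set (opp (e j) # blk j))) k X ((P @ blk j) @ concat (map blk js) @ Q)"
  proof (rule Cons.IH[OF 1])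
    fix i assume i: "i \<in> set js"
    have "v i \<noteq> v j" using Cons.prems(2,3) i by (auto simp: inj_on_def)
    moreover have "vtx ` set ?T \<subseteq> {v j}" using Cons.prems(4)[of j] by auto
    ultimately have "v i \<notin> vtx ` (A \<union> set ?T)" using Cons.prems(4)[of i] i by auto
    then show "distinct (opp (e i) # blk i) \<and> (\<forall>s\<in>set (opp (e i) # blk i). vtx s = v i) \<and> v i \<notin> vtx ` (A \<union> set ?T)"
      using Cons.prems(4)[of i] i by auto
  qed (use Cons.prems in \<open>auto simp: inj_on_def\<close>)
  then show ?case by (simp add: Un_assoc)
qed simp

section \<open>The strategy for complete bipartite graphs\<close>

abbreviation ue :: "nat \<Rightarrow> nat \<Rightarrow> (nat + nat) strand" where
  "ue i j \<equiv> ((Inl i, Inr j), False)"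

abbreviation we :: "nat \<Rightarrow> nat \<Rightarrow> (nat + nat) strand" where
  "we i j \<equiv> ((Inl i, Inr j), True)"

definition St :: "nat \<Rightarrow> nat \<Rightarrow> (nat + nat) set \<Rightarrow> (nat + nat) strand set" where
  "St m n V = {s. fst s \<in> Kmn_E m n \<and> vtx s \<in> V}"

lemma St_Inl: "i < m \<Longrightarrow> St m n (insert (Inl i) V) = St m n V \<union> ue i ` {..<n}"
  by (auto simp: St_def Kmn_E_def vtx_def image_iff split: if_splits)

lemma St_Inr: "j < n \<Longrightarrow> St m n (insert (Inr j) V) = St m n V \<union> (\<lambda>i. we i j) ` {..<m}"
  by (auto simp: St_def Kmn_E_def vtx_def image_iff split: if_splits)

lemma game_ins_u:
  assumes "game (St m n V) k x (P @ Q)" "i < m" "Inl i \<notin> V" "distinct T" "set T = ue i ` {..<n}"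
  shows "game (St m n (insert (Inl i) V)) k x (P @ T @ Q)"
  unfolding St_Inl[OF assms(2)] assms(5)[symmetric]
  by (rule game.ins[where v = "Inl i"]) (use assms in \<open>auto simp: St_def vtx_def\<close>)

lemma game_ins_w:
  assumes "game (St m n V) k x (P @ Q)" "j < n" "Inr j \<notin> V" "distinct T" "set T = (\<lambda>i. we i j) ` {..<m}"
  shows "game (St m n (insert (Inr j) V)) k x (P @ T @ Q)"
  unfolding St_Inr[OF assms(2)] assms(5)[symmetric]
  by (rule game.ins[where v = "Inr j"]) (use assms in \<open>auto simp: St_def vtx_def\<close>)

text \<open>The ends that wait for the last two vertices \<open>Inr N\<close> and
  \<open>Inr (Suc N)\<close>. The alternating order gives two consecutive vertices the shape
  \<open>c x # L x @ rev (L y) @ [c y]\<close> that \<open>game_row\<close> needs in the final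
  row.\<close>

definition eo :: "nat \<Rightarrow> nat \<Rightarrow> (nat + nat) strand list" where
  "eo N i = (if odd i then [ue i N, ue i (Suc N)] else [ue i (Suc N), ue i N])"

definition asc :: "nat \<Rightarrow> nat \<Rightarrow> nat \<Rightarrow> (nat + nat) strand list" where
  "asc m i x = map (\<lambda>a. we a x) [i..<m]"

lemma asc_Cons: "i < m \<Longrightarrow> asc m i x = we i x # asc m (Suc i) x"
  by (simp add: asc_def upt_conv_Cons)

text \<open>The vertices \<open>Inr 1\<close>, ..., \<open>Inr (2 * q)\<close> in pairs, with
  \<open>Inr 0\<close> left single. Each row turns every pair round, hence the swap in
  \<open>psi\<close>.\<close>

fun ps0 :: "nat \<Rightarrow> (nat \<times> nat) list" where
  "ps0 0 = []"
| "ps0 (Suc q) = (2 * q + 1, 2 * q + 2) # ps0 q"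

definition psi :: "nat \<Rightarrow> nat \<Rightarrow> (nat \<times> nat) list" where
  "psi q i = (if odd i then ps0 q else map prod.swap (ps0 q))"

lemma length_ps0[simp]: "length (ps0 q) = q" by (induction q) auto
lemma length_psi[simp]: "length (psi q i) = q" by (auto simp: psi_def)

lemma psi_Suc: "psi q (Suc i) = map prod.swap (psi q i)"
  by (auto simp: psi_def)

abbreviation flat :: "('x \<times> 'x) list \<Rightarrow> 'x list" where
  "flat ps \<equiv> concat (map (\<lambda>(x, y). [x, y]) ps)"

lemma flat_ps0: "set (flat (ps0 q)) = {1..<Suc (2 * q)}" "distinct (flat (ps0 q))"
proof -
  have *: "set (flat (ps0 q)) = {1..<Suc (2 * q)}" for q by (induction q) auto
  then show "set (flat (ps0 q)) = {1..<Suc (2 * q)}" .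
  show "distinct (flat (ps0 q))"
  proof (induction q)
    case (Suc q)
    then show ?case using *[of q] by (auto simp del: set_concat)
  qed simp
qed

lemma flat_swap: "set (flat (map prod.swap ps)) = set (flat ps)"
  "distinct (flat (map prod.swap ps)) = distinct (flat ps)"
proof -
  have "mset (flat (map prod.swap ps)) = mset (flat ps)" by (induction ps) auto
  then show "set (flat (map prod.swap ps)) = set (flat ps)"
    "distinct (flat (map prod.swap ps)) = distinct (flat ps)"
    by (auto dest: mset_eq_setD mset_eq_imp_distinct_iff simp del: set_concat)
qed

lemma flat_psi: "set (flat (psi q i)) = {1..<Suc (2 * q)}" "distinct (flat (psi q i))"
  unfolding psi_def using flat_ps0[of q] flat_swap[of "ps0 q"] by (auto simp del: set_concat)

text \<open>The open ends when the vertices Inl 0, ..., Inl (i - 1) and Inr 0, ..., Inr (2 * q) are present.\<close>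

definition front :: "nat \<Rightarrow> nat \<Rightarrow> nat \<Rightarrow> (nat + nat) strand list" where
  "front m q i = eo (Suc (2 * q)) 0 @ List.rev (asc m i 0) @
     concat (map (\<lambda>(x, y). asc m i x @ List.rev (asc m i y)) (List.rev (psi q i))) @
     concat (map (eo (Suc (2 * q))) (List.rev [1..<i]))"

lemma front1:
  assumes "1 < m"
  shows "game (St m (2 * q + 3) (Inl ` {..<1} \<union> Inr ` {..<Suc (2 * q)})) 0 False (front m q 1)"
proof -
  let ?N = "Suc (2 * q)" let ?n = "2 * q + 3"
  define blk where "blk = (\<lambda>j. if even j then List.rev (asc m 1 j) else asc m 1 j)"
  have E: "game (St m ?n {}) 0 False ([] @ [])" using game.start by (simp add: St_def)
  have "game (St m ?n (insert (Inl 0) {})) 0 False ([] @ (eo ?N 0 @ map (ue 0) [0..<?N]) @ [])"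
  proof (rule game_ins_u[OF E])
    have "{..<?n} = insert ?N (insert (Suc ?N) {..<?N})" by auto
    then show "set (eo ?N 0 @ map (ue 0) [0..<?N]) = ue 0 ` {..<?n}"
      by (auto simp: eo_def lessThan_Suc)
  qed (use assms in \<open>auto simp: eo_def distinct_map inj_on_def\<close>)
  then have "game (St m ?n {Inl 0}) 0 False (eo ?N 0 @ map (ue 0) [0..<?N] @ [])" by simp
  then have "game (St m ?n {Inl 0} \<union> (\<Union>j\<in>set [0..<?N]. set (opp (ue 0 j) # blk j))) 0 False
     (eo ?N 0 @ concat (map blk [0..<?N]) @ [])"
    by (rule game_attach[where v = Inr])
      (auto simp: blk_def asc_def opp_def vtx_def St_def distinct_map inj_on_def distinct_rev split: if_splits)
  moreover have "St m ?n {Inl 0} \<union> (\<Union>j\<in>set [0..<?N]. set (opp (ue 0 j) # blk j))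
     = St m ?n (Inl ` {..<1} \<union> Inr ` {..<?N})"
  proof -
    have "set (opp (ue 0 j) # blk j) = (\<lambda>i. we i j) ` {..<m}" for j
    proof -
      have "{..<m} = insert 0 {1..<m}" using assms by auto
      then show ?thesis by (auto simp: blk_def asc_def opp_def)
    qed
    moreover have "set [0..<?N] = {..<?N}" by auto
    ultimately have "(\<Union>j\<in>set [0..<?N]. set (opp (ue 0 j) # blk j)) = (\<Union>j\<in>{..<?N}. (\<lambda>i. we i j) ` {..<m})"
      by (simp only:)
    also have "\<dots> = {we i j | i j. i < m \<and> j < ?N}" by blast
    finally have "(\<Union>j\<in>set [0..<?N]. set (opp (ue 0 j) # blk j)) = {we i j | i j. i < m \<and> j < ?N}" .
    moreover have "St m ?n (Inl ` {..<1} \<union> Inr ` {..<?N}) = St m ?n {Inl 0} \<union> {we i j | i j. i < m \<and> j < ?N}"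
      by (auto simp: St_def Kmn_E_def vtx_def split: if_splits)
    ultimately show ?thesis by simp
  qed
  moreover have "concat (map blk [0..<Suc (2 * q)]) = List.rev (asc m 1 0) @
     concat (map (\<lambda>(x, y). asc m 1 x @ List.rev (asc m 1 y)) (List.rev (ps0 q)))" for q
    by (induction q) (auto simp: blk_def)
  ultimately show ?thesis by (simp add: front_def psi_def)
qed

text \<open>\<open>Inl i\<close> enters to the right of all blocks and travels to the left past the
  q pairs, one reversal each. The strand to \<open>Inr 0\<close> is the one carried through; it
  arrives next to the matching end of \<open>Inr 0\<close> and is joined without a reversal.\<close>

lemma front_step:
  assumes "game (St m (2 * q + 3) (Inl ` {..<i} \<union> Inr ` {..<Suc (2 * q)})) k False (front m q i)" "0 < i" "i < m"
  shows "game (St m (2 * q + 3) (Inl ` {..<Suc i} \<union> Inr ` {..<Suc (2 * q)})) (k + q) False (front m q (Suc i))"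
proof -
  let ?N = "Suc (2 * q)" let ?n = "2 * q + 3"
  let ?V = "Inl ` {..<i} \<union> Inr ` {..<?N}"
  let ?ps = "psi q i"
  define c where "c = we i"
  define B where "B = concat (map (\<lambda>(x, y). asc m i x @ List.rev (asc m i y)) (List.rev ?ps))"
  define R where "R = concat (map (eo ?N) (List.rev [1..<i]))"
  define T where "T = TT c [ue i 0] ?ps"
  have opc: "opp (c x) = ue i x" for x by (simp add: c_def opp_def)
  have g: "game (St m ?n ?V) k False ((eo ?N 0 @ List.rev (asc m i 0) @ B) @ R)"
    using assms(1) by (simp add: front_def B_def R_def)
  have "game (St m ?n (insert (Inl i) ?V)) k False ((eo ?N 0 @ List.rev (asc m i 0) @ B) @ (T @ eo ?N i) @ R)"
  proof (rule game_ins_u[OF g assms(3)])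
    have 1: "set T = ue i ` {..<?N}"
    proof -
      have "{..<?N} = insert 0 {1..<?N}" by auto
      then show ?thesis unfolding T_def set_TT opc flat_psi by simp
    qed
    have "distinct T"
      unfolding T_def distinct_TT opc using flat_psi[of q i]
      by (auto simp: distinct_map inj_on_def simp del: set_concat)
    then show "distinct (T @ eo ?N i)" using 1 by (auto simp: eo_def)
    have "{..<?n} = insert ?N (insert (Suc ?N) {..<?N})" by auto
    then show "set (T @ eo ?N i) = ue i ` {..<?n}" unfolding set_append 1 by (auto simp: eo_def)
  qed auto
  moreover have "insert (Inl i) ?V = Inl ` {..<Suc i} \<union> Inr ` {..<?N}" by (auto simp: lessThan_Suc)
  ultimately have g2: "game (St m ?n (Inl ` {..<Suc i} \<union> Inr ` {..<?N})) k False
     ((eo ?N 0 @ List.rev (asc m i 0)) @ B @ T @ (eo ?N i @ R))" by simp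
  have B: "B = concat (map (\<lambda>(x, y). c x # asc m (Suc i) x @ List.rev (asc m (Suc i) y) @ [c y]) (List.rev ?ps))"
    using assms(3) by (simp add: B_def asc_Cons c_def)
  from game_row[OF g2[unfolded B T_def]]
  have "game (St m ?n (Inl ` {..<Suc i} \<union> Inr ` {..<?N})) (k + q) False
     ((eo ?N 0 @ List.rev (asc m (Suc i) 0)) @ c 0 # opp (c 0) #
      (concat (map (\<lambda>(x, y). asc m (Suc i) y @ List.rev (asc m (Suc i) x)) (List.rev ?ps)) @ eo ?N i @ R))"
    using assms(3) by (simp add: asc_Cons opp_def c_def)
  then have "game (St m ?n (Inl ` {..<Suc i} \<union> Inr ` {..<?N})) (k + q) False
     ((eo ?N 0 @ List.rev (asc m (Suc i) 0)) @
      (concat (map (\<lambda>(x, y). asc m (Suc i) y @ List.rev (asc m (Suc i) x)) (List.rev ?ps)) @ eo ?N i @ R))"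
    by (rule game.join)
  moreover have "concat (map (\<lambda>(x, y). asc m (Suc i) y @ List.rev (asc m (Suc i) x)) (List.rev ?ps))
    = concat (map (\<lambda>(x, y). asc m (Suc i) x @ List.rev (asc m (Suc i) y)) (List.rev (psi q (Suc i))))"
    unfolding psi_Suc rev_map by (simp add: o_def case_prod_unfold)
  moreover have "concat (map (eo ?N) (List.rev [1..<Suc i])) = eo ?N i @ R"
    using assms(2) by (simp add: R_def)
  ultimately show ?thesis unfolding front_def by simp
qed

lemma front_all:
  assumes "0 < i" "i < m"
  shows "game (St m (2 * q + 3) (Inl ` {..<i} \<union> Inr ` {..<Suc (2 * q)})) ((i - 1) * q) False (front m q i)"
  using assms
proof (induction i)
  case (Suc i)
  show ?case
  proof (cases "i = 0")
    case True
    then show ?thesis using front1[of m q] Suc.prems by simp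
  next
    case False
    then have "game (St m (2 * q + 3) (Inl ` {..<i} \<union> Inr ` {..<Suc (2 * q)})) ((i - 1) * q) False (front m q i)"
      using Suc by simp
    from front_step[OF this] False Suc.prems show ?thesis by (cases i) (auto simp: add.commute)
  qed
qed simp

text \<open>For the last vertex \<open>Inl (m - 1)\<close> every block has shrunk to a single end,
  so its strands can be listed in the opposite order and closed without any reversal. This is why
  only m - 2 rows are paid for.\<close>

lemma front_end:
  assumes "2 < m"
  shows "game (St m (2 * q + 3) (Inl ` {..<m} \<union> Inr ` {..<Suc (2 * q)})) ((m - 2) * q) False
    (eo (Suc (2 * q)) 0 @ concat (map (eo (Suc (2 * q))) (List.rev [1..<m])))"
proof -
  let ?N = "Suc (2 * q)" let ?n = "2 * q + 3" let ?i = "m - 1"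
  let ?V = "Inl ` {..<?i} \<union> Inr ` {..<?N}"
  define ord where "ord = 0 # flat (List.rev (psi q ?i))"
  define xs where "xs = map (we ?i) ord"
  define R where "R = concat (map (eo ?N) (List.rev [1..<?i]))"
  have asc1: "asc m ?i x = [we ?i x]" for x
    using assms asc_Cons[of ?i m x] by (simp add: asc_def)
  have ord: "set ord = {..<?N}" "distinct ord"
  proof -
    have e: "mset (flat (List.rev ps)) = mset (flat ps)" for ps :: "(nat \<times> nat) list" by (induction ps) auto
    have "set (flat (List.rev (psi q ?i))) = {1..<?N}" "distinct (flat (List.rev (psi q ?i)))"
      using flat_psi[of q ?i] mset_eq_setD[OF e] mset_eq_imp_distinct_iff[OF e] by blast+
    then show "set ord = {..<?N}" "distinct ord" unfolding ord_def by (auto simp del: set_concat)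
  qed
  have fr: "front m q ?i = eo ?N 0 @ xs @ R"
  proof -
    have "concat (map (\<lambda>(x, y). [we ?i x] @ [we ?i y]) ps) = map (we ?i) (flat ps)" for ps
      by (induction ps) auto
    then show ?thesis unfolding front_def asc1 xs_def ord_def R_def by simp
  qed
  have g: "game (St m ?n ?V) ((m - 2) * q) False ((eo ?N 0 @ xs) @ R)"
  proof -
    have e: "?i - 1 = m - 2" by simp
    show ?thesis using front_all[of ?i m q] assms unfolding e fr by simp
  qed
  have opx: "map opp (List.rev xs) = map (ue ?i) (List.rev ord)"
    by (simp add: xs_def opp_def rev_map)
  have lt: "?i < m" using assms by simp
  have notin: "Inl ?i \<notin> ?V" by auto
  have set1: "set (map opp (List.rev xs)) = ue ?i ` {..<?N}"
    unfolding opx set_map set_rev ord(1) ..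
  have "distinct (map opp (List.rev xs))"
    unfolding opx using ord(2) by (simp add: distinct_map inj_on_def)
  then have dist: "distinct (map opp (List.rev xs) @ eo ?N ?i)"
    unfolding distinct_append set1 by (auto simp: eo_def)
  have "{..<?n} = insert ?N (insert (Suc ?N) {..<?N})" by auto
  then have set2: "set (map opp (List.rev xs) @ eo ?N ?i) = ue ?i ` {..<?n}"
    unfolding set_append set1 by (auto simp: eo_def)
  have "game (St m ?n (insert (Inl ?i) ?V)) ((m - 2) * q) False ((eo ?N 0 @ xs) @ (map opp (List.rev xs) @ eo ?N ?i) @ R)"
    by (rule game_ins_u[OF g lt notin dist set2])
  moreover have "insert (Inl ?i) ?V = Inl ` {..<m} \<union> Inr ` {..<?N}"
  proof -
    have "{..<m} = insert ?i {..<?i}" using assms by auto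
    then show ?thesis by simp
  qed
  ultimately have "game (St m ?n (Inl ` {..<m} \<union> Inr ` {..<?N})) ((m - 2) * q) False
      (eo ?N 0 @ xs @ map opp (List.rev xs) @ (eo ?N ?i @ R))" by simp
  then have "game (St m ?n (Inl ` {..<m} \<union> Inr ` {..<?N})) ((m - 2) * q) False (eo ?N 0 @ (eo ?N ?i @ R))"
    by (rule game_close)
  moreover have "concat (map (eo ?N) (List.rev [1..<m])) = eo ?N ?i @ R"
  proof -
    have "[1..<m] = [1..<?i] @ [?i]" using upt_Suc_append[of 1 ?i] assms by simp
    then show ?thesis by (simp add: R_def)
  qed
  ultimately show ?thesis by simp
qed

text \<open>The vertices \<open>Inl 2\<close>, ..., \<open>Inl (m - 2)\<close> form the p pairs that
  \<open>Inr N\<close> passes; \<open>Inl 1\<close>, \<open>Inl (m - 1)\<close> and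
  \<open>Inl 0\<close> are joined to it without reversals, the last one after the exchange. All
  remaining ends wait for \<open>Inr (Suc N)\<close>, which closes them at once.\<close>

theorem game_Kmn:
  fixes p q :: nat
  defines "m \<equiv> 2 * p + 3" and "n \<equiv> 2 * q + 3"
  shows "game (St m n (Kmn_V m n)) ((m - 2) * q + p) True []"
proof -
  let ?N = "Suc (2 * q)" let ?k = "(m - 2) * q"
  let ?V = "Inl ` {..<m} \<union> Inr ` {..<?N}"
  define ps where "ps = map (\<lambda>t. (2 * t + 3, 2 * t + 2)) [0..<p]"
  define c where "c = (\<lambda>v. ue v ?N)"
  define L where "L = (\<lambda>v. [ue v (Suc ?N)])"
  define B where "B = concat (map (\<lambda>(x, y). c x # L x @ List.rev (L y) @ [c y]) (List.rev ps))"
  \<comment> \<open>\<open>Inl (m - 1)\<close> and \<open>Inl 0\<close> stand to the left of all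
    pairs, so the strands to them are the ones carried through the whole row.\<close>
  define T where "T = TT c [we (m - 1) ?N, we 0 ?N] ps"
  have opc: "opp (c v) = we v ?N" for v by (simp add: c_def opp_def)
  have eom: "eo ?N (m - 1) = [ue (m - 1) (Suc ?N), ue (m - 1) ?N]" by (simp add: eo_def m_def)
  have "List.rev [1..<m] = (m - 1) # List.rev [2..<2 * p + 2] @ [1]"
    by (simp add: m_def upt_conv_Cons numeral_2_eq_2 numeral_3_eq_3)
  moreover have "concat (map (eo ?N) (List.rev [2..<2 * p + 2])) = B"
    unfolding B_def ps_def by (induction p) (auto simp: eo_def c_def L_def)
  ultimately have "concat (map (eo ?N) (List.rev [1..<m])) = eo ?N (m - 1) @ B @ eo ?N 1" by simp
  then have g: "game (St m n ?V) ?k False ((eo ?N 0 @ eo ?N (m - 1) @ B) @ eo ?N 1)"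
    using front_end[of m q] by (simp add: m_def n_def)
  have fl: "set (flat ps) = {2..<2 * p + 2}" "distinct (flat ps)"
  proof -
    have *: "set (flat (map (\<lambda>t. (2 * t + 3, 2 * t + 2)) [0..<p])) = {2..<2 * p + 2}" for p :: nat
      by (induction p) auto
    show "set (flat ps) = {2..<2 * p + 2}" unfolding ps_def by (rule *)
    show "distinct (flat ps)" unfolding ps_def
    proof (induction p)
      case (Suc p)
      then show ?case using *[of p] by (auto simp del: set_concat)
    qed simp
  qed
  have "game (St m n (insert (Inr ?N) ?V)) ?k False ((eo ?N 0 @ eo ?N (m - 1) @ B) @ (T @ [we 1 ?N]) @ eo ?N 1)"
  proof (rule game_ins_w[OF g])
    have 1: "set T = (\<lambda>v. we v ?N) ` (insert 0 (insert (m - 1) {2..<2 * p + 2}))"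
      unfolding T_def set_TT opc fl by auto
    have "distinct T"
      unfolding T_def distinct_TT opc using fl
      by (auto simp: distinct_map inj_on_def m_def simp del: set_concat)
    moreover have "we 1 ?N \<notin> set T" unfolding 1 m_def by (simp add: image_iff)
    ultimately show "distinct (T @ [we 1 ?N])" by simp
    have "{..<m} = insert 1 (insert 0 (insert (m - 1) {2..<2 * p + 2}))"
      unfolding m_def by (intro set_eqI) (simp, arith)
    then show "set (T @ [we 1 ?N]) = (\<lambda>i. we i ?N) ` {..<m}" unfolding set_append 1 by simp
  qed (auto simp: n_def)
  then have "game (St m n (insert (Inr ?N) ?V)) ?k False
    ((eo ?N 0 @ eo ?N (m - 1) @ B @ T) @ we 1 ?N # opp (we 1 ?N) # [ue 1 (Suc ?N)])"
    by (simp add: eo_def opp_def)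
  then have "game (St m n (insert (Inr ?N) ?V)) ?k False
    ((eo ?N 0 @ eo ?N (m - 1) @ B @ T) @ [ue 1 (Suc ?N)])" by (rule game.join)
  then have "game (St m n (insert (Inr ?N) ?V)) ?k False
    ((eo ?N 0 @ eo ?N (m - 1)) @ B @ T @ [ue 1 (Suc ?N)])" by simp
  from game_row[OF this[unfolded B_def T_def]]
  have g2: "game (St m n (insert (Inr ?N) ?V)) (?k + p) False
    ((eo ?N 0 @ eo ?N (m - 1)) @ [we (m - 1) ?N, we 0 ?N] @
     concat (map (\<lambda>(x, y). L y @ List.rev (L x)) (List.rev ps)) @ [ue 1 (Suc ?N)])"
    by (simp add: ps_def)
  define vs where "vs = concat (map (\<lambda>(x, y). [y, x]) (List.rev ps)) @ [1]"
  have vs: "concat (map (\<lambda>(x, y). L y @ List.rev (L x)) (List.rev ps)) @ [ue 1 (Suc ?N)] = map (\<lambda>v. ue v (Suc ?N)) vs"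
    unfolding vs_def L_def by (simp add: map_concat o_def case_prod_unfold)
  have "game (St m n (insert (Inr ?N) ?V)) (?k + p) False
    ((eo ?N 0 @ [ue (m - 1) (Suc ?N)]) @ ue (m - 1) ?N # opp (ue (m - 1) ?N) # (we 0 ?N # map (\<lambda>v. ue v (Suc ?N)) vs))"
    using g2 unfolding vs eom by (simp add: opp_def)
  then have "game (St m n (insert (Inr ?N) ?V)) (?k + p) False
    ((eo ?N 0 @ [ue (m - 1) (Suc ?N)]) @ (we 0 ?N # map (\<lambda>v. ue v (Suc ?N)) vs))"
    by (rule game.join)
  then have "game (St m n (insert (Inr ?N) ?V)) (?k + p) False
    (eo ?N 0 @ ue (m - 1) (Suc ?N) # we 0 ?N # map (\<lambda>v. ue v (Suc ?N)) vs)" by simp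
  \<comment> \<open>The one crossing: the edge between \<open>Inl 0\<close> and \<open>Inr N\<close>
    has to get past the end of \<open>Inl (m - 1)\<close> that waits for
    \<open>Inr (Suc N)\<close>.\<close>
  then have "game (St m n (insert (Inr ?N) ?V)) (?k + p) True
    (eo ?N 0 @ we 0 ?N # ue (m - 1) (Suc ?N) # map (\<lambda>v. ue v (Suc ?N)) vs)"
    by (rule game.swap) simp
  then have "game (St m n (insert (Inr ?N) ?V)) (?k + p) True
    ([ue 0 (Suc ?N)] @ ue 0 ?N # opp (ue 0 ?N) # (ue (m - 1) (Suc ?N) # map (\<lambda>v. ue v (Suc ?N)) vs))"
    by (simp add: eo_def opp_def)
  then have "game (St m n (insert (Inr ?N) ?V)) (?k + p) True
    ([ue 0 (Suc ?N)] @ (ue (m - 1) (Suc ?N) # map (\<lambda>v. ue v (Suc ?N)) vs))"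
    by (rule game.join)
  then have g3: "game (St m n (insert (Inr ?N) ?V)) (?k + p) True
    (map (\<lambda>v. ue v (Suc ?N)) (0 # (m - 1) # vs) @ [])" by simp
  define xs where "xs = map (\<lambda>v. ue v (Suc ?N)) (0 # (m - 1) # vs)"
  have vss: "set vs = insert 1 {2..<2 * p + 2}" "distinct vs"
  proof -
    have e: "mset (concat (map (\<lambda>(x, y). [y, x]) (List.rev ps))) = mset (flat ps)" for ps :: "(nat \<times> nat) list"
      by (induction ps) auto
    have "set (concat (map (\<lambda>(x, y). [y, x]) (List.rev ps))) = {2..<2 * p + 2}"
      "distinct (concat (map (\<lambda>(x, y). [y, x]) (List.rev ps)))"
      using fl mset_eq_setD[OF e] mset_eq_imp_distinct_iff[OF e] by blast+
    then show "set vs = insert 1 {2..<2 * p + 2}" "distinct vs" unfolding vs_def by (auto simp del: set_concat)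
  qed
  have opx: "map opp (List.rev xs) = map (\<lambda>v. we v (Suc ?N)) (List.rev (0 # (m - 1) # vs))"
    by (simp add: xs_def opp_def rev_map)
  have "game (St m n (insert (Inr (Suc ?N)) (insert (Inr ?N) ?V))) (?k + p) True (xs @ map opp (List.rev xs) @ [])"
  proof (rule game_ins_w[OF g3[folded xs_def]])
    show "distinct (map opp (List.rev xs))"
      unfolding opx using vss by (auto simp: distinct_map inj_on_def m_def)
    have "{..<m} = insert 0 (insert (m - 1) (insert 1 {2..<2 * p + 2}))"
      unfolding m_def by (intro set_eqI) (simp, arith)
    then show "set (map opp (List.rev xs)) = (\<lambda>i. we i (Suc ?N)) ` {..<m}"
      unfolding opx using vss by auto
  qed (auto simp: n_def)
  then have "game (St m n (insert (Inr (Suc ?N)) (insert (Inr ?N) ?V))) (?k + p) True ([] @ [])"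
    using game_close[of _ _ _ "[]" xs "[]"] by simp
  moreover have "insert (Inr (Suc ?N)) (insert (Inr ?N) ?V) = Kmn_V m n"
  proof -
    have "{..<n} = insert (Suc ?N) (insert ?N {..<?N})" unfolding n_def by (intro set_eqI) (simp, arith)
    then show ?thesis unfolding Kmn_V_def by auto
  qed
  ultimately show ?thesis by simp
qed

section \<open>Straight-line pictures of noncrossing words\<close>

lemma inner_cis: "inner (cis a) (cis b) = cos (a - b)"
  by (simp add: inner_complex_def cos_diff)

lemma cis_inj_on_period:
  assumes "cis a = cis b" "\<bar>a - b\<bar> < 2 * pi"
  shows "a = b"
proof -
  have "sin a = sin b \<and> cos a = cos b" using assms(1) by (simp add: complex_eq_iff)
  then obtain n :: int where n: "a = b + 2 * pi * n" using sin_cos_eq_iff by auto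
  then have "\<bar>real_of_int n\<bar> * (2 * pi) < 1 * (2 * pi)" using assms(2) by (simp add: abs_mult mult.commute)
  then have "\<bar>real_of_int n\<bar> < 1" by (subst (asm) mult_less_cancel_right) auto
  then have "n = 0" by linarith
  then show ?thesis using n by simp
qed

lemma polar_inj:
  assumes "of_real r * cis a = of_real s * cis b" "0 < r" "0 < s" "\<bar>a - b\<bar> < 2 * pi"
  shows "r = s \<and> a = b"
proof -
  have "norm (of_real r * cis a) = r" "norm (of_real s * cis b) = s" using assms(2,3) by (simp_all add: norm_mult)
  then have "r = s" using assms(1) by simp
  then show ?thesis using assms cis_inj_on_period by auto
qed

text \<open>The signed distance of \<open>cis t\<close> from the line through \<open>cis a\<close>
  and \<open>cis b\<close> factors as - 2 sin ((t - a) / 2) sin ((t - b) / 2), and the sines have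
  the signs of t - a and t - b.\<close>

lemma chord_sign:
  fixes a b t :: real
  defines "D \<equiv> inner (cis ((a + b) / 2)) (cis t) - cos ((b - a) / 2)"
  assumes "a < b" "0 < a" "b < 2 * pi" "0 < t" "t < 2 * pi"
  shows "a < t \<Longrightarrow> t < b \<Longrightarrow> 0 < D" "t < a \<Longrightarrow> D < 0" "b < t \<Longrightarrow> D < 0"
    "t = a \<or> t = b \<Longrightarrow> D = 0"
proof -
  have "D = cos ((a + b) / 2 - t) - cos ((b - a) / 2)" by (simp add: D_def inner_cis)
  also have "\<dots> = - (2 * (sin ((t - a) / 2) * sin ((t - b) / 2)))"
  proof -
    have "cos ((a + b) / 2 - t) = cos ((t - a) / 2 + (t - b) / 2)"
    proof -
      have "(t - a) / 2 + (t - b) / 2 = - ((a + b) / 2 - t)" by (simp add: field_simps)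
      then show ?thesis by (simp only: cos_minus)
    qed
    moreover have "cos ((b - a) / 2) = cos ((t - a) / 2 - (t - b) / 2)"
    proof -
      have "(b - a) / 2 = (t - a) / 2 - (t - b) / 2" by (simp add: field_simps)
      then show ?thesis by (simp only:)
    qed
    ultimately show ?thesis unfolding cos_add[of "(t - a) / 2"] cos_diff[of "(t - a) / 2"] by simp
  qed
  finally have D: "D = - (2 * (sin ((t - a) / 2) * sin ((t - b) / 2)))" .
  have pos: "0 < sin (u / 2)" if "0 < u" "u < 2 * pi" for u :: real
    using that by (intro sin_gt_zero) auto
  have neg: "sin (u / 2) < 0" if "u < 0" "- 2 * pi < u" for u :: real
    using pos[of "- u"] that by simp
  show "a < t \<Longrightarrow> t < b \<Longrightarrow> 0 < D"
    unfolding D using pos[of "t - a"] neg[of "t - b"] assms by (simp add: mult_pos_neg)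
  show "t < a \<Longrightarrow> D < 0"
    unfolding D using neg[of "t - a"] neg[of "t - b"] assms by (simp add: mult_neg_neg)
  show "b < t \<Longrightarrow> D < 0"
    unfolding D using pos[of "t - a"] pos[of "t - b"] assms by simp
  show "t = a \<or> t = b \<Longrightarrow> D = 0" unfolding D by auto
qed

text \<open>The line is a chord of one of the sets. If all of \<open>A\<close> precedes
  \<open>B\<close>, it joins the first and the last point of \<open>B\<close>, which differ by
  \<open>B2\<close>. Otherwise it joins the points of \<open>A\<close> next to \<open>Min B\<close>
  on both sides; all of \<open>B\<close> lies between them, for a later point of \<open>B\<close>
  would produce an alternation.\<close>

lemma separate1:
  fixes A B :: "real set"
  assumes fin: "finite A" "finite B" and ne: "A \<noteq> {}" "B \<noteq> {}" and dis: "A \<inter> B = {}"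
    and ran: "A \<subseteq> {0<..<2*pi}" "B \<subseteq> {0<..<2*pi}"
    and B2: "\<And>b. b \<in> B \<Longrightarrow> \<exists>b'\<in>B. b' \<noteq> b"
    and nalt: "\<And>a b a' b'. a \<in> A \<Longrightarrow> b \<in> B \<Longrightarrow> a' \<in> A \<Longrightarrow> b' \<in> B \<Longrightarrow> a < b \<Longrightarrow> b < a' \<Longrightarrow> a' < b' \<Longrightarrow> False"
    and less: "Min A < Min B"
  shows "\<exists>c d. (\<forall>t\<in>A. inner c (cis t) \<le> d \<and> (\<forall>s\<in>B. d < inner c (cis s))) \<or>
               (\<forall>t\<in>A. inner c (cis t) < d \<and> (\<forall>s\<in>B. d \<le> inner c (cis s)))"
proof -
  let ?b = "Min B"
  have b: "?b \<in> B" "\<And>y. y \<in> B \<Longrightarrow> ?b \<le> y" using fin ne by auto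
  define A1 where "A1 = {x\<in>A. x < ?b}"
  have "Min A \<in> A1" using fin ne less by (simp add: A1_def)
  then have A1: "finite A1" "A1 \<noteq> {}" using fin by (auto simp: A1_def)
  let ?a = "Max A1"
  have a: "?a \<in> A" "?a < ?b" "\<And>x. x \<in> A \<Longrightarrow> x < ?b \<Longrightarrow> x \<le> ?a"
    using Max_in[OF A1] A1 by (auto simp: A1_def)
  define A2 where "A2 = {x\<in>A. ?b < x}"
  show ?thesis
  proof (cases "A2 = {}")
    case True
    let ?e = "Max B"
    have e: "?e \<in> B" "\<And>y. y \<in> B \<Longrightarrow> y \<le> ?e" using fin ne by auto
    obtain b' where "b' \<in> B" "b' \<noteq> ?b" using B2 b(1) by blast
    then have be: "?b < ?e" using b(2)[of b'] e(2)[of b'] by linarith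
    have r: "0 < ?b" "?e < 2 * pi" using ran b(1) e(1) by auto
    have "inner (cis ((?b + ?e) / 2)) (cis t) < cos ((?e - ?b) / 2)" if "t \<in> A" for t
    proof -
      have "t \<noteq> ?b" using that dis b(1) by auto
      then have "t < ?b" using that True by (auto simp: A2_def)
      then show ?thesis using chord_sign(2)[of ?b ?e t] be r ran that by auto
    qed
    moreover have "cos ((?e - ?b) / 2) \<le> inner (cis ((?b + ?e) / 2)) (cis s)" if s: "s \<in> B" for s
    proof -
      have "s \<in> {0<..<2*pi}" using ran s by auto
      then have rs: "0 < s" "s < 2 * pi" by auto
      consider "s = ?b \<or> s = ?e" | "?b < s" "s < ?e" using b(2)[OF s] e(2)[OF s] by linarith
      then show ?thesis
      proof cases
        case 1
        then show ?thesis using chord_sign(4)[of ?b ?e s] be r rs by linarith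
      next
        case 2
        then show ?thesis using chord_sign(1)[of ?b ?e s] be r rs by linarith
      qed
    qed
    ultimately show ?thesis by blast
  next
    case False
    have A2: "finite A2" using fin by (auto simp: A2_def)
    let ?a' = "Min A2"
    have a': "?a' \<in> A" "?b < ?a'" "\<And>x. x \<in> A \<Longrightarrow> ?b < x \<Longrightarrow> ?a' \<le> x"
      using Min_in[OF A2 False] A2 by (auto simp: A2_def)
    have aa': "?a < ?a'" using a a' by linarith
    have r: "0 < ?a" "?a' < 2 * pi" using ran a(1) a'(1) by auto
    have "inner (cis ((?a + ?a') / 2)) (cis t) \<le> cos ((?a' - ?a) / 2)" if t: "t \<in> A" for t
    proof -
      have "t \<noteq> ?b" using t dis b(1) by auto
      then consider "t = ?a \<or> t = ?a'" | "t < ?a" | "?a' < t"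
        using a(3)[OF t] a'(3)[OF t] by linarith
      moreover have rt: "0 < t" "t < 2 * pi" using ran t by auto
      ultimately show ?thesis
      proof cases
        case 1
        then show ?thesis using chord_sign(4)[of ?a ?a' t] aa' r rt by linarith
      next
        case 2
        then show ?thesis using chord_sign(2)[of ?a ?a' t] aa' r rt by linarith
      next
        case 3
        then show ?thesis using chord_sign(3)[of ?a ?a' t] aa' r rt by linarith
      qed
    qed
    moreover have "cos ((?a' - ?a) / 2) < inner (cis ((?a + ?a') / 2)) (cis s)" if "s \<in> B" for s
    proof -
      have "s \<in> {0<..<2*pi}" using ran that by auto
      moreover have "?a < s" using a(2) b(2)[OF that] by linarith
      moreover have "s < ?a'"
      proof (rule ccontr)
        assume "\<not> s < ?a'"
        moreover have "s \<noteq> ?a'" using a'(1) that dis by auto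
        ultimately have "?a' < s" by linarith
        then show False using nalt[OF a(1) b(1) a'(1) that] a(2) a'(2) by blast
      qed
      ultimately show ?thesis using chord_sign(1)[of ?a ?a' s] aa' r by auto
    qed
    ultimately show ?thesis by blast
  qed
qed

text \<open>Finiteness widens the one-sided strict inequality to a gap between d and e, a form that
  passes to convex combinations.\<close>

lemma separate:
  fixes A B :: "real set"
  assumes fin: "finite A" "finite B" and ne: "A \<noteq> {}" "B \<noteq> {}" and dis: "A \<inter> B = {}"
    and ran: "A \<subseteq> {0<..<2*pi}" "B \<subseteq> {0<..<2*pi}"
    and A2: "\<And>b. b \<in> A \<Longrightarrow> \<exists>b'\<in>A. b' \<noteq> b"
    and B2: "\<And>b. b \<in> B \<Longrightarrow> \<exists>b'\<in>B. b' \<noteq> b"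
    and nalt: "\<And>a b a' b'. a \<in> A \<Longrightarrow> b \<in> B \<Longrightarrow> a' \<in> A \<Longrightarrow> b' \<in> B \<Longrightarrow> a < b \<Longrightarrow> b < a' \<Longrightarrow> a' < b' \<Longrightarrow> False"
    and nalt': "\<And>a b a' b'. a \<in> B \<Longrightarrow> b \<in> A \<Longrightarrow> a' \<in> B \<Longrightarrow> b' \<in> A \<Longrightarrow> a < b \<Longrightarrow> b < a' \<Longrightarrow> a' < b' \<Longrightarrow> False"
  shows "\<exists>c d e. d < e \<and>
    ((\<forall>t\<in>A. inner c (cis t) \<le> d) \<and> (\<forall>t\<in>B. e \<le> inner c (cis t)) \<or>
     (\<forall>t\<in>B. inner c (cis t) \<le> d) \<and> (\<forall>t\<in>A. e \<le> inner c (cis t)))"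
proof -
  have key: "\<exists>c d e. d < e \<and> (\<forall>t\<in>A. inner c (cis t) \<le> d) \<and> (\<forall>t\<in>B. e \<le> inner c (cis t))"
    if f: "finite A" "finite B" "A \<noteq> {}" "B \<noteq> {}"
     and "\<exists>c d. (\<forall>t\<in>A. inner c (cis t) \<le> d \<and> (\<forall>s\<in>B. d < inner c (cis s))) \<or>
               (\<forall>t\<in>A. inner c (cis t) < d \<and> (\<forall>s\<in>B. d \<le> inner c (cis s)))"
    for A B :: "real set"
  proof -
    from that(5) obtain c d where cd: "(\<forall>t\<in>A. inner c (cis t) \<le> d \<and> (\<forall>s\<in>B. d < inner c (cis s))) \<or>
               (\<forall>t\<in>A. inner c (cis t) < d \<and> (\<forall>s\<in>B. d \<le> inner c (cis s)))" by blast
    let ?f = "\<lambda>t. inner c (cis t)"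
    have fi: "finite (?f ` A)" "finite (?f ` B)" "?f ` A \<noteq> {}" "?f ` B \<noteq> {}" using f by auto
    have "Max (?f ` A) \<in> ?f ` A" "Min (?f ` B) \<in> ?f ` B" using fi by (auto intro: Max_in Min_in)
    then have "Max (?f ` A) < Min (?f ` B)" using cd f by fastforce
    moreover have "\<forall>t\<in>A. ?f t \<le> Max (?f ` A)" "\<forall>t\<in>B. Min (?f ` B) \<le> ?f t" using f by auto
    ultimately show ?thesis by blast
  qed
  have "Min A \<noteq> Min B" using Min_in[OF fin(1) ne(1)] Min_in[OF fin(2) ne(2)] dis by auto
  then consider "Min A < Min B" | "Min B < Min A" by linarith
  then show ?thesis
  proof cases
    case 1
    have "\<exists>c d e. d < e \<and> (\<forall>t\<in>A. inner c (cis t) \<le> d) \<and> (\<forall>t\<in>B. e \<le> inner c (cis t))"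
      by (rule key[OF fin ne], rule separate1[OF fin ne dis ran]) (use B2 nalt 1 in \<open>blast+\<close>)
    then show ?thesis by blast
  next
    case 2
    have "B \<inter> A = {}" using dis by auto
    then have "\<exists>c d e. d < e \<and> (\<forall>t\<in>B. inner c (cis t) \<le> d) \<and> (\<forall>t\<in>A. e \<le> inner c (cis t))"
      by (intro key[OF fin(2,1) ne(2,1)] separate1[OF fin(2,1) ne(2,1) _ ran(2,1)])
        (use A2 nalt' 2 in \<open>blast+\<close>)
    then show ?thesis by blast
  qed
qed

text \<open>Two different points of the circle on one ray from c would make one of them a proper
  convex combination of the other and c, hence a point inside the circle.\<close>

lemma ray_circle:
  fixes c p q :: complex
  assumes "norm c < r" "norm p = r" "norm q = r" "0 < s" "0 < t"
    "c + of_real s * (p - c) = c + of_real t * (q - c)"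
  shows "p = q"
proof -
  have *: "p = q" if "norm c < r" "norm p = r" "norm q = r" "0 < s" "s \<le> t"
    "of_real s * (p - c) = of_real t * (q - c)" for p q :: complex and s t :: real
  proof (rule ccontr)
    assume neq: "p \<noteq> q"
    define l where "l = s / t"
    have l: "0 < l" "l \<le> 1" using that by (auto simp: l_def)
    have "q - c = of_real l * (p - c)" using that by (auto simp: l_def field_simps)
    then have q: "q = of_real l * p + of_real (1 - l) * c" by (simp add: algebra_simps)
    have "l \<noteq> 1" using q neq by auto
    then have "(1 - l) * norm c < (1 - l) * r" using l that(1) by simp
    moreover have "norm q \<le> l * norm p + (1 - l) * norm c"
    proof -
      have "norm (of_real l * p) = l * norm p" using l by (simp add: norm_mult)
      moreover have "norm (of_real (1 - l) * c) = (1 - l) * norm c"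
        using l by (simp only: norm_mult norm_of_real)
      ultimately show ?thesis unfolding q using norm_triangle_ineq[of "of_real l * p" "of_real (1 - l) * c"] by simp
    qed
    ultimately show False using that l by (simp add: algebra_simps)
  qed
  have e: "of_real s * (p - c) = of_real t * (q - c)" using assms(6) by simp
  show ?thesis
  proof (cases "s \<le> t")
    case True
    then show ?thesis using *[OF assms(1-4) True e] by simp
  next
    case False
    then show ?thesis using *[OF assms(1,3,2,5) _ e[symmetric]] by simp
  qed
qed

text \<open>The picture of a cyclic word Sl with angles \<theta>: points with equal labels are joined by straight
  segments to their centroid, linked points by a tent outside the circle, except for the points of
  thr, from which a radius runs to the boundary of the disc.\<close>

locale picture =
  fixes Sl :: "'s set" and \<theta> :: "'s \<Rightarrow> real" and lb :: "'s \<Rightarrow> 'b" and lk :: "'s \<Rightarrow> 's"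
    and thr :: "'s set" and X :: "'b set"
  assumes fin: "finite Sl"
    and \<theta>_range: "x \<in> Sl \<Longrightarrow> 0 < \<theta> x" "x \<in> Sl \<Longrightarrow> \<theta> x < 2 * pi"
    and \<theta>_inj: "x \<in> Sl \<Longrightarrow> y \<in> Sl \<Longrightarrow> \<theta> x = \<theta> y \<Longrightarrow> x = y"
    and nalt: "x1 \<in> Sl \<Longrightarrow> y1 \<in> Sl \<Longrightarrow> x2 \<in> Sl \<Longrightarrow> y2 \<in> Sl \<Longrightarrow> \<theta> x1 < \<theta> y1 \<Longrightarrow> \<theta> y1 < \<theta> x2 \<Longrightarrow>
      \<theta> x2 < \<theta> y2 \<Longrightarrow> lb x1 = lb x2 \<Longrightarrow> lb y1 = lb y2 \<Longrightarrow> lb x1 \<noteq> lb y1 \<Longrightarrow> {lb x1, lb y1} = X"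
    and lk: "x \<in> Sl \<Longrightarrow> lk x \<in> Sl" "x \<in> Sl \<Longrightarrow> lk (lk x) = x" "x \<in> Sl \<Longrightarrow> lk x \<noteq> x"
    and thr_lk: "x \<in> thr \<Longrightarrow> lk x \<in> thr"
    and cap: "x \<in> Sl \<Longrightarrow> x \<notin> thr \<Longrightarrow> z \<in> Sl \<Longrightarrow> \<theta> x < \<theta> z \<Longrightarrow> \<theta> z < \<theta> (lk x) \<Longrightarrow>
      z \<notin> thr \<and> \<theta> x < \<theta> (lk z) \<and> \<theta> (lk z) < \<theta> (lk x)"
    and two: "x \<in> Sl \<Longrightarrow> \<exists>y\<in>Sl. y \<noteq> x \<and> lb y = lb x"
    and X2: "x \<in> Sl \<Longrightarrow> y \<in> Sl \<Longrightarrow> z \<in> Sl \<Longrightarrow> lb x \<in> X \<Longrightarrow> lb y = lb x \<Longrightarrow> lb z = lb x \<Longrightarrow> x = y \<or> y = z \<or> x = z"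
begin

definition pt :: "'s \<Rightarrow> complex" where "pt x = cis (\<theta> x) / 2"

definition blk :: "'b \<Rightarrow> 's set" where "blk b = {x \<in> Sl. lb x = b}"

definition cen :: "'b \<Rightarrow> complex" where "cen b = (\<Sum>x\<in>blk b. pt x) /\<^sub>R real (card (blk b))"

definition dl :: "'s \<Rightarrow> real" where "dl x = (\<theta> (lk x) - \<theta> x) / 2"

text \<open>All tents have the same slope, so those over disjoint or nested intervals do not meet.
  As the half width \<open>\<bar>dl x\<bar>\<close> is less than pi, the divisor 8 * pi keeps them
  within radius 5/8, away from the glued boundary.\<close>

definition g :: "'s \<Rightarrow> real \<Rightarrow> complex" where
  "g x t = (if t \<le> 1/2 then cen (lb x) + of_real (2 * t) * (pt x - cen (lb x))
            else if x \<in> thr then of_real t * cis (\<theta> x)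
            else of_real (1/2 + (2 * t - 1) * \<bar>dl x\<bar> / (8 * pi)) * cis (\<theta> x + (2 * t - 1) * dl x))"

lemma finite_blk[simp]: "finite (blk b)" using fin by (simp add: blk_def)

lemma card_blk: "x \<in> Sl \<Longrightarrow> 0 < card (blk (lb x))"
  using finite_blk[of "lb x"] by (auto simp: card_gt_0_iff blk_def)

lemma norm_pt[simp]: "norm (pt x) = 1/2" by (simp add: pt_def norm_divide)

lemma pt_inj:
  assumes "x \<in> Sl" "y \<in> Sl" "pt x = pt y" shows "x = y"
proof -
  have "\<bar>\<theta> x - \<theta> y\<bar> < 2 * pi" using \<theta>_range[OF assms(1)] \<theta>_range[OF assms(2)] by linarith
  then show ?thesis using assms cis_inj_on_period[of "\<theta> x" "\<theta> y"] \<theta>_inj by (auto simp: pt_def)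
qed

lemma inner_cen: "x \<in> Sl \<Longrightarrow> inner c (cen (lb x)) = (\<Sum>y\<in>blk (lb x). inner c (pt y)) / card (blk (lb x))"
  by (simp add: cen_def inner_sum_right divide_inverse mult.commute)

lemma cen_le:
  assumes "x \<in> Sl" "\<And>y. y \<in> blk (lb x) \<Longrightarrow> inner c (pt y) \<le> d"
  shows "inner c (cen (lb x)) \<le> d"
proof -
  have "(\<Sum>y\<in>blk (lb x). inner c (pt y)) \<le> of_nat (card (blk (lb x))) * d"
    using assms(2) by (rule sum_bounded_above)
  then show ?thesis using card_blk[OF assms(1)] inner_cen[OF assms(1)] by (simp add: field_simps)
qed

text \<open>A centroid on the circle would have to coincide with every point of its block, but by
  \<open>two\<close> a block has at least two points.\<close>

lemma norm_cen: assumes "x \<in> Sl" shows "norm (cen (lb x)) < 1/2"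
proof -
  let ?B = "blk (lb x)" let ?c = "cen (lb x)"
  have ub: "norm ?c \<le> 1/2"
  proof -
    have "norm (\<Sum>x\<in>?B. pt x) \<le> (\<Sum>x\<in>?B. 1/2)" by (rule sum_norm_le) simp
    then show ?thesis using card_blk[OF assms] by (simp add: cen_def field_simps)
  qed
  moreover have False if eq: "norm ?c = 1/2"
  proof -
    have le: "inner ?c (pt y) \<le> 1/4" for y
      using norm_cauchy_schwarz[of ?c "pt y"] eq by simp
    have cc: "inner ?c ?c = 1/4" using eq by (simp only: dot_square_norm power2_eq_square)
    have all: "inner ?c (pt y) = 1/4" if y: "y \<in> ?B" for y
    proof (rule ccontr)
      assume "inner ?c (pt y) \<noteq> 1/4"
      then have "inner ?c (pt y) < 1/4" using le[of y] by simp
      then have "(\<Sum>y\<in>?B. inner ?c (pt y)) < (\<Sum>y\<in>?B. 1/4)"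
        using y le by (intro sum_strict_mono_ex1) auto
      then show False using cc inner_cen[OF assms, of ?c] card_blk[OF assms] by (simp add: field_simps)
    qed
    have pc: "pt y = ?c" if "y \<in> ?B" for y
    proof -
      have "inner (pt y - ?c) (pt y - ?c) = 0"
        using all[OF that] cc dot_square_norm[of "pt y"]
        by (simp add: inner_diff inner_commute power2_eq_square)
      then show ?thesis by simp
    qed
    obtain y where "y \<in> Sl" "y \<noteq> x" "lb y = lb x" using two[OF assms] by blast
    then show False using pc[of x] pc[of y] pt_inj[of x y] assms by (auto simp: blk_def)
  qed
  ultimately show ?thesis using order_le_imp_less_or_eq by blast
qed

lemma g0: "g x 0 = cen (lb x)" by (simp add: g_def)
lemma ghalf: "g x (1/2) = pt x" by (simp add: g_def)

lemma g_leg: "t \<le> 1/2 \<Longrightarrow> g x t = of_real (1 - 2 * t) * cen (lb x) + of_real (2 * t) * pt x"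
  by (simp add: g_def algebra_simps)

lemma inner_of_real: "inner c (of_real u * z) = u * inner c z" for c z :: complex
  by (simp add: inner_complex_def algebra_simps)

lemma norm_leg:
  assumes "x \<in> Sl" "0 \<le> t" "t < 1/2" shows "norm (g x t) < 1/2"
proof -
  have "norm (g x t) \<le> norm (of_real (1 - 2 * t) * cen (lb x)) + norm (of_real (2 * t) * pt x)"
    using assms by (simp only: g_leg less_imp_le norm_triangle_ineq)
  also have "\<dots> = (1 - 2 * t) * norm (cen (lb x)) + (2 * t) * (1/2)"
    using assms by (simp only: norm_mult norm_of_real norm_pt)
  also have "\<dots> < (1 - 2 * t) * (1/2) + (2 * t) * (1/2)"
    using norm_cen[OF assms(1)] assms by (intro add_strict_right_mono mult_strict_left_mono) auto
  finally show ?thesis by (simp add: algebra_simps)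
qed

lemma dl_bound: assumes "x \<in> Sl" shows "\<bar>dl x\<bar> < pi"
proof -
  have "\<bar>\<theta> (lk x) - \<theta> x\<bar> < 2 * pi"
    using \<theta>_range[OF assms] \<theta>_range[OF lk(1)[OF assms]] by linarith
  then show ?thesis by (simp add: dl_def)
qed

definition rad :: "'s \<Rightarrow> real \<Rightarrow> real" where
  "rad x t = (if x \<in> thr then t else 1/2 + (2 * t - 1) * \<bar>dl x\<bar> / (8 * pi))"

definition ang :: "'s \<Rightarrow> real \<Rightarrow> real" where
  "ang x t = (if x \<in> thr then \<theta> x else \<theta> x + (2 * t - 1) * dl x)"

lemma g_out: "1/2 \<le> t \<Longrightarrow> g x t = of_real (rad x t) * cis (ang x t)"
proof (cases "t = 1/2")
  case True
  show ?thesis unfolding True by (simp add: ghalf rad_def ang_def pt_def)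
qed (simp add: g_def rad_def ang_def)

lemma rad_bounds:
  assumes "x \<in> Sl" "1/2 \<le> t" "t \<le> 1"
  shows "1/2 \<le> rad x t" "rad x t \<le> 1" "rad x t = 1 \<Longrightarrow> x \<in> thr \<and> t = 1"
proof -
  have "(2 * t - 1) * \<bar>dl x\<bar> \<le> 1 * pi"
    using assms dl_bound[OF assms(1)] by (intro mult_mono) auto
  then have "(2 * t - 1) * \<bar>dl x\<bar> / (8 * pi) \<le> 1/8"
    by (simp add: field_simps)
  moreover define u where "u = (2 * t - 1) * \<bar>dl x\<bar> / (8 * pi)"
  moreover have "0 \<le> u" using assms by (simp add: u_def)
  ultimately show "1/2 \<le> rad x t" "rad x t \<le> 1" "rad x t = 1 \<Longrightarrow> x \<in> thr \<and> t = 1"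
    using assms unfolding rad_def u_def[symmetric] by (auto split: if_splits)
qed

lemma ang_range:
  assumes "x \<in> Sl" "1/2 \<le> t" "t \<le> 1"
  shows "0 < ang x t" "ang x t < 2 * pi"
    "x \<notin> thr \<Longrightarrow> min (\<theta> x) (\<theta> (lk x)) \<le> ang x t \<and> ang x t \<le> max (\<theta> x) (\<theta> (lk x))"
proof -
  have x: "0 < \<theta> x" "\<theta> x < 2 * pi" "0 < \<theta> (lk x)" "\<theta> (lk x) < 2 * pi"
    using \<theta>_range lk assms by auto
  have *: "min (\<theta> x) (\<theta> (lk x)) \<le> ang x t \<and> ang x t \<le> max (\<theta> x) (\<theta> (lk x))" if "x \<notin> thr"
  proof (cases "0 \<le> dl x")
    case True
    then have "0 \<le> (2 * t - 1) * dl x" "(2 * t - 1) * dl x \<le> 1 * dl x"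
      using assms by (intro mult_nonneg_nonneg mult_right_mono; simp)+
    then show ?thesis using True that by (auto simp: ang_def dl_def)
  next
    case False
    then have "0 \<le> (2 * t - 1) * (- dl x)" "(2 * t - 1) * (- dl x) \<le> 1 * (- dl x)"
      using assms by (intro mult_nonneg_nonneg mult_right_mono; simp)+
    then show ?thesis using False that by (auto simp: ang_def dl_def)
  qed
  then show "x \<notin> thr \<Longrightarrow> min (\<theta> x) (\<theta> (lk x)) \<le> ang x t \<and> ang x t \<le> max (\<theta> x) (\<theta> (lk x))" .
  show "0 < ang x t" "ang x t < 2 * pi"
    using * x by (cases "x \<in> thr"; auto simp: ang_def)+
qed

lemma norm_out: "x \<in> Sl \<Longrightarrow> 1/2 \<le> t \<Longrightarrow> t \<le> 1 \<Longrightarrow> norm (g x t) = rad x t"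
  using rad_bounds(1)[of x t] by (simp add: g_out norm_mult)

lemma g_disc: assumes "x \<in> Sl" "0 \<le> t" "t \<le> 1" shows "norm (g x t) \<le> 1"
proof (cases "t < 1/2")
  case True then show ?thesis using norm_leg[OF assms(1,2)] by simp
next
  case False then show ?thesis using norm_out[OF assms(1)] rad_bounds(2)[OF assms(1)] assms by simp
qed

lemma rad_ang_cap:
  assumes "x \<notin> thr" "1/2 \<le> t"
  shows "rad x t = 1/2 + \<bar>ang x t - \<theta> x\<bar> / (8 * pi)"
  using assms by (simp add: rad_def ang_def abs_mult)

text \<open>Two half tents at the same height over the same angle have feet at the same distance,
  hence they are the two halves of one tent.\<close>

lemma caps_meet:
  assumes xy: "x \<in> Sl" "y \<in> Sl" "x \<notin> thr" "y \<notin> thr" "\<theta> x < \<theta> y"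
    and st: "1/2 \<le> s" "s \<le> 1" "1/2 \<le> t" "t \<le> 1"
    and eq: "rad x s = rad y t" "ang x s = ang y t"
  shows "y = lk x \<and> s = 1 \<and> t = 1"
proof -
  define p where "p = ang x s"
  have "\<bar>p - \<theta> x\<bar> = \<bar>p - \<theta> y\<bar>"
    using eq rad_ang_cap[OF xy(3) st(1)] rad_ang_cap[OF xy(4) st(3)] by (simp add: p_def)
  then have p: "p - \<theta> x = \<theta> y - p" "\<theta> x < p" "p < \<theta> y" using xy(5) by linarith+
  have sx: "p - \<theta> x = (2 * s - 1) * dl x" using xy(3) by (simp add: p_def ang_def)
  have ty: "p - \<theta> y = (2 * t - 1) * dl y" using xy(4) eq by (simp add: p_def ang_def)
  have dx: "0 < dl x"
  proof (rule ccontr)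
    assume "\<not> 0 < dl x"
    then have "(2 * s - 1) * dl x \<le> 0" using st by (intro mult_nonneg_nonpos) auto
    then show False using sx p by simp
  qed
  have dy: "dl y < 0"
  proof (rule ccontr)
    assume "\<not> dl y < 0"
    then have "0 \<le> (2 * t - 1) * dl y" using st by (intro mult_nonneg_nonneg) auto
    then show False using ty p by simp
  qed
  have "(2 * s - 1) * dl x \<le> 1 * dl x" using dx st by (intro mult_right_mono) auto
  then have y: "\<theta> y \<le> \<theta> (lk x)" using sx p by (simp add: dl_def)
  have "(2 * t - 1) * (- dl y) \<le> 1 * (- dl y)" using dy st by (intro mult_right_mono) auto
  then have x: "\<theta> (lk y) \<le> \<theta> x" using ty p by (simp add: dl_def)
  have lky: "lk y = x"
  proof (rule ccontr)
    assume "lk y \<noteq> x"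
    then have "\<theta> (lk y) < \<theta> x" using x \<theta>_inj[of "lk y" x] lk xy by (cases "\<theta> (lk y) = \<theta> x") auto
    moreover have "lk y \<notin> thr" using thr_lk[of "lk y"] lk xy by auto
    ultimately have "\<theta> (lk x) < \<theta> y"
      using cap[of "lk y" x] lk xy by auto
    then show False using y by simp
  qed
  then have "y = lk x" using lk xy by auto
  moreover have "s = 1"
  proof -
    have "2 * (p - \<theta> x) = \<theta> y - \<theta> x" using p by simp
    then have "(2 * s - 1) * dl x = 1 * dl x" using sx \<open>y = lk x\<close> by (simp add: dl_def)
    then show ?thesis using dx by (subst (asm) mult_right_cancel) auto
  qed
  moreover have "t = 1"
  proof -
    have "2 * (p - \<theta> y) = \<theta> x - \<theta> y" using p by simp
    then have "(2 * t - 1) * dl y = 1 * dl y" using ty lky by (simp add: dl_def)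
    then show ?thesis using dy by (subst (asm) mult_right_cancel) auto
  qed
  ultimately show ?thesis by simp
qed

lemma caps_same:
  assumes "x \<in> Sl" "x \<notin> thr" "ang x s = ang x t" shows "s = t"
proof -
  have "\<theta> (lk x) \<noteq> \<theta> x" using lk \<theta>_inj assms by blast
  then show ?thesis using assms by (auto simp: ang_def dl_def)
qed

text \<open>The radius of a through point could meet a tent only at an angle between two linked
  points, where \<open>cap\<close> admits no through point.\<close>

lemma thr_cap:
  assumes xy: "x \<in> Sl" "y \<in> Sl" "x \<in> thr" "y \<notin> thr" and st: "1/2 \<le> s" "s \<le> 1" "1/2 \<le> t" "t \<le> 1"
    and eq: "ang x s = ang y t"
  shows False
proof -
  have a: "\<theta> x = ang y t" using eq xy(3) by (simp add: ang_def)
  have ne: "\<theta> x \<noteq> \<theta> y" "\<theta> x \<noteq> \<theta> (lk y)"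
    using xy \<theta>_inj[of x y] \<theta>_inj[of x "lk y"] lk thr_lk[of "lk y"] thr_lk[of y] thr_lk[of x] by auto
  have b: "min (\<theta> y) (\<theta> (lk y)) \<le> \<theta> x \<and> \<theta> x \<le> max (\<theta> y) (\<theta> (lk y))"
    using ang_range(3)[OF xy(2) st(3,4) xy(4)] a by simp
  have ly: "lk y \<in> Sl" "lk y \<notin> thr" "lk (lk y) = y" using lk xy thr_lk[of "lk y"] by auto
  consider "\<theta> y < \<theta> x" "\<theta> x < \<theta> (lk y)" | "\<theta> (lk y) < \<theta> x" "\<theta> x < \<theta> y"
    using b ne by (auto simp: min_def max_def split: if_splits)
  then show False
  proof cases
    case 1 then show ?thesis using cap[OF xy(2,4,1)] xy by auto
  next
    case 2 then show ?thesis using cap[OF ly(1,2) xy(1)] ly xy by auto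
  qed
qed

text \<open>All angles lie strictly between 0 and 2 pi, so polar coordinates are unique and the
  pieces can be compared by radius and angle.\<close>

lemma outer_inj:
  assumes xy: "x \<in> Sl" "y \<in> Sl" and st: "1/2 \<le> s" "s \<le> 1" "1/2 \<le> t" "t \<le> 1"
    and eq: "g x s = g y t"
  shows "x = y \<and> s = t \<or> s = 1 \<and> t = 1 \<and> y = lk x"
proof -
  have "\<bar>ang x s - ang y t\<bar> < 2 * pi"
    using ang_range[OF xy(1) st(1,2)] ang_range[OF xy(2) st(3,4)] by linarith
  then have ra: "rad x s = rad y t" "ang x s = ang y t"
    using eq polar_inj[of "rad x s" "ang x s" "rad y t" "ang y t"] rad_bounds(1)[OF xy(1) st(1,2)]
      rad_bounds(1)[OF xy(2) st(3,4)] st by (auto simp: g_out)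
  consider "x \<in> thr" "y \<in> thr" | "x \<in> thr" "y \<notin> thr" | "x \<notin> thr" "y \<in> thr" | "x \<notin> thr" "y \<notin> thr"
    by blast
  then show ?thesis
  proof cases
    case 1
    then show ?thesis using ra \<theta>_inj xy by (auto simp: rad_def ang_def)
  next
    case 2
    then show ?thesis using thr_cap[OF xy 2 st ra(2)] by simp
  next
    case 3
    then show ?thesis using thr_cap[OF xy(2,1) 3(2,1) st(3,4,1,2) ra(2)[symmetric]] by simp
  next
    case 4
    consider "\<theta> x < \<theta> y" | "\<theta> y < \<theta> x" | "x = y" using \<theta>_inj[OF xy] by linarith
    then show ?thesis
    proof cases
      case 1
      then show ?thesis using caps_meet[OF xy 4 1 st ra] by simp
    next
      case 2
      then show ?thesis
        using caps_meet[OF xy(2,1) 4(2,1) 2 st(3,4,1,2) ra[symmetric]] lk xy by auto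
    next
      case 3
      then show ?thesis using caps_same[of x s t] ra xy 4 by auto
    qed
  qed
qed

lemma same_block:
  assumes "x \<in> Sl" "y \<in> Sl" "lb x = lb y" "0 \<le> s" "s \<le> 1/2" "0 \<le> t" "t \<le> 1/2" "g x s = g y t"
  shows "x = y \<and> s = t \<or> s = 0 \<and> t = 0"
proof -
  let ?c = "cen (lb x)"
  have e: "?c + of_real (2 * s) * (pt x - ?c) = ?c + of_real (2 * t) * (pt y - ?c)"
    using assms by (simp add: g_def)
  have pc: "pt z \<noteq> cen (lb z)" if "z \<in> Sl" for z
  proof
    assume "pt z = cen (lb z)"
    then have "norm (cen (lb z)) = 1/2" using norm_pt[of z] by (simp only:)
    then show False using norm_cen[OF that] by simp
  qed
  consider "s = 0" | "t = 0" | "0 < s" "0 < t" using assms by linarith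
  then show ?thesis
  proof cases
    case 1 then show ?thesis using e pc[of y] assms by auto
  next
    case 2 then show ?thesis using e pc[of x] assms by auto
  next
    case 3
    have "pt x = pt y"
      by (rule ray_circle[OF norm_cen[OF assms(1)] norm_pt norm_pt _ _ e]) (use 3 in auto)
    then have "x = y" using pt_inj assms by auto
    then show ?thesis using e pc[of x] assms by auto
  qed
qed

lemma inner_leg_le:
  assumes "x \<in> Sl" "0 \<le> t" "t \<le> 1/2" "\<And>y. y \<in> blk (lb x) \<Longrightarrow> inner c (pt y) \<le> d"
  shows "inner c (g x t) \<le> d"
proof -
  have "x \<in> blk (lb x)" using assms(1) by (simp add: blk_def)
  then have "inner c (pt x) \<le> d" by (rule assms(4))
  moreover have "inner c (cen (lb x)) \<le> d" using cen_le[OF assms(1,4)] .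
  moreover have "inner c (g x t) = (1 - 2 * t) * inner c (cen (lb x)) + (2 * t) * inner c (pt x)"
    by (simp only: g_leg[OF assms(3)] inner_add_right inner_of_real)
  moreover have "(1 - 2 * t) * inner c (cen (lb x)) \<le> (1 - 2 * t) * d" "(2 * t) * inner c (pt x) \<le> (2 * t) * d"
    using calculation(1,2) assms(2,3) by (intro mult_left_mono; simp)+
  ultimately show ?thesis by (simp add: algebra_simps)
qed

lemma inner_leg_ge:
  assumes "x \<in> Sl" "0 \<le> t" "t \<le> 1/2" "\<And>y. y \<in> blk (lb x) \<Longrightarrow> d \<le> inner c (pt y)"
  shows "d \<le> inner c (g x t)"
  using inner_leg_le[OF assms(1-3), of "- c" "- d"] assms(4) by simp

text \<open>Legs stay in the convex hull of their block, and the hulls of two blocks that do not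
  alternate are strictly separated by a line.\<close>

lemma different_blocks:
  assumes xy: "x \<in> Sl" "y \<in> Sl" "lb x \<noteq> lb y" "{lb x, lb y} \<noteq> X"
    and st: "0 \<le> s" "s \<le> 1/2" "0 \<le> t" "t \<le> 1/2"
  shows "g x s \<noteq> g y t"
proof
  assume eq: "g x s = g y t"
  let ?A = "\<theta> ` blk (lb x)" and ?B = "\<theta> ` blk (lb y)"
  have two': "\<exists>b'\<in>\<theta> ` blk (lb z). b' \<noteq> b" if bz: "b \<in> \<theta> ` blk (lb z)" for b z
  proof -
    obtain u where u: "u \<in> Sl" "lb u = lb z" "b = \<theta> u" using bz unfolding blk_def by blast
    obtain v where "v \<in> Sl" "v \<noteq> u" "lb v = lb u" using two[OF u(1)] by blast
    then show ?thesis using u \<theta>_inj[of v u] by (intro bexI[of _ "\<theta> v"]) (auto simp: blk_def)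
  qed
  have nalt1: False if "a \<in> \<theta> ` blk (lb x)" "b \<in> \<theta> ` blk (lb y)" "a' \<in> \<theta> ` blk (lb x)" "b' \<in> \<theta> ` blk (lb y)"
    "a < b" "b < a'" "a' < b'" "lb x \<noteq> lb y" "{lb x, lb y} \<noteq> X" for a b a' b' x y
  proof -
    from that obtain x1 x2 y1 y2 where *: "x1 \<in> Sl" "lb x1 = lb x" "a = \<theta> x1" "y1 \<in> Sl" "lb y1 = lb y" "b = \<theta> y1"
      "x2 \<in> Sl" "lb x2 = lb x" "a' = \<theta> x2" "y2 \<in> Sl" "lb y2 = lb y" "b' = \<theta> y2"
      by (auto simp: blk_def)
    then show False using nalt[of x1 y1 x2 y2] that by auto
  qed
  have "\<exists>c d e. d < e \<and> ((\<forall>t\<in>?A. inner c (cis t) \<le> d) \<and> (\<forall>t\<in>?B. e \<le> inner c (cis t)) \<or>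
     (\<forall>t\<in>?B. inner c (cis t) \<le> d) \<and> (\<forall>t\<in>?A. e \<le> inner c (cis t)))"
  proof (rule separate)
    show "finite ?A" "finite ?B" by auto
    show "?A \<noteq> {}" "?B \<noteq> {}" using xy by (auto simp: blk_def)
    show "?A \<inter> ?B = {}"
    proof (rule ccontr)
      assume "?A \<inter> ?B \<noteq> {}"
      then obtain u v where "u \<in> Sl" "v \<in> Sl" "lb u = lb x" "lb v = lb y" "\<theta> u = \<theta> v"
        by (auto simp: blk_def)
      then show False using \<theta>_inj[of u v] xy(3) by simp
    qed
    show "?A \<subseteq> {0<..<2*pi}" "?B \<subseteq> {0<..<2*pi}" using \<theta>_range by (auto simp: blk_def)
    show False if "a \<in> ?A" "b \<in> ?B" "a' \<in> ?A" "b' \<in> ?B" "a < b" "b < a'" "a' < b'" for a b a' b'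
      using nalt1[OF that xy(3,4)] .
    have xy': "lb y \<noteq> lb x" "{lb y, lb x} \<noteq> X" using xy(3,4) by (auto simp: insert_commute)
    show False if "a \<in> ?B" "b \<in> ?A" "a' \<in> ?B" "b' \<in> ?A" "a < b" "b < a'" "a' < b'" for a b a' b'
      using nalt1[OF that xy'] .
    show "\<exists>b'\<in>?A. b' \<noteq> b" if "b \<in> ?A" for b using two'[OF that] .
    show "\<exists>b'\<in>?B. b' \<noteq> b" if "b \<in> ?B" for b using two'[OF that] .
  qed
  then obtain c d e where de: "d < e" and sep: "(\<forall>t\<in>?A. inner c (cis t) \<le> d) \<and> (\<forall>t\<in>?B. e \<le> inner c (cis t)) \<or>
     (\<forall>t\<in>?B. inner c (cis t) \<le> d) \<and> (\<forall>t\<in>?A. e \<le> inner c (cis t))" by blast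
  have ip: "inner c (pt z) = inner c (cis (\<theta> z)) / 2" for z by (simp add: pt_def inner_complex_def)
  from sep show False
  proof
    assume "(\<forall>t\<in>?A. inner c (cis t) \<le> d) \<and> (\<forall>t\<in>?B. e \<le> inner c (cis t))"
    then have "inner c (g x s) \<le> d / 2" "e / 2 \<le> inner c (g y t)"
      by (intro inner_leg_le inner_leg_ge; use xy st in \<open>auto simp: ip\<close>)+
    then show False using eq de by simp
  next
    assume "(\<forall>t\<in>?B. inner c (cis t) \<le> d) \<and> (\<forall>t\<in>?A. e \<le> inner c (cis t))"
    then have "inner c (g y t) \<le> d / 2" "e / 2 \<le> inner c (g x s)"
      by (intro inner_leg_le inner_leg_ge; use xy st in \<open>auto simp: ip\<close>)+
    then show False using eq de by simp
  qed
qed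

end

section \<open>The surfaces as quotient spaces\<close>

lemma glue_norm: "(z, w) \<in> glue k \<Longrightarrow> norm z = 1 \<and> norm w = 1"
  by (auto simp: glue_def split: if_splits)

lemma glue_rel_refl: "(z, z) \<in> glue_rel k"
  by (simp add: glue_rel_def)

lemma glue_rel_sym: "(z, w) \<in> glue_rel k \<Longrightarrow> (w, z) \<in> glue_rel k"
proof -
  have "sym (glue k \<union> (glue k)\<inverse> \<union> Id_on disc)" by (auto simp: sym_def)
  then have "sym (glue_rel k)" unfolding glue_rel_def by (rule sym_rtrancl)
  then show "(z, w) \<in> glue_rel k \<Longrightarrow> (w, z) \<in> glue_rel k" by (rule symD)
qed

lemma glue_rel_trans: "(z, w) \<in> glue_rel k \<Longrightarrow> (w, v) \<in> glue_rel k \<Longrightarrow> (z, v) \<in> glue_rel k"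
  unfolding glue_rel_def by (rule rtrancl_trans)

lemma glue_rel_glue: "(z, w) \<in> glue k \<Longrightarrow> (z, w) \<in> glue_rel k"
  unfolding glue_rel_def by auto

text \<open>The means to bound the classes of the generated equivalence from above: a set that
  respects the generators contains or misses each class.\<close>

lemma glue_rel_invariant:
  assumes "(z, w) \<in> glue_rel k" "\<And>a b. (a, b) \<in> glue k \<Longrightarrow> a \<in> S \<longleftrightarrow> b \<in> S"
  shows "z \<in> S \<longleftrightarrow> w \<in> S"
  using assms(1) unfolding glue_rel_def
  by (induction rule: rtrancl_induct) (use assms(2) in auto)

lemma glue_rel_disc:
  assumes "(z, w) \<in> glue_rel k" shows "z \<in> disc \<longleftrightarrow> w \<in> disc"
  by (rule glue_rel_invariant[OF assms]) (auto simp: disc_def dest: glue_norm)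

lemma glue_rel_interior:
  assumes "(z, w) \<in> glue_rel k" "norm z < 1" shows "w = z"
proof -
  have "z \<in> {z} \<longleftrightarrow> w \<in> {z}"
    by (rule glue_rel_invariant[OF assms(1)]) (use assms(2) in \<open>auto dest: glue_norm\<close>)
  then show ?thesis by simp
qed

definition prj :: "nat \<Rightarrow> complex \<Rightarrow> complex set" where
  "prj k z = glue_rel k `` {z}"

lemma prj_eq_iff: "prj k z = prj k w \<longleftrightarrow> (z, w) \<in> glue_rel k"
proof
  assume "prj k z = prj k w"
  moreover have "w \<in> prj k w" by (simp add: prj_def glue_rel_refl)
  ultimately have "w \<in> prj k z" by (simp only:)
  then show "(z, w) \<in> glue_rel k" by (simp add: prj_def)
next
  assume zw: "(z, w) \<in> glue_rel k"
  show "prj k z = prj k w"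
    unfolding prj_def
    using glue_rel_trans[OF zw] glue_rel_trans[OF glue_rel_sym[OF zw]] by (intro set_eqI) blast
qed

lemma prj_quotient: "disc // glue_rel k = prj k ` disc"
  by (auto simp: quotient_def prj_def)

lemma Union_prj:
  assumes "U \<subseteq> prj k ` disc"
  shows "\<Union>U = {z \<in> disc. prj k z \<in> U}"
proof (intro set_eqI iffI)
  fix z assume "z \<in> \<Union>U"
  then obtain w where w: "w \<in> disc" "prj k w \<in> U" "z \<in> prj k w" using assms by blast
  then have "(w, z) \<in> glue_rel k" by (simp add: prj_def)
  then have "prj k w = prj k z" "z \<in> disc" using prj_eq_iff glue_rel_disc w(1) by auto
  then show "z \<in> {z \<in> disc. prj k z \<in> U}" using w by simp
next
  fix z assume "z \<in> {z \<in> disc. prj k z \<in> U}"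
  moreover have "z \<in> prj k z" by (simp add: prj_def glue_rel_refl)
  ultimately show "z \<in> \<Union>U" by blast
qed

lemma openin_Nsurf:
  "openin (Nsurf k) U \<longleftrightarrow> U \<subseteq> prj k ` disc \<and> openin (top_of_set disc) {z \<in> disc. prj k z \<in> U}"
proof -
  let ?P = "\<lambda>U. U \<subseteq> prj k ` disc \<and> openin (top_of_set disc) {z \<in> disc. prj k z \<in> U}"
  have eq: "(U \<subseteq> topspace (top_of_set disc) // glue_rel k \<and> openin (top_of_set disc) (\<Union>U)) \<longleftrightarrow> ?P U" for U
    unfolding topspace_euclidean_subtopology prj_quotient using Union_prj[of U k] by auto
  have "istopology ?P"
    unfolding istopology_def
  proof (intro conjI allI impI)
    fix S T assume "?P S" "?P T"
    moreover have "{z \<in> disc. prj k z \<in> S \<inter> T} = {z \<in> disc. prj k z \<in> S} \<inter> {z \<in> disc. prj k z \<in> T}" by auto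
    ultimately show "S \<inter> T \<subseteq> prj k ` disc" "openin (top_of_set disc) {z \<in> disc. prj k z \<in> S \<inter> T}"
      by auto
  next
    fix K assume *: "\<forall>S\<in>K. ?P S"
    moreover have "{z \<in> disc. prj k z \<in> \<Union>K} = \<Union>((\<lambda>S. {z \<in> disc. prj k z \<in> S}) ` K)" by auto
    ultimately show "\<Union>K \<subseteq> prj k ` disc" "openin (top_of_set disc) {z \<in> disc. prj k z \<in> \<Union>K}"
      by (auto intro!: openin_Union simp del: UN_simps)
  qed
  then show ?thesis unfolding Nsurf_def quotient_top_def eq by simp
qed

lemma topspace_Nsurf: "topspace (Nsurf k) = prj k ` disc"
proof -
  have "{z \<in> disc. prj k z \<in> prj k ` disc} = disc" by auto
  then have "openin (Nsurf k) (prj k ` disc)" unfolding openin_Nsurf by auto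
  then show ?thesis using openin_Nsurf[of k "topspace (Nsurf k)"] openin_subset[of "Nsurf k"] by auto
qed

lemma quotient_map_prj: "quotient_map (top_of_set disc) (Nsurf k) (prj k)"
  unfolding quotient_map_def topspace_Nsurf openin_Nsurf by auto

lemma continuous_map_prj: "continuous_map (top_of_set disc) (Nsurf k) (prj k)"
  using quotient_map_prj quotient_imp_continuous_map by blast

text \<open>The set of the point and its partner respects \<open>glue\<close>. In units of pi / k
  the first arcs are the intervals from 2 i to 2 i + 1; since \<open>u\<close> lies strictly inside
  one of them and \<open>v\<close> in one of them, they cannot differ by exactly 1.\<close>

lemma glue_rel_side:
  assumes rel: "(cis \<theta>, w) \<in> glue_rel k" and i: "i < k"
    and \<theta>: "2 * pi * real i / real k < \<theta>" "\<theta> < 2 * pi * real i / real k + pi / real k"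
  shows "w = cis \<theta> \<or> w = cis (\<theta> + pi / real k)"
proof -
  have k: "0 < k" using i by simp
  let ?S = "{cis \<theta>, cis (\<theta> + pi / real k)}"
  have "cis \<theta> \<in> ?S \<longleftrightarrow> w \<in> ?S"
  proof (rule glue_rel_invariant[OF rel])
    fix a b assume "(a, b) \<in> glue k"
    then obtain \<phi> j where ab: "a = cis \<phi>" "b = cis (\<phi> + pi / real k)" "j < k"
      "2 * pi * real j / real k \<le> \<phi>" "\<phi> \<le> 2 * pi * real j / real k + pi / real k"
      using k by (auto simp: glue_def)
    define u where "u = k * \<theta> / pi"
    define v where "v = k * \<phi> / pi"
    have u: "2 * real i < u" "u < 2 * real i + 1" using \<theta> k by (auto simp: u_def field_simps)
    have v: "2 * real j \<le> v" "v \<le> 2 * real j + 1" using ab k by (auto simp: v_def field_simps)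
    have \<theta>u: "\<theta> = u * pi / k" "\<phi> = v * pi / k" using k by (auto simp: u_def v_def)
    have ij: "real i \<le> real k - 1" "real j \<le> real k - 1" using i ab(3) by linarith+
    have cs: "x = y" if "cis (x * pi / k) = cis (y * pi / k)" "\<bar>x - y\<bar> < 2 * real k" for x y
    proof -
      have "x * pi / k - y * pi / k = (x - y) * (pi / k)" using k by (simp add: divide_simps) (simp add: algebra_simps)
      then have "\<bar>x * pi / k - y * pi / k\<bar> = \<bar>x - y\<bar> * (pi / k)" using k by (simp only: abs_mult) simp
      also have "\<dots> < 2 * real k * (pi / k)"
        by (rule mult_strict_right_mono) (use that(2) k in auto)
      also have "\<dots> = 2 * pi" using k by simp
      finally have "\<bar>x * pi / k - y * pi / k\<bar> < 2 * pi" .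
      then have "x * pi / k = y * pi / k" by (rule cis_inj_on_period[OF that(1)])
      then show ?thesis using k by simp
    qed
    have pl: "\<theta> + pi / k = (u + 1) * pi / k" "\<phi> + pi / k = (v + 1) * pi / k"
      using \<theta>u by (auto simp: distrib_right add_divide_distrib)
    have neq: "u \<noteq> v + 1" "v \<noteq> u + 1"
    proof -
      show "u \<noteq> v + 1"
      proof
        assume "u = v + 1"
        then have "2 * real i < 2 * real j + 2" "2 * real j + 1 < 2 * real i + 1" using u v by linarith+
        then have "real i < real (j + 1)" "real j < real i" by simp_all
        then have "i < j + 1" "j < i" by (simp_all only: of_nat_less_iff)
        then show False by simp
      qed
      show "v \<noteq> u + 1"
      proof
        assume "v = u + 1"
        then have "2 * real j < 2 * real i + 2" "2 * real i + 1 < 2 * real j + 1" using u v by linarith+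
        then have "real j < real (i + 1)" "real i < real j" by simp_all
        then have "j < i + 1" "i < j" by (simp_all only: of_nat_less_iff)
        then show False by simp
      qed
    qed
    have ab2: "\<bar>v - u\<bar> < 2 * real k" "\<bar>v - (u + 1)\<bar> < 2 * real k" "\<bar>v + 1 - u\<bar> < 2 * real k"
      "\<bar>v + 1 - (u + 1)\<bar> < 2 * real k"
      using u v ij by linarith+
    show "a \<in> ?S \<longleftrightarrow> b \<in> ?S"
    proof
      assume "a \<in> ?S"
      then have "v = u \<or> v = u + 1"
        unfolding ab pl using cs[OF _ ab2(1)] cs[OF _ ab2(2)] unfolding \<theta>u by auto
      then show "b \<in> ?S" using neq unfolding ab pl by auto
    next
      assume "b \<in> ?S"
      then have "v + 1 = u \<or> v + 1 = u + 1"
        unfolding ab pl using cs[OF _ ab2(3)] cs[OF _ ab2(4)] unfolding \<theta>u by auto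
      then show "a \<in> ?S" using neq unfolding ab by (auto simp: \<theta>u)
    qed
  qed
  then show ?thesis by auto
qed

section \<open>Uniqueness of the crossing and injectivity in the surface\<close>

context picture
begin

text \<open>By \<open>X2\<close> a block with an exempt label has just two points, so its legs form
  the straight segment between them.\<close>

lemma leg_segment:
  assumes "x1 \<in> Sl" "x2 \<in> Sl" "x1 \<noteq> x2" "lb x1 = lb x2" "lb x1 \<in> X" "y \<in> Sl" "lb y = lb x1" "0 \<le> t" "t \<le> 1/2"
  shows "\<exists>u. g y t = of_real (1 - u) * pt x1 + of_real u * pt x2"
proof -
  have "blk (lb x1) = {x1, x2}" using X2 assms by (auto simp: blk_def)
  then have c: "cen (lb y) = pt x1 / 2 + pt x2 / 2"
    using assms by (simp add: cen_def scaleR_conv_of_real field_simps)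
  have alg: "of_real (1 - 2 * t) * (a / 2 + b / 2) + of_real (2 * t) * a =
    of_real (1 - (1 - 2 * t) / 2) * a + of_real ((1 - 2 * t) / 2) * b"
    "of_real (1 - 2 * t) * (b / 2 + a / 2) + of_real (2 * t) * a =
    of_real (1 - (2 * t + (1 - 2 * t) / 2)) * b + of_real (2 * t + (1 - 2 * t) / 2) * a" for a b :: complex
    by (simp_all add: complex_eq_iff algebra_simps diff_divide_distrib)
  have "x1 = x2 \<or> x2 = y \<or> x1 = y" by (rule X2[OF assms(1,2,6,5)]) (simp_all only: assms(4,7))
  then have "y = x1 \<or> y = x2" using assms(3) by blast
  then show ?thesis
  proof
    assume "y = x1"
    then have "g y t = of_real (1 - (1 - 2 * t) / 2) * pt x1 + of_real ((1 - 2 * t) / 2) * pt x2"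
      unfolding g_leg[OF assms(9)] c by (simp only: alg)
    then show ?thesis by blast
  next
    assume "y = x2"
    then have "g y t = of_real (1 - (2 * t + (1 - 2 * t) / 2)) * pt x1 + of_real (2 * t + (1 - 2 * t) / 2) * pt x2"
      unfolding g_leg[OF assms(9)] c by (simp only: alg)
    then show ?thesis by blast
  qed
qed

text \<open>The legs of the first block lie on the line \<open>inner c z = d\<close>, and by
  injectivity of the angles no point of the second block lies on that line. The line through the
  second block therefore meets it for one parameter only.\<close>

lemma cross_unique:
  assumes Sl: "x \<in> Sl" "y \<in> Sl" "x' \<in> Sl" "y' \<in> Sl"
    and lb: "lb x' = lb x" "lb y' = lb y" "lb x \<noteq> lb y" "{lb x, lb y} = X"
    and st: "0 \<le> s" "s \<le> 1/2" "0 \<le> t" "t \<le> 1/2" "0 \<le> s'" "s' \<le> 1/2" "0 \<le> t'" "t' \<le> 1/2"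
    and eq: "g x s = g y t" "g x' s' = g y' t'"
  shows "g x s = g x' s'"
proof -
  have X: "lb x \<in> X" "lb y \<in> X" using lb by auto
  obtain x1 x2 where x12: "x1 \<in> Sl" "x2 \<in> Sl" "\<theta> x1 < \<theta> x2" "lb x1 = lb x" "lb x2 = lb x"
  proof -
    obtain z where z: "z \<in> Sl" "z \<noteq> x" "lb z = lb x" using two[OF Sl(1)] by blast
    then have "\<theta> z \<noteq> \<theta> x" using \<theta>_inj Sl(1) by blast
    then consider "\<theta> z < \<theta> x" | "\<theta> x < \<theta> z" by linarith
    then show ?thesis using that[of z x] that[of x z] z Sl(1) by cases auto
  qed
  obtain y2 where y2: "y2 \<in> Sl" "y2 \<noteq> y" "lb y2 = lb y" using two[OF Sl(2)] by blast
  define c where "c = cis ((\<theta> x1 + \<theta> x2) / 2)"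
  define d where "d = cos ((\<theta> x2 - \<theta> x1) / 2) / 2"
  have ip: "inner c (pt z) = inner c (cis (\<theta> z)) / 2" for z by (simp add: pt_def inner_complex_def)
  have r: "0 < \<theta> x1" "\<theta> x2 < 2 * pi" using \<theta>_range x12 by auto
  have on: "inner c (pt z) = d" if "z \<in> Sl" "lb z = lb x" for z
  proof -
    have "z = x1 \<or> z = x2" using X2[OF x12(1,2) that(1)] x12 that X by auto
    then show ?thesis
      using chord_sign(4)[OF x12(3) r, of "\<theta> z"] \<theta>_range[OF that(1)] unfolding ip unfolding d_def c_def by auto
  qed
  have off: "inner c (pt z) \<noteq> d" if "z \<in> Sl" "lb z = lb y" for z
  proof -
    have "z \<noteq> x1" "z \<noteq> x2" using that x12 lb(3) by auto
    then have "\<theta> z \<noteq> \<theta> x1" "\<theta> z \<noteq> \<theta> x2" using \<theta>_inj that x12 by blast+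
    then consider "\<theta> z < \<theta> x1" | "\<theta> x1 < \<theta> z" "\<theta> z < \<theta> x2" | "\<theta> x2 < \<theta> z" by linarith
    then show ?thesis
      using chord_sign(1-3)[OF x12(3) r, of "\<theta> z"] \<theta>_range[OF that(1)] unfolding ip unfolding d_def c_def
      by cases auto
  qed
  have line: "inner c (g z u) = d" if "z \<in> Sl" "lb z = lb x" "0 \<le> u" "u \<le> 1/2" for z u
    using inner_leg_le[OF that(1,3,4), of c d] inner_leg_ge[OF that(1,3,4), of d c] on that(2)
    by (force simp: blk_def)
  obtain u where u: "g y t = of_real (1 - u) * pt y + of_real u * pt y2"
    using leg_segment[of y y2 y t] Sl y2 X st by auto
  obtain u' where u': "g y' t' = of_real (1 - u') * pt y + of_real u' * pt y2"
    using leg_segment[of y y2 y' t'] Sl y2 X st lb by auto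
  have 1: "(1 - u) * inner c (pt y) + u * inner c (pt y2) = d"
    using line[of x s] Sl st eq(1) u by (simp add: inner_add_right inner_of_real del: of_real_diff)
  have 2: "(1 - u') * inner c (pt y) + u' * inner c (pt y2) = d"
    using line[of x' s'] Sl st lb eq(2) u' by (simp add: inner_add_right inner_of_real del: of_real_diff)
  define p where "p = inner c (pt y)"
  define q where "q = inner c (pt y2)"
  have "p \<noteq> d" using off[OF Sl(2)] by (simp add: p_def)
  have "p + u * (q - p) = d" "p + u' * (q - p) = d"
    using 1 2 unfolding p_def[symmetric] q_def[symmetric] by (simp_all add: algebra_simps)
  then have "u * (q - p) = u' * (q - p)" "q - p \<noteq> 0" using \<open>p \<noteq> d\<close> by auto
  then have "u = u'" by simp
  then show ?thesis using eq u u' by simp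
qed

lemma g_inj:
  assumes xy: "x \<in> Sl" "y \<in> Sl" and st: "0 \<le> s" "s \<le> 1" "0 \<le> t" "t \<le> 1" and eq: "g x s = g y t"
  shows "x = y \<and> s = t \<or> s = 0 \<and> t = 0 \<and> lb x = lb y \<or> s = 1 \<and> t = 1 \<and> y = lk x \<or>
    lb x \<noteq> lb y \<and> {lb x, lb y} = X \<and> s < 1/2 \<and> t < 1/2 \<and> g x s = g y t"
proof -
  consider "s < 1/2" "t < 1/2" | "s < 1/2" "1/2 \<le> t" | "1/2 \<le> s" "t < 1/2" | "1/2 \<le> s" "1/2 \<le> t" by linarith
  then show ?thesis
  proof cases
    case 1
    show ?thesis
    proof (cases "lb x = lb y")
      case True
      then show ?thesis using same_block[OF xy True] 1 st eq by auto
    next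
      case False
      then show ?thesis using different_blocks[OF xy False _ st(1) _ st(3)] 1 eq by fastforce
    qed
  next
    case 2
    then show ?thesis
      using norm_leg[OF xy(1) st(1)] norm_out[OF xy(2) _ st(4)] rad_bounds(1)[OF xy(2) _ st(4)] eq by auto
  next
    case 3
    then show ?thesis
      using norm_leg[OF xy(2) st(3)] norm_out[OF xy(1) _ st(2)] rad_bounds(1)[OF xy(1) _ st(2)] eq by auto
  next
    case 4
    then show ?thesis using outer_inj[OF xy 4(1) st(2) 4(2) st(4) eq] by auto
  qed
qed

lemma g_apex:
  assumes "x \<in> Sl" "x \<notin> thr" shows "g x 1 = g (lk x) 1"
proof -
  have "lk x \<notin> thr" using thr_lk[of "lk x"] lk assms by auto
  moreover have "dl (lk x) = - dl x" unfolding dl_def lk(2)[OF assms(1)] by (simp add: minus_divide_left)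
  ultimately have "g (lk x) 1 = of_real (1/2 + \<bar>dl x\<bar> / (8 * pi)) * cis (\<theta> (lk x) - dl x)"
    by (simp add: g_def)
  moreover have "g x 1 = of_real (1/2 + \<bar>dl x\<bar> / (8 * pi)) * cis (\<theta> x + dl x)"
    using assms by (simp add: g_def)
  moreover have "\<theta> (lk x) - dl x = \<theta> x + dl x" by (simp add: dl_def field_simps)
  ultimately show ?thesis by (simp only:)
qed

lemma continuous_g: "continuous_on {0..1} (g x)"
proof -
  have 1: "continuous_on {0..1/2} (g x)"
  proof (rule continuous_on_eq)
    show "continuous_on {0..1/2} (\<lambda>t. of_real (1 - 2 * t) * cen (lb x) + of_real (2 * t) * pt x)"
      by (intro continuous_intros)
  qed (use g_leg in auto)
  have 2: "continuous_on {1/2..1} (g x)"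
  proof (rule continuous_on_eq)
    show "continuous_on {1/2..1} (\<lambda>t. of_real (rad x t) * cis (ang x t))"
      unfolding rad_def ang_def by (cases "x \<in> thr") (auto intro!: continuous_intros)
  qed (use g_out in auto)
  have "{0..1/2} \<union> {1/2..1} = {0..(1::real)}" by auto
  then show ?thesis using continuous_on_closed_Un[OF _ _ 1 2] by simp
qed

end

text \<open>Linked through points sit at corresponding places of the two arcs of a glued pair, so
  that their radii end in identified boundary points. The strict bounds keep them away from the ends
  of the arcs.\<close>

locale surface_picture = picture +
  fixes k :: nat
  assumes thrk: "x \<in> Sl \<Longrightarrow> x \<in> thr \<Longrightarrow> \<exists>y i. i < k \<and> (y = x \<or> y = lk x) \<and>
     2 * pi * real i / real k < \<theta> y \<and> \<theta> y < 2 * pi * real i / real k + pi / real k \<and>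
     \<theta> (lk y) = \<theta> y + pi / real k"
begin

definition h :: "'a \<Rightarrow> real \<Rightarrow> complex set" where
  "h x t = prj k (g x t)"

lemma h_link:
  assumes "x \<in> Sl" shows "h x 1 = h (lk x) 1"
proof (cases "x \<in> thr")
  case False
  then show ?thesis using g_apex[OF assms] by (simp add: h_def)
next
  case True
  then obtain y i where y: "i < k" "y = x \<or> y = lk x" "2 * pi * real i / real k < \<theta> y"
    "\<theta> y < 2 * pi * real i / real k + pi / real k" "\<theta> (lk y) = \<theta> y + pi / real k"
    using thrk[OF assms] by blast
  have "(cis (\<theta> y), cis (\<theta> (lk y))) \<in> glue k"
  proof -
    have "(cis (\<theta> y), cis (\<theta> y + pi / real k)) \<in> {(cis \<phi>, cis (\<phi> + pi / real k)) | \<phi> i. i < k \<and>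
        2 * pi * real i / real k \<le> \<phi> \<and> \<phi> \<le> 2 * pi * real i / real k + pi / real k}"
      by (intro CollectI exI[of _ "\<theta> y"] exI[of _ i]) (use y(1,3,4) in simp)
    moreover have "k \<noteq> 0" using y(1) by simp
    ultimately show ?thesis unfolding y(5) glue_def by (simp only: if_False)
  qed
  then have e: "prj k (cis (\<theta> y)) = prj k (cis (\<theta> (lk y)))"
    unfolding prj_eq_iff by (rule glue_rel_glue)
  from y(2) have "prj k (cis (\<theta> x)) = prj k (cis (\<theta> (lk x)))"
  proof
    assume "y = x" then show ?thesis using e by simp
  next
    assume y: "y = lk x" show ?thesis using e[symmetric] unfolding y lk(2)[OF assms] .
  qed
  then show ?thesis using True thr_lk[OF True] by (simp add: h_def g_def)
qed

text \<open>Inside the disc the projection identifies nothing. On the boundary circle only ends of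
  radii of through points occur, and \<open>glue_rel_side\<close> determines their classes.\<close>

lemma h_inj:
  assumes xy: "x \<in> Sl" "y \<in> Sl" and st: "0 \<le> s" "s \<le> 1" "0 \<le> t" "t \<le> 1" and eq: "h x s = h y t"
  shows "x = y \<and> s = t \<or> s = 0 \<and> t = 0 \<and> lb x = lb y \<or> s = 1 \<and> t = 1 \<and> y = lk x \<or>
    lb x \<noteq> lb y \<and> {lb x, lb y} = X \<and> s < 1/2 \<and> t < 1/2 \<and> g x s = g y t"
proof -
  have rel: "(g x s, g y t) \<in> glue_rel k" using eq by (simp add: h_def prj_eq_iff)
  have thr1: "x \<in> thr \<and> s = 1" if "\<not> norm (g x s) < 1" "x \<in> Sl" "0 \<le> s" "s \<le> 1" for x s
  proof -
    have "\<not> s < 1/2" using norm_leg[OF that(2,3)] that(1) by auto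
    then have s: "1/2 \<le> s" by simp
    have "rad x s = 1" using norm_out[OF that(2) s that(4)] rad_bounds(2)[OF that(2) s that(4)] that(1) by simp
    then show ?thesis using rad_bounds(3)[OF that(2) s that(4)] by simp
  qed
  consider "norm (g x s) < 1" | "norm (g y t) < 1" | "\<not> norm (g x s) < 1" "\<not> norm (g y t) < 1" by blast
  then show ?thesis
  proof cases
    case 1
    then have "g x s = g y t" using glue_rel_interior[OF rel] by simp
    then show ?thesis by (rule g_inj[OF xy st])
  next
    case 2
    then have "g x s = g y t" using glue_rel_interior[OF glue_rel_sym[OF rel]] by simp
    then show ?thesis by (rule g_inj[OF xy st])
  next
    case 3
    have x: "x \<in> thr" "s = 1" using thr1[OF 3(1) xy(1) st(1,2)] by auto
    have y: "y \<in> thr" "t = 1" using thr1[OF 3(2) xy(2) st(3,4)] by auto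
    obtain z i where z: "i < k" "z = x \<or> z = lk x" "2 * pi * real i / real k < \<theta> z"
      "\<theta> z < 2 * pi * real i / real k + pi / real k" "\<theta> (lk z) = \<theta> z + pi / real k"
      using thrk[OF xy(1) x(1)] by blast
    have zS: "z \<in> Sl" "z \<in> thr" using z(2) xy x thr_lk lk by auto
    have "h z 1 = h x 1" using z(2) h_link[OF xy(1)] by auto
    then have "h z 1 = h y 1" using eq x y by simp
    then have "(cis (\<theta> z), cis (\<theta> y)) \<in> glue_rel k"
      using zS y by (simp add: h_def g_def prj_eq_iff)
    then have "cis (\<theta> y) = cis (\<theta> z) \<or> cis (\<theta> y) = cis (\<theta> (lk z))"
      using glue_rel_side[OF _ z(1,3,4)] z(5) by auto
    then have "pt y = pt z \<or> pt y = pt (lk z)" by (auto simp: pt_def)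
    then have "y = z \<or> y = lk z" using pt_inj xy(2) zS lk by blast
    then show ?thesis using z(2) x y lk(2)[OF xy(1)] by auto
  qed
qed

lemma continuous_map_h:
  assumes "x \<in> Sl" shows "continuous_map (top_of_set {0..1}) (Nsurf k) (h x)"
proof -
  have "continuous_map (top_of_set {0..1}) (top_of_set disc) (g x)"
    using continuous_g g_disc[OF assms] by (auto simp: disc_def)
  then have "continuous_map (top_of_set {0..1}) (Nsurf k) (prj k \<circ> g x)"
    using continuous_map_prj continuous_map_compose by blast
  then show ?thesis by (rule continuous_map_eq) (simp add: h_def)
qed

lemma h_topspace: "x \<in> Sl \<Longrightarrow> 0 \<le> t \<Longrightarrow> t \<le> 1 \<Longrightarrow> h x t \<in> topspace (Nsurf k)"
  using g_disc by (auto simp: h_def topspace_Nsurf disc_def)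

end

section \<open>Edges assembled from half edges\<close>

locale graph_picture = surface_picture Sl \<theta> lb lk thr X k
  for Sl :: "'s set" and \<theta> and lb :: "'s \<Rightarrow> 'v + 'c" and lk thr X k +
  fixes V :: "'v set" and E :: "('v \<times> 'v) set" and N :: "'v \<times> 'v \<Rightarrow> nat" and sq :: "'v \<times> 'v \<Rightarrow> nat \<Rightarrow> 's"
  assumes finE: "finite E"
    and N: "e \<in> E \<Longrightarrow> even (N e)" "e \<in> E \<Longrightarrow> 2 \<le> N e"
    and sq_in: "e \<in> E \<Longrightarrow> i < N e \<Longrightarrow> sq e i \<in> Sl"
    and sq_lk: "e \<in> E \<Longrightarrow> i < N e \<Longrightarrow> lk (sq e i) = sq e (if even i then Suc i else i - 1)"
    and sq_inj: "e \<in> E \<Longrightarrow> f \<in> E \<Longrightarrow> i < N e \<Longrightarrow> j < N f \<Longrightarrow> sq e i = sq f j \<Longrightarrow> e = f \<and> i = j"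
    and lb_first: "e \<in> E \<Longrightarrow> lb (sq e 0) = Inl (fst e)"
    and lb_last: "e \<in> E \<Longrightarrow> lb (sq e (N e - 1)) = Inl (snd e)"
    and lb_mid: "e \<in> E \<Longrightarrow> 0 < i \<Longrightarrow> i < N e - 1 \<Longrightarrow> \<exists>c. lb (sq e i) = Inr c"
    and lb_eq: "e \<in> E \<Longrightarrow> f \<in> E \<Longrightarrow> 0 < i \<Longrightarrow> i < N e - 1 \<Longrightarrow> 0 < j \<Longrightarrow> j < N f - 1 \<Longrightarrow>
      lb (sq e i) = lb (sq f j) \<Longrightarrow> e = f \<and> (i + 1) div 2 = (j + 1) div 2"
    and lb_pass: "e \<in> E \<Longrightarrow> odd i \<Longrightarrow> Suc i < N e \<Longrightarrow> lb (sq e (Suc i)) = lb (sq e i)"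
    and V: "v \<in> V \<Longrightarrow> \<exists>x\<in>Sl. lb x = Inl v"
    and X_Inr: "X \<subseteq> range Inr"
    and X_edge: "e \<in> E \<Longrightarrow> i < N e \<Longrightarrow> j < N e \<Longrightarrow> lb (sq e i) \<in> X \<Longrightarrow> lb (sq e j) \<in> X \<Longrightarrow> lb (sq e i) = lb (sq e j)"
begin

text \<open>Slots with even number are traversed from the centre of their block outwards, those with
  odd number from the link inwards, so consecutive slots fit together.\<close>

definition loc :: "nat \<Rightarrow> real \<Rightarrow> real" where
  "loc i y = (if even i then y - real i else 1 - (y - real i))"

definition gam :: "'v \<times> 'v \<Rightarrow> real \<Rightarrow> complex set" where
  "gam e t = (let y = real (N e) * t; i = min (nat \<lfloor>y\<rfloor>) (N e - 1) in h (sq e i) (loc i y))"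

definition vpt :: "'v \<Rightarrow> complex set" where
  "vpt v = prj k (cen (Inl v))"

lemma h0: "h x 0 = prj k (cen (lb x))"
  by (simp add: h_def g0)

text \<open>Where two slots of an edge meet, both give the same point: the common link if i is even,
  the common centre if i is odd.\<close>

lemma gam_eq:
  assumes e: "e \<in> E" "i < N e" and y: "real i \<le> real (N e) * t" "real (N e) * t \<le> real i + 1"
  shows "gam e t = h (sq e i) (loc i (real (N e) * t))"
proof (cases "real (N e) * t = real i + 1 \<and> Suc i < N e")
  case False
  have "min (nat \<lfloor>real (N e) * t\<rfloor>) (N e - 1) = i"
  proof (cases "real (N e) * t = real i + 1")
    case True
    then have "nat \<lfloor>real (N e) * t\<rfloor> = Suc i" by linarith
    then show ?thesis using False True e by auto
  next
    case False
    then have "nat \<lfloor>real (N e) * t\<rfloor> = i" using y by linarith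
    then show ?thesis using e by auto
  qed
  then show ?thesis by (simp add: gam_def Let_def)
next
  case True
  then have "nat \<lfloor>real (N e) * t\<rfloor> = Suc i" by linarith
  then have "min (nat \<lfloor>real (N e) * t\<rfloor>) (N e - 1) = Suc i" using True by auto
  then have *: "gam e t = h (sq e (Suc i)) (loc (Suc i) (real i + 1))" using True by (simp add: gam_def Let_def)
  show ?thesis
  proof (cases "even i")
    case ev: True
    then have "lk (sq e i) = sq e (Suc i)" using sq_lk[OF e] by simp
    then have "h (sq e i) 1 = h (sq e (Suc i)) 1" using h_link[OF sq_in[OF e]] by simp
    then show ?thesis using * True ev by (simp add: loc_def)
  next
    case od: False
    then have "lb (sq e (Suc i)) = lb (sq e i)" using lb_pass[OF e(1)] True by simp
    then have "h (sq e i) 0 = h (sq e (Suc i)) 0" by (simp add: h0)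
    then show ?thesis using * True od by (simp add: loc_def)
  qed
qed

lemma loc_range: "real i \<le> y \<Longrightarrow> y \<le> real i + 1 \<Longrightarrow> 0 \<le> loc i y \<and> loc i y \<le> 1"
  by (auto simp: loc_def)

lemma position:
  assumes e: "e \<in> E" and t: "0 \<le> t" "t \<le> 1"
  obtains i where "i < N e" "real i \<le> real (N e) * t" "real (N e) * t \<le> real i + 1"
proof -
  let ?y = "real (N e) * t"
  have y: "0 \<le> ?y" "?y \<le> real (N e)" using t by (auto simp: mult_left_le)
  show ?thesis
  proof (cases "?y = real (N e)")
    case True
    show ?thesis by (rule that[of "N e - 1"]) (use True N(2)[OF e] in \<open>auto simp: of_nat_diff\<close>)
  next
    case False
    show ?thesis
    proof (rule that[of "nat \<lfloor>?y\<rfloor>"])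
      show "nat \<lfloor>?y\<rfloor> < N e" using y False by linarith
      show "real (nat \<lfloor>?y\<rfloor>) \<le> ?y" "?y \<le> real (nat \<lfloor>?y\<rfloor>) + 1" using y by linarith+
    qed
  qed
qed

lemma continuous_gam:
  assumes e: "e \<in> E" shows "continuous_map (top_of_set {0..1}) (Nsurf k) (gam e)"
proof (rule pasting_lemma_closed[where I = "{..<N e}" and T = "\<lambda>i. {real i / N e .. (real i + 1) / N e}" and f = "\<lambda>i. gam e"])
  have n: "0 < real (N e)" using N(2)[OF e] by simp
  show "finite {..<N e}" by simp
  fix i assume i: "i \<in> {..<N e}"
  let ?T = "{real i / N e .. (real i + 1) / N e}"
  have iN: "real i + 1 \<le> real (N e)" using i by simp
  then have sub: "?T \<subseteq> {0..1}" using n by (auto simp: field_simps intro: order_trans)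
  then show "closedin (top_of_set {0..1}) ?T" by (intro closed_subset) auto
  have st: "subtopology (top_of_set {0..1}) ?T = top_of_set ?T"
  proof -
    have "{0..1} \<inter> ?T = ?T" using sub by blast
    then show ?thesis by (simp only: subtopology_subtopology)
  qed
  have loc: "0 \<le> loc i (real (N e) * t) \<and> loc i (real (N e) * t) \<le> 1" "gam e t = h (sq e i) (loc i (real (N e) * t))"
    if "t \<in> ?T" for t
  proof -
    have t: "real i \<le> real (N e) * t" "real (N e) * t \<le> real i + 1"
      using that n by (auto simp: field_simps)
    show "0 \<le> loc i (real (N e) * t) \<and> loc i (real (N e) * t) \<le> 1" using loc_range[OF t] .
    show "gam e t = h (sq e i) (loc i (real (N e) * t))" using gam_eq[OF e _ t] i by simp
  qed
  have "continuous_on ?T (\<lambda>t. loc i (real (N e) * t))"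
    unfolding loc_def by (cases "even i") (auto intro!: continuous_intros)
  then have "continuous_map (top_of_set ?T) (top_of_set {0..1}) (\<lambda>t. loc i (real (N e) * t))"
    using loc(1) by auto
  then have "continuous_map (top_of_set ?T) (Nsurf k) (h (sq e i) \<circ> (\<lambda>t. loc i (real (N e) * t)))"
    by (rule continuous_map_compose) (use continuous_map_h sq_in e i in auto)
  then have "continuous_map (top_of_set ?T) (Nsurf k) (gam e)"
    by (rule continuous_map_eq) (use loc(2) in auto)
  then show "continuous_map (subtopology (top_of_set {0..1}) ?T) (Nsurf k) (gam e)" unfolding st .
next
  fix x assume "x \<in> topspace (top_of_set {0..1::real})"
  then have x: "0 \<le> x" "x \<le> 1" by auto
  obtain i where i: "i < N e" "real i \<le> real (N e) * x" "real (N e) * x \<le> real i + 1"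
    using position[OF e x] .
  have "0 < real (N e)" using N(2)[OF e] by simp
  then show "\<exists>j. j \<in> {..<N e} \<and> x \<in> {real j / N e .. (real j + 1) / N e} \<and> gam e x = gam e x"
    using i by (intro exI[of _ i]) (auto simp: field_simps)
qed auto

lemma not_vertex_slot:
  assumes e: "e \<in> E" "i < N e" "lb (sq e i) = Inl v"
  shows "i = 0 \<or> i = N e - 1"
  using lb_mid[OF e(1), of i] e by force

text \<open>Equal slots, equal centres and equal links in \<open>h_inj\<close> each lead back to the
  same parameter of the same edge; centres that are vertices are reached only at the parameters 0
  and 1. The alternation of the exempt labels is all that remains.\<close>

lemma gam_inj:
  assumes e: "e \<in> E" "i < N e" "real i \<le> real (N e) * s" "real (N e) * s \<le> real i + 1" "0 < s" "s < 1"
    and f: "f \<in> E" "j < N f" "real j \<le> real (N f) * t" "real (N f) * t \<le> real j + 1" "0 < t" "t < 1"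
    and eq: "gam e s = gam f t"
  shows "e = f \<and> s = t \<or> (let a = loc i (real (N e) * s); b = loc j (real (N f) * t); x = sq e i; y = sq f j in
     lb x \<noteq> lb y \<and> {lb x, lb y} = X \<and> 0 \<le> a \<and> a < 1/2 \<and> 0 \<le> b \<and> b < 1/2 \<and> g x a = g y b)"
proof -
  define a where "a = loc i (real (N e) * s)"
  define b where "b = loc j (real (N f) * t)"
  have ab: "0 \<le> a" "a \<le> 1" "0 \<le> b" "b \<le> 1" using loc_range e f by (auto simp: a_def b_def)
  have n: "0 < real (N e)" "0 < real (N f)" using N(2) e f by fastforce+
  have dn: "s = t" if "e = f" "real (N e) * s = real (N f) * t" using that n by simp
  have "h (sq e i) a = h (sq f j) b"
    using eq gam_eq[OF e(1-4)] gam_eq[OF f(1-4)] by (simp add: a_def b_def)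
  from h_inj[OF sq_in[OF e(1,2)] sq_in[OF f(1,2)] ab this]
  consider "sq e i = sq f j" "a = b" | "a = 0" "b = 0" "lb (sq e i) = lb (sq f j)"
    | "a = 1" "b = 1" "sq f j = lk (sq e i)"
    | "lb (sq e i) \<noteq> lb (sq f j)" "{lb (sq e i), lb (sq f j)} = X" "a < 1/2" "b < 1/2" "g (sq e i) a = g (sq f j) b"
    by blast
  then show ?thesis
  proof cases
    case 1
    then have "e = f" "i = j" using sq_inj e f by blast+
    then have "real (N e) * s = real (N f) * t" using 1(2) by (auto simp: a_def b_def loc_def split: if_splits)
    then show ?thesis using dn \<open>e = f\<close> by simp
  next
    case 2
    have vs: False if "e \<in> E" "i < N e" "loc i (real (N e) * s) = 0" "lb (sq e i) = Inl v" "0 < s" "s < 1"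
      for e i s v
    proof -
      have n: "0 < real (N e)" "odd (N e - 1)" "2 \<le> N e" using N that(1) by fastforce+
      have "i = 0 \<or> i = N e - 1" using not_vertex_slot that by blast
      then show False
      proof
        assume "i = 0"
        then show False using that n by (simp add: loc_def)
      next
        assume i: "i = N e - 1"
        then have "real (N e) * s = real i + 1" using that(3) n(2) by (simp add: loc_def)
        also have "\<dots> = real (N e)" using i n(3) by (simp add: of_nat_diff)
        finally show False using n that(6) by simp
      qed
    qed
    have vse: "lb (sq e i) \<noteq> Inl v" for v using vs[OF e(1,2) 2(1)[unfolded a_def] _ e(5,6)] by blast
    have vsf: "lb (sq f j) \<noteq> Inl v" for v using vs[OF f(1,2) 2(2)[unfolded b_def] _ f(5,6)] by blast
    have "i \<noteq> 0" by (rule notI) (use vse[of "fst e"] lb_first[OF e(1)] in simp)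
    moreover have "i \<noteq> N e - 1" by (rule notI) (use vse[of "snd e"] lb_last[OF e(1)] in simp)
    moreover have "j \<noteq> 0" by (rule notI) (use vsf[of "fst f"] lb_first[OF f(1)] in simp)
    moreover have "j \<noteq> N f - 1" by (rule notI) (use vsf[of "snd f"] lb_last[OF f(1)] in simp)
    ultimately have ef: "e = f" "(i + 1) div 2 = (j + 1) div 2"
      using lb_eq[OF e(1) f(1) _ _ _ _ 2(3)] e(2) f(2) by auto
    have pos: "real (N e) * s = 2 * real ((i + 1) div 2)" if "loc i (real (N e) * s) = 0" for e i s
    proof (cases "even i")
      case True
      then show ?thesis using that by (auto simp: loc_def elim!: evenE)
    next
      case False
      then show ?thesis using that by (auto simp: loc_def elim!: oddE)
    qed
    have "real (N e) * s = real (N f) * t"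
      using pos[of i e s] pos[of j f t] 2(1,2) ef(2) by (simp add: a_def b_def)
    then show ?thesis using dn ef(1) by simp
  next
    case 3
    define i' where "i' = (if even i then Suc i else i - 1)"
    have "even (N e)" using N e by simp
    then have i': "i' < N e" using e(2) by (cases "even i") (auto simp: i'_def elim!: evenE)
    have "sq f j = sq e i'" using 3(3) sq_lk[OF e(1,2)] by (simp add: i'_def)
    then have ef: "f = e" "j = i'" using sq_inj[OF f(1) e(1) f(2) i'] by auto
    have "y = z" if "loc i y = 1" "loc i' z = 1" for y z
      using that by (cases "even i") (auto simp: loc_def i'_def of_nat_diff elim!: oddE)
    then have "real (N e) * s = real (N f) * t" using 3(1,2) ef unfolding a_def b_def by blast
    then show ?thesis using dn ef(1) by simp
  next
    case 4
    then show ?thesis using ab by (simp add: a_def b_def Let_def)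
  qed
qed

lemma gam_not_vertex:
  assumes e: "e \<in> E" "0 < t" "t < 1" and v: "v \<in> V" shows "gam e t \<noteq> vpt v"
proof
  assume eq: "gam e t = vpt v"
  obtain i where i: "i < N e" "real i \<le> real (N e) * t" "real (N e) * t \<le> real i + 1"
    using position[OF e(1)] e by (metis less_imp_le)
  obtain x where x: "x \<in> Sl" "lb x = Inl v" using V[OF v] by blast
  define a where "a = loc i (real (N e) * t)"
  have ab: "0 \<le> a" "a \<le> 1" using loc_range i by (auto simp: a_def)
  have "h x 0 = h (sq e i) a" using eq gam_eq[OF e(1) i] x by (simp add: h0 vpt_def a_def)
  from h_inj[OF x(1) sq_in[OF e(1) i(1)] _ _ ab this] X_Inr x(2)
  have a0: "a = 0" "lb (sq e i) = Inl v" by auto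
  then have "i = 0 \<or> i = N e - 1" using not_vertex_slot e i by blast
  have n: "0 < real (N e)" "odd (N e - 1)" "2 \<le> N e" using N e by fastforce+
  from \<open>i = 0 \<or> i = N e - 1\<close> show False
  proof
    assume "i = 0"
    then show False using a0 e n by (simp add: loc_def a_def)
  next
    assume i: "i = N e - 1"
    then have "real (N e) * t = real i + 1" using a0(1) n(2) by (simp add: loc_def a_def)
    also have "\<dots> = real (N e)" using i n(3) by (simp add: of_nat_diff)
    finally show False using n e by simp
  qed
qed

lemma vpt_inj: "inj_on vpt V"
proof (rule inj_onI)
  fix v w assume v: "v \<in> V" "w \<in> V" "vpt v = vpt w"
  obtain x y where x: "x \<in> Sl" "lb x = Inl v" "y \<in> Sl" "lb y = Inl w" using V v by metis
  have "h x 0 = h y 0" using v x by (simp add: h0 vpt_def)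
  from h_inj[OF x(1,3) _ _ _ _ this] X_Inr x show "v = w" by auto
qed

lemma gam_0: assumes "e \<in> E" shows "gam e 0 = vpt (fst e)"
  using gam_eq[OF assms, of 0 0] N(2)[OF assms] lb_first[OF assms] by (simp add: loc_def h0 vpt_def)

lemma gam_1: assumes "e \<in> E" shows "gam e 1 = vpt (snd e)"
proof -
  have n: "odd (N e - 1)" "2 \<le> N e" using N assms by fastforce+
  then have "gam e 1 = h (sq e (N e - 1)) (loc (N e - 1) (real (N e)))"
    using gam_eq[OF assms, of "N e - 1" 1] by (simp add: of_nat_diff)
  also have "loc (N e - 1) (real (N e)) = 0" using n by (simp add: loc_def of_nat_diff)
  finally show ?thesis using lb_last[OF assms] by (simp add: h0 vpt_def)
qed

definition on_leg :: "'v \<times> 'v \<Rightarrow> real \<Rightarrow> 's \<Rightarrow> real \<Rightarrow> bool" where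
  "on_leg e s x a \<longleftrightarrow> e \<in> E \<and> 0 < s \<and> s < 1 \<and> x \<in> Sl \<and> 0 \<le> a \<and> a < 1/2 \<and>
     (\<exists>i<N e. x = sq e i \<and> real i \<le> real (N e) * s \<and> real (N e) * s \<le> real i + 1 \<and> a = loc i (real (N e) * s))"

definition meets :: "'v \<times> 'v \<Rightarrow> real \<Rightarrow> 'v \<times> 'v \<Rightarrow> real \<Rightarrow> 's \<Rightarrow> real \<Rightarrow> 's \<Rightarrow> real \<Rightarrow> bool" where
  "meets e s f t x a y b \<longleftrightarrow> on_leg e s x a \<and> on_leg f t y b \<and> lb x \<noteq> lb y \<and> {lb x, lb y} = X \<and> g x a = g y b"

lemma meets_commute: "meets e s f t x a y b \<Longrightarrow> meets f t e s y b x a"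
  unfolding meets_def by (elim conjE) (simp add: insert_commute)

lemma crossing_meets:
  assumes "e \<in> E" "f \<in> E" "0 < s" "s < 1" "0 < t" "t < 1" "GE e s \<noteq> GE f t" "gam e s = gam f t"
  obtains x a y b where "meets e s f t x a y b"
proof -
  obtain i where i: "i < N e" "real i \<le> real (N e) * s" "real (N e) * s \<le> real i + 1"
    by (rule position[OF assms(1) less_imp_le[OF assms(3)] less_imp_le[OF assms(4)]])
  obtain j where j: "j < N f" "real j \<le> real (N f) * t" "real (N f) * t \<le> real j + 1"
    by (rule position[OF assms(2) less_imp_le[OF assms(5)] less_imp_le[OF assms(6)]])
  have "meets e s f t (sq e i) (loc i (real (N e) * s)) (sq f j) (loc j (real (N f) * t))"
    using gam_inj[OF assms(1) i assms(3,4,2) j assms(5,6,8)] assms i j sq_in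
    unfolding meets_def on_leg_def Let_def by blast
  then show ?thesis by (rule that)
qed

text \<open>The two exempt chords have one common point by \<open>cross_unique\<close>, and with
  equal labels \<open>gam_inj\<close> leaves only one place of the graph over it.\<close>

lemma meets_same:
  assumes "meets e s f t x a y b" "meets e' s' f' t' x' a' y' b'" "lb x' = lb x"
  shows "GE e s = GE e' s'"
proof -
  have m: "lb x \<noteq> lb y" "{lb x, lb y} = X" "g x a = g y b" "lb x' \<noteq> lb y'" "{lb x', lb y'} = X" "g x' a' = g y' b'"
    and l: "on_leg e s x a" "on_leg f t y b" "on_leg e' s' x' a'" "on_leg f' t' y' b'"
    using assms(1,2) unfolding meets_def by blast+
  have "lb y' \<in> {lb x, lb y}" unfolding m(2) m(5)[symmetric] by simp
  then have lb: "lb y' = lb y" using m(4) assms(3) by auto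
  have Sl: "x \<in> Sl" "y \<in> Sl" "x' \<in> Sl" "y' \<in> Sl" using l by (simp_all add: on_leg_def)
  have ab: "0 \<le> a" "a \<le> 1/2" "0 \<le> b" "b \<le> 1/2" "0 \<le> a'" "a' \<le> 1/2" "0 \<le> b'" "b' \<le> 1/2"
    using l by (simp_all add: on_leg_def)
  have gx: "g x a = g x' a'"
    by (rule cross_unique[OF Sl assms(3) lb m(1,2) ab m(3,6)])
  obtain i where i: "i < N e" "x = sq e i" "real i \<le> real (N e) * s" "real (N e) * s \<le> real i + 1" "a = loc i (real (N e) * s)"
    using l(1) unfolding on_leg_def by blast
  obtain j where j: "j < N e'" "x' = sq e' j" "real j \<le> real (N e') * s'" "real (N e') * s' \<le> real j + 1" "a' = loc j (real (N e') * s')"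
    using l(3) unfolding on_leg_def by blast
  have E: "e \<in> E" "e' \<in> E" "0 < s" "s < 1" "0 < s'" "s' < 1" using l(1,3) by (simp_all add: on_leg_def)
  have "gam e s = gam e' s'"
    using gam_eq[OF E(1) i(1,3,4)] gam_eq[OF E(2) j(1,3,4)] gx i j by (simp add: h_def)
  from gam_inj[OF E(1) i(1,3,4) E(3,4,2) j(1,3,4) E(5,6) this] show ?thesis
    using assms(3) unfolding i(2) j(2) by (auto simp: Let_def)
qed

lemma card_crossings: "finite (crossings E gam) \<and> card (crossings E gam) \<le> 1"
proof -
  have uniq: "c = c'" if "c \<in> crossings E gam" "c' \<in> crossings E gam" for c c'
  proof -
    from that(1) obtain e f s t where c: "c = {GE e s, GE f t}" "e \<in> E" "f \<in> E" "0 < s" "s < 1" "0 < t" "t < 1"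
      "GE e s \<noteq> GE f t" "gam e s = gam f t" unfolding crossings_def by blast
    from that(2) obtain e' f' s' t' where c': "c' = {GE e' s', GE f' t'}" "e' \<in> E" "f' \<in> E" "0 < s'" "s' < 1" "0 < t'" "t' < 1"
      "GE e' s' \<noteq> GE f' t'" "gam e' s' = gam f' t'" unfolding crossings_def by blast
    obtain x a y b where m: "meets e s f t x a y b" using crossing_meets[OF c(2-)] .
    obtain x' a' y' b' where m': "meets e' s' f' t' x' a' y' b'" using crossing_meets[OF c'(2-)] .
    have "{lb x, lb y} = {lb x', lb y'}" using m m' by (simp add: meets_def)
    then consider "lb x' = lb x" "lb y' = lb y" | "lb y' = lb x" "lb x' = lb y" by (auto simp: doubleton_eq_iff)
    then show ?thesis
    proof cases
      case 1
      then show ?thesis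
        using meets_same[OF m m'] meets_same[OF meets_commute[OF m] meets_commute[OF m']] c(1) c'(1) by simp
    next
      case 2
      then show ?thesis
        using meets_same[OF m meets_commute[OF m']] meets_same[OF meets_commute[OF m] m'] c(1) c'(1) by auto
    qed
  qed
  show ?thesis
  proof (cases "crossings E gam = {}")
    case False
    then obtain c where "c \<in> crossings E gam" by blast
    then have "crossings E gam = {c}" using uniq by blast
    then show ?thesis by simp
  qed simp
qed

text \<open>More than local injectivity holds: by \<open>X_edge\<close> an edge carries at most one
  of the two exempt labels, so it never crosses itself. This is where exchanging only ends of
  different edges pays off.\<close>

lemma gam_locally_inj_edge:
  assumes "e \<in> E" "0 < s" "s < 1" "0 < t" "t < 1" "gam e s = gam e t" shows "s = t"
proof (rule ccontr)
  assume "s \<noteq> t"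
  then obtain x a y b where m: "meets e s e t x a y b"
    using crossing_meets[OF assms(1,1-5)] assms(6) by blast
  then obtain i j where "i < N e" "x = sq e i" "j < N e" "y = sq e j" "lb x \<in> X" "lb y \<in> X" "lb x \<noteq> lb y"
    unfolding meets_def on_leg_def by blast
  then show False using X_edge[OF assms(1)] by blast
qed

text \<open>Close to v both points lie in slots labelled by v, and equal labels rule out the
  crossing case of \<open>gam_inj\<close>.\<close>

lemma gam_near_vertex:
  assumes e: "e \<in> E" "0 < s" "s < 1" and f: "f \<in> E" "0 < t" "t < 1" and eq: "gam e s = gam f t"
    and end_e: "fst e = v \<and> real (N e) * s \<le> 1 \<or> snd e = v \<and> real (N e) * (1 - s) \<le> 1"
    and end_f: "fst f = v \<and> real (N f) * t \<le> 1 \<or> snd f = v \<and> real (N f) * (1 - t) \<le> 1"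
  shows "GE e s = GE f t"
proof -
  have leg: "\<exists>i<N e. real i \<le> real (N e) * s \<and> real (N e) * s \<le> real i + 1 \<and> lb (sq e i) = Inl v"
    if e: "e \<in> E" "0 < s" "s < 1" and "fst e = v \<and> real (N e) * s \<le> 1 \<or> snd e = v \<and> real (N e) * (1 - s) \<le> 1" for e s
  proof -
    have n: "0 < real (N e)" "2 \<le> N e" using N(2)[OF e(1)] by auto
    show ?thesis using that(4)
    proof
      assume *: "fst e = v \<and> real (N e) * s \<le> 1"
      have "lb (sq e 0) = Inl v" using lb_first[OF e(1)] * by simp
      then show ?thesis using * n e by (intro exI[of _ 0]) auto
    next
      assume *: "snd e = v \<and> real (N e) * (1 - s) \<le> 1"
      have "lb (sq e (N e - 1)) = Inl v" using lb_last[OF e(1)] * by simp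
      moreover have "real (N e - 1) = real (N e) - 1" using n by (simp add: of_nat_diff)
      moreover have "real (N e) * s \<le> real (N e)" using n e by simp
      ultimately show ?thesis using * n by (intro exI[of _ "N e - 1"]) (auto simp: right_diff_distrib)
    qed
  qed
  obtain i where i: "i < N e" "real i \<le> real (N e) * s" "real (N e) * s \<le> real i + 1" "lb (sq e i) = Inl v"
    using leg[OF e end_e] by blast
  obtain j where j: "j < N f" "real j \<le> real (N f) * t" "real (N f) * t \<le> real j + 1" "lb (sq f j) = Inl v"
    using leg[OF f end_f] by blast
  from gam_inj[OF e(1) i(1-3) e(2,3) f(1) j(1-3) f(2,3) eq] show ?thesis
    using i(4) j(4) by (auto simp: Let_def)
qed

lemma gnbhd_GV:
  assumes "z \<in> gnbhd E (GV v) d"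
  obtains "z = GV v" | e t where "z = GE e t" "e \<in> E" "0 < t" "t < 1" "fst e = v \<and> t < d \<or> snd e = v \<and> 1 - d < t"
  using assms by auto

theorem drawing_gam:
  assumes VE: "\<And>e. e \<in> E \<Longrightarrow> fst e \<in> V \<and> snd e \<in> V"
  shows "drawing (Nsurf k) V E vpt gam"
  unfolding drawing_def
proof (intro conjI ballI allI impI)
  show "vpt ` V \<subseteq> topspace (Nsurf k)"
  proof
    fix z assume "z \<in> vpt ` V"
    then obtain v where v: "v \<in> V" "z = vpt v" by blast
    obtain x where "x \<in> Sl" "lb x = Inl v" using V[OF v(1)] by blast
    then show "z \<in> topspace (Nsurf k)" using h_topspace[of x 0] v by (simp add: h0 vpt_def)
  qed
  show "inj_on vpt V" by (rule vpt_inj)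
  show "continuous_map (top_of_set {0..1}) (Nsurf k) (gam e)" if "e \<in> E" for e by (rule continuous_gam[OF that])
  show "gam e 0 = vpt (fst e)" if "e \<in> E" for e by (rule gam_0[OF that])
  show "gam e 1 = vpt (snd e)" if "e \<in> E" for e by (rule gam_1[OF that])
  show "gam e t \<notin> vpt ` V" if "e \<in> E" "0 < t \<and> t < 1" for e t using gam_not_vertex that by blast
  show "finite (crossings E gam)" using card_crossings by blast
  fix z assume "z \<in> gpoints V E"
  then consider v where "z = GV v" "v \<in> V" | e t where "z = GE e t" "e \<in> E" "0 < t" "t < 1"
    by (auto simp: gpoints_def)
  then show "\<exists>d>0. inj_on (realize vpt gam) (gnbhd E z d)"
  proof cases
    case 2
    have "inj_on (realize vpt gam) (gnbhd E (GE e t) 1)"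
      using gam_locally_inj_edge[OF 2(2)] by (auto intro!: inj_onI)
    then show ?thesis using 2(1) by (intro exI[of _ 1]) auto
  next
    case 1
    \<comment> \<open>The radius d is small enough for all edges together: at distance less than d
      from an end, an edge is still in its first or last slot.\<close>
    define S where "S = real (\<Sum>e\<in>E. N e)"
    have S: "0 \<le> S" unfolding S_def by (rule of_nat_0_le_iff)
    define d where "d = 1 / (1 + S)"
    have d: "0 < d" unfolding d_def using S by simp
    have dN: "real (N e) * t \<le> 1" if "e \<in> E" "0 < t" "t < d" for e t
    proof -
      have "N e \<le> (\<Sum>e\<in>E. N e)" using finE that(1) by (simp add: member_le_sum)
      then have "real (N e) \<le> 1 + S" unfolding S_def by (simp only: of_nat_le_iff flip: of_nat_Suc)
      then have "real (N e) * t \<le> (1 + S) * d" using that S by (intro mult_mono) auto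
      also have "\<dots> = 1" unfolding d_def using S by simp
      finally show ?thesis .
    qed
    have dE: "fst e = v \<and> real (N e) * t \<le> 1 \<or> snd e = v \<and> real (N e) * (1 - t) \<le> 1"
      if "e \<in> E" "0 < t" "t < 1" "fst e = v \<and> t < d \<or> snd e = v \<and> 1 - d < t" for e t
      using that dN[OF that(1), of t] dN[OF that(1), of "1 - t"] by auto
    have "inj_on (realize vpt gam) (gnbhd E (GV v) d)"
    proof (rule inj_onI)
      fix p q assume pq: "p \<in> gnbhd E (GV v) d" "q \<in> gnbhd E (GV v) d" "realize vpt gam p = realize vpt gam q"
      from pq(1) show "p = q"
      proof (cases rule: gnbhd_GV)
        case p: 1
        from pq(2) show ?thesis
        proof (cases rule: gnbhd_GV)
          case 1 then show ?thesis using p by simp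
        next
          case (2 f t)
          then show ?thesis using gam_not_vertex[OF 2(2-4) \<open>v \<in> V\<close>] pq(3) p by simp
        qed
      next
        case p: (2 e s)
        from pq(2) show ?thesis
        proof (cases rule: gnbhd_GV)
          case 1 then show ?thesis using gam_not_vertex[OF p(2-4) \<open>v \<in> V\<close>] pq(3) p(1) by simp
        next
          case (2 f t)
          have "gam e s = gam f t" using pq(3) p(1) 2(1) by simp
          from gam_near_vertex[OF p(2-4) 2(2-4) this dE[OF p(2-5)] dE[OF 2(2-5)]]
          show ?thesis using p(1) 2(1) by simp
        qed
      qed
    qed
    then show ?thesis using 1(1) d by blast
  qed
qed

end

section \<open>Realising a won game\<close>

abbreviation incr :: "('s \<Rightarrow> real) \<Rightarrow> 's list \<Rightarrow> bool" where
  "incr \<theta> \<equiv> sorted_wrt (\<lambda>x y. \<theta> x < \<theta> y)"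

section \<open>Choice of the angles\<close>

lemma incr_exists:
  fixes a b :: real
  assumes "distinct L" "a < b"
  shows "\<exists>\<theta>. incr \<theta> L \<and> (\<forall>x\<in>set L. a < \<theta> x \<and> \<theta> x < b)"
  using assms
proof (induction L arbitrary: a)
  case (Cons x L)
  have ab: "a < (a + b) / 2" "(a + b) / 2 < b" using Cons.prems by auto
  obtain \<theta> where \<theta>: "incr \<theta> L" "\<forall>x\<in>set L. (a + b) / 2 < \<theta> x \<and> \<theta> x < b"
    using Cons.IH[OF _ ab(2)] Cons.prems by auto
  define \<theta>' where "\<theta>' = \<theta>(x := (a + b) / 2)"
  have eq: "\<theta>' y = \<theta> y" if "y \<in> set L" for y using that Cons.prems by (auto simp: \<theta>'_def)
  have "incr \<theta>' L" using \<theta>(1) by (rule sorted_wrt_mono_rel[rotated]) (simp add: eq)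
  moreover have "\<forall>y\<in>set L. \<theta>' x < \<theta>' y" using \<theta>(2) eq by (simp add: \<theta>'_def)
  moreover have "a < \<theta>' x" "\<theta>' x < b" using ab by (auto simp: \<theta>'_def)
  moreover have "\<forall>y\<in>set L. a < \<theta>' y \<and> \<theta>' y < b" using \<theta>(2) eq ab by fastforce
  ultimately show ?case by (intro exI[of _ \<theta>']) auto
qed simp

lemma capx_sorted: "capx C H T \<Longrightarrow> sorted_wrt P H \<Longrightarrow> sorted_wrt P T"
proof (induction rule: capx.induct)
  case (Thr H T z)
  then show ?case using capx_set[OF Thr(1)] by auto
qed (auto simp: sorted_wrt_append)

text \<open>Turns an alternation of angles into a subsequence of the word, to which
  \<open>nc\<close> applies.\<close>

lemma incr_subseq:
  assumes "incr \<theta> W" "incr \<theta> xs" "set xs \<subseteq> set W"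
  shows "subseq xs W"
  using assms
proof (induction W arbitrary: xs)
  case (Cons w W)
  show ?case
  proof (cases xs)
    case Nil then show ?thesis by simp
  next
    case (Cons x ys)
    show ?thesis
    proof (cases "x = w")
      case True
      have "set ys \<subseteq> set W"
      proof
        fix z assume "z \<in> set ys"
        then have "\<theta> w < \<theta> z" "z \<in> set (w # W)" using Cons.prems Cons True by auto
        then show "z \<in> set W" by auto
      qed
      then show ?thesis using Cons.IH[of ys] Cons.prems Cons True by auto
    next
      case False
      have "x \<in> set W" using Cons.prems Cons False by auto
      then have "\<theta> w < \<theta> x" using Cons.prems by auto
      moreover have "\<theta> x \<le> \<theta> z" if "z \<in> set xs" for z using that Cons.prems Cons by auto
      ultimately have "w \<notin> set xs" by force
      then have "subseq xs W" using Cons.IH[of xs] Cons.prems by auto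
      then show ?thesis by auto
    qed
  qed
qed simp

lemma wd_Cons: "wd ((H, T) # D) M = H @ map suc T @ wd D M"
  by (simp add: wd_def)

text \<open>Each crosscap owns a sector of angle 2 pi / K = 4 q: \<open>H\<close> lies in its first
  quarter, and the rotation by pi / K takes \<open>T\<close> to the third one. \<open>M\<close> gets
  the last interval of length q before 2 pi; this may begin before 2 pi t0 / K, hence the minimum.
  \<open>K\<close> stands in for k, which may be 0.\<close>

lemma angles:
  fixes K :: real
  assumes "\<And>H T. (H, T) \<in> set D \<Longrightarrow> capx C H T" "distinct (wd D M)" "t0 + length D \<le> k" "0 < K" "real k \<le> K"
  shows "\<exists>\<theta>. incr \<theta> (wd D M) \<and>
     (\<forall>x\<in>set (wd D M). min (2 * pi * real t0 / K) (2 * pi - pi / (2 * K)) < \<theta> x \<and> \<theta> x < 2 * pi) \<and>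
     (\<forall>H T. (H, T) \<in> set D \<longrightarrow> (\<forall>x\<in>set T. \<exists>i<k. 2 * pi * real i / K < \<theta> x \<and>
        \<theta> x < 2 * pi * real i / K + pi / K \<and> \<theta> (suc x) = \<theta> x + pi / K))"
  using assms(1-3)
proof (induction D arbitrary: t0)
  case Nil
  have "2 * pi - pi / (2 * K) < 2 * pi" using assms(4) by simp
  moreover have "distinct M" using Nil by (simp add: wd_def)
  ultimately obtain \<theta> where "incr \<theta> M" "\<forall>x\<in>set M. 2 * pi - pi / (2 * K) < \<theta> x \<and> \<theta> x < 2 * pi"
    using incr_exists by blast
  then show ?case by (intro exI[of _ \<theta>]) (auto simp: wd_def)
next
  case (Cons HT D)
  obtain H T where HT: "HT = (H, T)" by (cases HT)
  define a where "a = 2 * pi * real t0 / K"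
  define q where "q = pi / (2 * K)"
  have q: "0 < q" "pi / K = 2 * q" using assms(4) by (simp_all add: q_def)
  have cap: "capx C H T" using Cons.prems(1) HT by auto
  have dis: "distinct H" "distinct (map suc T)" "distinct (wd D M)" "set H \<inter> set (map suc T) = {}"
     "set H \<inter> set (wd D M) = {}" "set (map suc T) \<inter> set (wd D M) = {}"
    using Cons.prems(2) unfolding HT wd_Cons by auto
  obtain \<theta>1 where \<theta>1: "incr \<theta>1 H" "\<forall>x\<in>set H. a < \<theta>1 x \<and> \<theta>1 x < a + q"
    using incr_exists[OF dis(1), of a "a + q"] q by auto
  obtain \<theta>2 where \<theta>2: "incr \<theta>2 (wd D M)"
     "\<forall>x\<in>set (wd D M). min (2 * pi * real (Suc t0) / K) (2 * pi - pi / (2 * K)) < \<theta>2 x \<and> \<theta>2 x < 2 * pi"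
     "\<forall>H T. (H, T) \<in> set D \<longrightarrow> (\<forall>x\<in>set T. \<exists>i<k. 2 * pi * real i / K < \<theta>2 x \<and>
        \<theta>2 x < 2 * pi * real i / K + pi / K \<and> \<theta>2 (suc x) = \<theta>2 x + pi / K)"
    using Cons.IH[of "Suc t0"] Cons.prems dis(3) by auto
  define \<theta> where "\<theta> = (\<lambda>x. if x \<in> set H then \<theta>1 x else if x \<in> set (map suc T) then
      \<theta>1 (fst x, snd x - 1) + pi / K else \<theta>2 x)"
  have eH: "\<theta> x = \<theta>1 x" if "x \<in> set H" for x using that by (simp add: \<theta>_def)
  have eT: "\<theta> (suc x) = \<theta>1 x + pi / K" if "x \<in> set T" for x
  proof -
    have "suc x \<in> set (map suc T)" using that by auto
    then have "suc x \<notin> set H" using dis(4) by blast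
    then show ?thesis using \<open>suc x \<in> set (map suc T)\<close> by (simp add: \<theta>_def)
  qed
  have e2: "\<theta> x = \<theta>2 x" if "x \<in> set (wd D M)" for x
  proof -
    have "x \<notin> set H" "x \<notin> set (map suc T)" using that dis(5,6) by blast+
    then show ?thesis unfolding \<theta>_def by (simp only: if_False)
  qed
  have TH: "set T \<subseteq> set H" using capx_set[OF cap] .
  have t0: "real t0 + 1 \<le> K" using Cons.prems(3) assms(5) by simp
  have step: "2 * pi * real (Suc t0) / K = a + 4 * q"
    using assms(4) by (simp add: a_def q_def field_simps)
  have up: "a + 4 * q \<le> 2 * pi"
  proof -
    have "2 * pi * real (Suc t0) \<le> 2 * pi * K" using t0 by (intro mult_left_mono) auto
    then have "2 * pi * real (Suc t0) / K \<le> 2 * pi" using assms(4) by (simp add: pos_divide_le_eq)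
    then show ?thesis using step by simp
  qed
  have r2: "a + 3 * q < \<theta>2 x" "\<theta>2 x < 2 * pi" if "x \<in> set (wd D M)" for x
    using \<theta>2(2) that up q unfolding step q_def[symmetric] by fastforce+
  have rT: "a + 2 * q < \<theta>1 x + pi / K" "\<theta>1 x + pi / K < a + 3 * q" if "x \<in> set T" for x
    using \<theta>1(2) TH that q by fastforce+
  have "incr \<theta> H" using \<theta>1(1) by (rule sorted_wrt_mono_rel[rotated]) (simp add: eH)
  moreover have "incr \<theta> (map suc T)"
  proof -
    have "incr \<theta>1 T" using capx_sorted[OF cap \<theta>1(1)] .
    then show ?thesis unfolding sorted_wrt_map by (rule sorted_wrt_mono_rel[rotated]) (simp add: eT)
  qed
  moreover have "incr \<theta> (wd D M)" using \<theta>2(1) by (rule sorted_wrt_mono_rel[rotated]) (simp add: e2)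
  moreover have "\<theta> x < \<theta> z" if "x \<in> set H" "z \<in> set (wd D M)" for x z
    using \<theta>1(2) r2[OF that(2)] that e2[OF that(2)] eH[OF that(1)] q by fastforce
  moreover have "\<theta> (suc x) < \<theta> z" if "x \<in> set T" "z \<in> set (wd D M)" for x z
    using rT[OF that(1)] r2[OF that(2)] e2[OF that(2)] eT[OF that(1)] q by linarith
  moreover have "\<theta> x < \<theta> (suc y)" if "x \<in> set H" "y \<in> set T" for x y
    using \<theta>1(2) rT[OF that(2)] that eT[OF that(2)] eH[OF that(1)] q by fastforce
  ultimately have inc: "incr \<theta> (wd (HT # D) M)"
    unfolding HT wd_Cons by (auto simp: sorted_wrt_append)
  have "min (2 * pi * real t0 / K) (2 * pi - pi / (2 * K)) < \<theta> x \<and> \<theta> x < 2 * pi" if "x \<in> set (wd (HT # D) M)" for x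
  proof -
    consider "x \<in> set H" | y where "x = suc y" "y \<in> set T" | "x \<in> set (wd D M)"
      using \<open>x \<in> set (wd (HT # D) M)\<close> unfolding HT wd_Cons by auto
    then have "a < \<theta> x \<and> \<theta> x < 2 * pi"
    proof cases
      case 1 then show ?thesis using \<theta>1(2) eH[OF 1] up q by fastforce
    next
      case 2 then show ?thesis using rT[OF 2(2)] eT[OF 2(2)] up q by auto
    next
      case 3 then show ?thesis using r2[OF 3] e2[OF 3] q by auto
    qed
    then show ?thesis unfolding a_def by auto
  qed
  moreover have "\<exists>i<k. 2 * pi * real i / K < \<theta> x \<and> \<theta> x < 2 * pi * real i / K + pi / K \<and> \<theta> (suc x) = \<theta> x + pi / K"
    if "(H', T') \<in> set (HT # D)" "x \<in> set T'" for H' T' x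
  proof (cases "(H', T') = HT")
    case True
    then have x: "x \<in> set T" "x \<in> set H" using that(2) HT TH by auto
    show ?thesis
      by (intro exI[of _ t0]) (use x \<theta>1(2) eH[OF x(2)] eT[OF x(1)] q Cons.prems(3) in \<open>auto simp: a_def\<close>)
  next
    case False
    then have D: "(H', T') \<in> set D" using that(1) by simp
    have "x \<in> set H'" using capx_set Cons.prems(1)[of H' T'] D that(2) by fastforce
    then have "x \<in> set (wd D M)" "suc x \<in> set (wd D M)" using D that(2) by (fastforce simp: wd_def)+
    then show ?thesis using \<theta>2(3) D that(2) unfolding e2[OF \<open>x \<in> set (wd D M)\<close>] e2[OF \<open>suc x \<in> set (wd D M)\<close>] by blast
  qed
  ultimately show ?case using inc by (intro exI[of _ \<theta>]) blast
qed

definition btw :: "('s \<Rightarrow> real) \<Rightarrow> 's \<Rightarrow> 's \<Rightarrow> 's \<Rightarrow> bool" where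
  "btw \<theta> u v z \<longleftrightarrow> min (\<theta> u) (\<theta> v) < \<theta> z \<and> \<theta> z < max (\<theta> u) (\<theta> v)"

text \<open>The word under a cap consists of complete caps only, so links do not leave it and no
  through letter lies in it. \<open>btw\<close> works with minimum and maximum because x may be
  either end of its cap.\<close>

lemma capx_nest:
  assumes "capx C H T" "incr \<theta> H" "\<And>x y. (x, y) \<in> C \<Longrightarrow> lk x = y \<and> lk y = x" "x \<in> set H" "x \<notin> set T"
  shows "lk x \<in> set H \<and> lk x \<notin> set T \<and> ((x, lk x) \<in> C \<or> (lk x, x) \<in> C) \<and>
    (\<forall>z\<in>set H. btw \<theta> x (lk x) z \<longrightarrow> z \<notin> set T \<and> btw \<theta> x (lk x) (lk z))"
  using assms(1,2,4,5)
proof (induction arbitrary: x rule: capx.induct)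
  case Nil
  then show ?case by simp
next
  case (Thr H T z0)
  have x: "x \<in> set H" "x \<notin> set T" "incr \<theta> H" using Thr.prems by auto
  have IH: "lk x \<in> set H" "lk x \<notin> set T" "(x, lk x) \<in> C \<or> (lk x, x) \<in> C"
    "\<And>z. z \<in> set H \<Longrightarrow> btw \<theta> x (lk x) z \<Longrightarrow> z \<notin> set T \<and> btw \<theta> x (lk x) (lk z)"
    using Thr.IH[OF x(3,1,2)] by blast+
  have lt: "\<theta> z0 < \<theta> y" if "y \<in> set H" for y using that Thr.prems(1) by simp
  have ne: "lk x \<noteq> z0" using lt[OF IH(1)] by auto
  have z: "z \<noteq> z0" if "btw \<theta> x (lk x) z" for z
    using that lt[OF x(1)] lt[OF IH(1)] by (auto simp: btw_def)
  show ?case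
  proof (intro conjI ballI impI)
    fix w assume w: "w \<in> set (z0 # H)" "btw \<theta> x (lk x) w"
    then have "w \<in> set H" "w \<noteq> z0" using z[OF w(2)] by auto
    then show "w \<notin> set (z0 # T)" "btw \<theta> x (lk x) (lk w)" using IH(4)[OF _ w(2)] by auto
  qed (use IH ne in auto)
next
  case (Cap b H T x0 y0)
  have lk0: "lk x0 = y0" "lk y0 = x0" using assms(3)[OF Cap(3)] by auto
  have s: "incr \<theta> b" "incr \<theta> H" "\<theta> x0 < \<theta> y0" using Cap.prems(1) by (auto simp: sorted_wrt_append)
  have lb: "\<theta> x0 < \<theta> z" "\<theta> z < \<theta> y0" if "z \<in> set b" for z using that Cap.prems(1) by (auto simp: sorted_wrt_append)
  have lH: "\<theta> y0 < \<theta> z" if "z \<in> set H" for z using that Cap.prems(1) by (auto simp: sorted_wrt_append)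
  have TH: "set T \<subseteq> set H" using capx_set[OF Cap(2)] .
  have nT: "z \<notin> set T" if "z \<in> insert x0 (insert y0 (set b))" for z
  proof
    assume "z \<in> set T"
    then have "\<theta> y0 < \<theta> z" using lH TH by blast
    then show False using that lb(2)[of z] s(3) by auto
  qed
  have in_b: "z \<in> set b" if "z \<in> set (x0 # b @ y0 # H)" "\<theta> x0 < \<theta> z" "\<theta> z < \<theta> y0" for z
    using that lH[of z] by auto
  have IHb: "lk z \<in> set b" "(z, lk z) \<in> C \<or> (lk z, z) \<in> C"
    "\<And>w. w \<in> set b \<Longrightarrow> btw \<theta> z (lk z) w \<Longrightarrow> btw \<theta> z (lk z) (lk w)" if "z \<in> set b" for z
    using Cap.IH(1)[OF s(1) that] by auto
  consider "x = x0 \<or> x = y0" | "x \<in> set b" | "x \<in> set H" using Cap.prems(2) by auto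
  then show ?case
  proof cases
    case 1
    then have mm: "btw \<theta> x (lk x) z \<longleftrightarrow> \<theta> x0 < \<theta> z \<and> \<theta> z < \<theta> y0" for z using lk0 s(3) by (auto simp: btw_def)
    have 2: "lk x \<in> {x0, y0}" "(x, lk x) \<in> C \<or> (lk x, x) \<in> C" using 1 lk0 Cap(3) by auto
    show ?thesis
    proof (intro conjI ballI impI)
      fix w assume w: "w \<in> set (x0 # b @ y0 # H)" "btw \<theta> x (lk x) w"
      then have wb: "w \<in> set b" using in_b mm by blast
      show "w \<notin> set T" using nT wb by blast
      show "btw \<theta> x (lk x) (lk w)" unfolding mm using lb[OF IHb(1)[OF wb]] by blast
    next
      show "lk x \<notin> set T" using nT[of "lk x"] 2(1) by blast
    qed (use 2 in auto)
  next
    case 2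
    have l: "lk x \<in> set b" using IHb(1)[OF 2] .
    have in_b': "z \<in> set b" if "z \<in> set (x0 # b @ y0 # H)" "btw \<theta> x (lk x) z" for z
      using in_b[OF that(1)] that(2) lb[OF 2] lb[OF l] by (auto simp: btw_def)
    show ?thesis
    proof (intro conjI ballI impI)
      fix w assume w: "w \<in> set (x0 # b @ y0 # H)" "btw \<theta> x (lk x) w"
      have wb: "w \<in> set b" using in_b'[OF w] .
      show "w \<notin> set T" using nT wb by blast
      show "btw \<theta> x (lk x) (lk w)" using IHb(3)[OF 2 wb w(2)] .
    next
      show "lk x \<notin> set T" using nT l by blast
    qed (use l IHb(2)[OF 2] in auto)
  next
    case 3
    have IH: "lk x \<in> set H" "lk x \<notin> set T" "(x, lk x) \<in> C \<or> (lk x, x) \<in> C"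
      "\<And>z. z \<in> set H \<Longrightarrow> btw \<theta> x (lk x) z \<Longrightarrow> z \<notin> set T \<and> btw \<theta> x (lk x) (lk z)"
      using Cap.IH(2)[OF s(2) 3 Cap.prems(3)] by blast+
    have inH: "z \<in> set H" if "z \<in> set (x0 # b @ y0 # H)" "btw \<theta> x (lk x) z" for z
    proof -
      have "\<theta> y0 < \<theta> z" using lH[OF 3] lH[OF IH(1)] that(2) by (auto simp: btw_def)
      then show ?thesis using that(1) lb(2)[of z] s(3) by auto
    qed
    show ?thesis
    proof (intro conjI ballI impI)
      fix w assume w: "w \<in> set (x0 # b @ y0 # H)" "btw \<theta> x (lk x) w"
      show "w \<notin> set T" "btw \<theta> x (lk x) (lk w)" using IH(4)[OF inH[OF w] w(2)] by auto
    qed (use IH in auto)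
  qed
qed

section \<open>Links and the order of the points along an edge\<close>

lemma nat_parity_cases:
  fixes j :: nat
  obtains "j = 0" | a where "j = Suc (2 * a)" | a where "j = Suc (Suc (2 * a))"
proof -
  have "j = 0 \<or> j = Suc (2 * (j div 2)) \<or> j = Suc (Suc (2 * (j div 2 - 1)))" by presburger
  then show ?thesis using that by blast
qed

text \<open>The link of a point across the outside of the circle.\<close>

definition lks :: "('v strand \<Rightarrow> nat) \<Rightarrow> 'v slot \<Rightarrow> 'v slot" where
  "lks l x = (if snd x = 2 * l (fst x) then (opp (fst x), 2 * l (opp (fst x)))
     else if even (snd x) then (fst x, Suc (snd x)) else (fst x, snd x - 1))"

lemma lks_lks:
  assumes "snd x \<le> 2 * l (fst x)"
  shows "lks l (lks l x) = x" "lks l x \<noteq> x" "snd (lks l x) \<le> 2 * l (fst (lks l x))" "fst (fst (lks l x)) = fst (fst x)"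
proof -
  obtain s i where x: "x = (s, i)" by (cases x)
  consider "i = 2 * l s" | "even i" "i < 2 * l s" | "odd i" "i < 2 * l s"
    using assms x by fastforce
  then have "lks l (lks l x) = x \<and> lks l x \<noteq> x \<and> snd (lks l x) \<le> 2 * l (fst (lks l x)) \<and> fst (fst (lks l x)) = fst (fst x)"
  proof cases
    case 1 then show ?thesis by (simp add: lks_def x)
  next
    case 2
    then have "Suc i \<noteq> 2 * l s" by presburger
    then show ?thesis using 2 by (simp add: lks_def x)
  next
    case 3
    then obtain j where "i = Suc (2 * j)" by (auto elim: oddE)
    then show ?thesis using 3 by (simp add: lks_def x)
  qed
  then show "lks l (lks l x) = x" "lks l x \<noteq> x" "snd (lks l x) \<le> 2 * l (fst (lks l x))" "fst (fst (lks l x)) = fst (fst x)"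
    by blast+
qed

lemma capok_lks:
  assumes "capok l {} (x, y)"
  shows "lks l x = y \<and> lks l y = x"
proof -
  obtain s i s' j where xy: "x = (s, i)" "y = (s', j)" by (metis surj_pair)
  from assms consider "s' = s" "even (min i j)" "j = Suc i \<or> i = Suc j" "max i j \<le> 2 * l s"
    | "s' = opp s" "i = 2 * l s" "j = 2 * l s'"
    unfolding capok_def xy by auto
  then show ?thesis
  proof cases
    case 1
    from 1(3) show ?thesis
    proof
      assume j: "j = Suc i"
      then have "even i" "i < 2 * l s" "Suc i \<noteq> 2 * l s" using 1 by (auto, presburger)
      then show ?thesis by (simp add: lks_def xy 1(1) j)
    next
      assume j: "i = Suc j"
      then have "even j" "j < 2 * l s" "Suc j \<noteq> 2 * l s" using 1 by (auto, presburger)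
      then show ?thesis by (simp add: lks_def xy 1(1) j)
    qed
  next
    case 2
    then show ?thesis by (simp add: lks_def xy)
  qed
qed

lemma set_wd: "set (wd D M) = (\<Union>HT\<in>set D. set (fst HT) \<union> suc ` set (snd HT)) \<union> set M"
  by (auto simp: wd_def case_prod_unfold)

text \<open>The points of an edge in the order of the edge, the second strand being traversed backwards.\<close>

definition sqs :: "('v strand \<Rightarrow> nat) \<Rightarrow> 'v \<times> 'v \<Rightarrow> nat \<Rightarrow> 'v slot" where
  "sqs l e i = (if i \<le> 2 * l (e, False) then ((e, False), i)
     else ((e, True), 2 * l (e, False) + 2 * l (e, True) + 1 - i))"

definition Ns :: "('v strand \<Rightarrow> nat) \<Rightarrow> 'v \<times> 'v \<Rightarrow> nat" where
  "Ns l e = 2 * l (e, False) + 2 * l (e, True) + 2"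

lemma sqs_edge[simp]: "fst (fst (sqs l e i)) = e"
  by (simp add: sqs_def)

lemma sqs_cases:
  assumes "i < Ns l e"
  obtains "i \<le> 2 * l (e, False)" "sqs l e i = ((e, False), i)"
  | j where "i = 2 * l (e, False) + 1 + j" "j \<le> 2 * l (e, True)" "sqs l e i = ((e, True), 2 * l (e, True) - j)"
proof (cases "i \<le> 2 * l (e, False)")
  case True
  then show ?thesis using that(1) by (simp add: sqs_def)
next
  case False
  then show ?thesis using that(2)[of "i - (2 * l (e, False) + 1)"] assms by (simp add: sqs_def Ns_def)
qed

lemma sqs_top: "snd (sqs l e i) \<le> 2 * l (fst (sqs l e i))" if "i < Ns l e"
  using that by (cases rule: sqs_cases) auto

lemma sqs_lk:
  assumes "i < Ns l e" shows "lks l (sqs l e i) = sqs l e (if even i then Suc i else i - 1)"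
  using assms
proof (cases rule: sqs_cases)
  case 1
  consider "i = 2 * l (e, False)" | "even i" "i < 2 * l (e, False)" | j where "i = Suc (2 * j)" "i < 2 * l (e, False)"
  proof (cases "even i")
    case True
    then show ?thesis using 1(1) that(1,2) by (cases "i = 2 * l (e, False)") auto
  next
    case False
    then obtain j where j: "i = Suc (2 * j)" by (auto elim: oddE)
    then have "i \<noteq> 2 * l (e, False)" by presburger
    then show ?thesis using 1(1) that(3)[OF j] by simp
  qed
  then show ?thesis
  proof cases
    case a: 1 then show ?thesis unfolding 1(2) by (simp add: lks_def sqs_def opp_def)
  next
    case a: 2 then show ?thesis unfolding 1(2) by (simp add: lks_def sqs_def)
  next
    case a: 3 then show ?thesis unfolding 1(2) by (simp add: lks_def sqs_def)
  qed
next
  case (2 j)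
  consider "j = 0" | a where "j = Suc (2 * a)" | a where "j = Suc (Suc (2 * a))"
    by (rule nat_parity_cases)
  then show ?thesis
  proof cases
    case 1 then show ?thesis unfolding 2(3) using 2(1) by (simp add: lks_def sqs_def opp_def)
  next
    case (2 a)
    then show ?thesis using \<open>sqs l e i = _\<close> \<open>i = _\<close> \<open>j \<le> _\<close> by (auto simp: lks_def sqs_def)
  next
    case (3 a)
    then show ?thesis using \<open>sqs l e i = _\<close> \<open>i = _\<close> \<open>j \<le> _\<close> by (auto simp: lks_def sqs_def)
  qed
qed

lemma sqs_inj:
  assumes "i < Ns l e" "j < Ns l f" "sqs l e i = sqs l f j" shows "e = f \<and> i = j"
proof -
  have e: "e = f" using arg_cong[OF assms(3), of "\<lambda>x. fst (fst x)"] by simp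
  show ?thesis
    using assms(1)
  proof (cases rule: sqs_cases)
    case i: 1
    show ?thesis using assms(2) by (cases rule: sqs_cases) (use i assms(3) e in auto)
  next
    case i: (2 a)
    show ?thesis using assms(2) by (cases rule: sqs_cases) (use i assms(3) e in auto)
  qed
qed

text \<open>The two points of a chord have positions 2 r - 1 and 2 r along the edge. On the second
  strand this is still so, as 2 * l (e, False) + 1 positions precede it and it is run through
  backwards.\<close>

lemma sqs_pass:
  assumes "i < Ns l e" "j < Ns l e" "fst (sqs l e i) = fst (sqs l e j)"
    "(snd (sqs l e i) + 1) div 2 = (snd (sqs l e j) + 1) div 2"
  shows "(i + 1) div 2 = (j + 1) div 2"
  using assms(1)
proof (cases rule: sqs_cases)
  case i: 1
  show ?thesis using assms(2)
  proof (cases rule: sqs_cases)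
    case 1 then show ?thesis using i(2) assms(4) by simp
  next
    case (2 b) then show ?thesis using i(2) assms(3) by simp
  qed
next
  case i: (2 a)
  show ?thesis using assms(2)
  proof (cases rule: sqs_cases)
    case 1 then show ?thesis using i(3) assms(3) by simp
  next
    case (2 b)
    have *: "(2 * r - c + 1) div 2 = r - c div 2" if "c \<le> 2 * r" for c r :: nat
      using that by presburger
    have "l (e, True) - a div 2 = l (e, True) - b div 2"
      using assms(4) unfolding i(3) 2(3) by (simp add: *[OF i(2), simplified] *[OF 2(2), simplified])
    moreover have "a div 2 \<le> l (e, True)" "b div 2 \<le> l (e, True)" using i(2) 2(2) by linarith+
    ultimately have "a div 2 = b div 2" by linarith
    then show ?thesis unfolding i(1) 2(1) by simp
  qed
qed

text \<open>Without open ends every point has a link, so the diagram satisfies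
  \<open>graph_picture\<close>. The degree condition provides at least two points with the label of
  each vertex, which keeps the centroid inside the circle.\<close>

theorem diag_drawing:
  assumes d: "diag A k x [] D M l C X" and A: "A = {s. fst s \<in> E}" and finE: "finite E"
    and deg: "\<And>s. s \<in> A \<Longrightarrow> \<exists>s'\<in>A. s' \<noteq> s \<and> vtx s' = vtx s"
    and V: "\<And>v. v \<in> V \<Longrightarrow> \<exists>s\<in>A. vtx s = v"
    and VE: "\<And>e. e \<in> E \<Longrightarrow> fst e \<in> V \<and> snd e \<in> V"
  shows "\<exists>p \<gamma>. drawing (Nsurf k) V E p \<gamma> \<and> card (crossings E \<gamma>) \<le> 1"
proof -
  note d = diagD[OF d]
  define K where "K = (if k = 0 then 1 else real k)"
  obtain \<theta> where \<theta>: "incr \<theta> (wd D M)"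
     "\<forall>x\<in>set (wd D M). min (2 * pi * real 0 / K) (2 * pi - pi / (2 * K)) < \<theta> x \<and> \<theta> x < 2 * pi"
     "\<forall>H T. (H, T) \<in> set D \<longrightarrow> (\<forall>x\<in>set T. \<exists>i<k. 2 * pi * real i / K < \<theta> x \<and>
        \<theta> x < 2 * pi * real i / K + pi / K \<and> \<theta> (suc x) = \<theta> x + pi / K)"
  proof -
    have "0 < K" "real k \<le> K" by (auto simp: K_def)
    moreover have "0 + length D \<le> k" using d(1) by simp
    ultimately show ?thesis using angles[where D = D and M = M and C = C and ?t0.0 = 0 and k = k and K = K, OF d(5) d(2)] that by blast
  qed
  let ?Sl = "set (wd D M)" and ?lk = "lks l"
  define thr where "thr = (\<Union>(H, T)\<in>set D. set T \<union> suc ` set T)"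
  have Sl: "y \<in> ?Sl \<longleftrightarrow> fst (fst y) \<in> E \<and> snd y \<le> 2 * l (fst y)" for y
    unfolding d(3) A by (cases y) simp
  have pos: "0 < \<theta> y" "\<theta> y < 2 * pi" if "y \<in> ?Sl" for y
  proof -
    have "pi / (2 * K) \<le> pi / 2" "0 < K" by (auto simp: K_def field_simps)
    then have "0 \<le> 2 * pi - pi / (2 * K)" using pi_gt_zero by linarith
    then have "0 \<le> min (2 * pi * real 0 / K) (2 * pi - pi / (2 * K))" by (simp add: min_def)
    then show "0 < \<theta> y" "\<theta> y < 2 * pi" using \<theta>(2) that by fastforce+
  qed
  have inj: "y = z" if "y \<in> ?Sl" "z \<in> ?Sl" "\<theta> y = \<theta> z" for y z
  proof -
    have "incr \<theta> W \<Longrightarrow> y \<in> set W \<Longrightarrow> z \<in> set W \<Longrightarrow> \<theta> y = \<theta> z \<Longrightarrow> y = z" for W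
      by (induction W) auto
    then show ?thesis using \<theta>(1) that by blast
  qed
  have T: "lks l y = suc y" "lks l (suc y) = y" "y \<in> set H" "y \<in> ?Sl" "suc y \<in> ?Sl" if "(H, T) \<in> set D" "y \<in> set T" for H T y
  proof -
    obtain s i where y: "y = (s, i)" by (cases y)
    have i: "even i" "i < 2 * l s" "s \<in> A" using d(6)[OF that(1), of s i] that(2) y by auto
    then have "Suc i \<noteq> 2 * l s" by presburger
    then show "lks l y = suc y" "lks l (suc y) = y" using i by (simp_all add: lks_def y)
    show "y \<in> set H" using capx_set[OF d(5)[OF that(1)]] that(2) by auto
    show "y \<in> ?Sl" "suc y \<in> ?Sl" using i unfolding d(3) y by auto
  qed
  have Clk: "lks l a = b \<and> lks l b = a" if "(a, b) \<in> C" for a b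
    using d(8)[OF that] capok_lks[of l a b] by simp
  \<comment> \<open>A point that is not a through point lies in some \<open>H\<close> or in
    \<open>M\<close>. Within this contiguous piece of the word \<open>capx_nest\<close> applies, and
    the pieces before and after it lie outside the interval of every cap.\<close>
  have piece: "\<exists>H T U R. wd D M = U @ H @ R \<and> capx C H T \<and> y \<in> set H \<and> y \<notin> set T \<and> set H \<inter> thr \<subseteq> set T"
    if y: "y \<in> ?Sl" "y \<notin> thr" for y
  proof -
    have thrW: "thr = (\<Union>(H, T)\<in>set D. set T) \<union> (\<Union>(H, T)\<in>set D. set (map suc T))"
      by (auto simp: thr_def)
    consider "y \<in> set M" | H T where "(H, T) \<in> set D" "y \<in> set H"
    proof (cases "y \<in> set M")
      case False
      then obtain HT where HT: "HT \<in> set D" "y \<in> set (fst HT) \<or> y \<in> suc ` set (snd HT)"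
        using y(1) unfolding set_wd by blast
      obtain H T where e: "HT = (H, T)" by (cases HT)
      have "y \<notin> suc ` set T" using y(2) HT(1) unfolding thr_def e by blast
      then show ?thesis using HT that(2)[of H T] unfolding e by simp
    qed (rule that(1))
    then show ?thesis
    proof cases
      case 1
      have "thr \<subseteq> set (wd D [])"
      proof
        fix z assume "z \<in> thr"
        then obtain H T' where HT: "(H, T') \<in> set D" "z \<in> set T' \<or> z \<in> suc ` set T'" by (auto simp: thr_def)
        then have "z \<in> set (fst (H, T')) \<union> suc ` set (snd (H, T'))" using T(3)[OF HT(1), of z] by auto
        then show "z \<in> set (wd D [])" unfolding set_wd using HT(1) by blast
      qed
      moreover have "set (wd D []) \<inter> set M = {}" using d(2) by (auto simp: wd_def)
      ultimately have "set M \<inter> thr \<subseteq> set []" by auto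
      then show ?thesis using d(7) 1
        by (intro exI[of _ M] exI[of _ "[]"] exI[of _ "wd D []"]) (auto simp: wd_def)
    next
      case (2 H T)
      obtain D1 D2 where D: "D = D1 @ (H, T) # D2" using 2(1) by (meson split_list)
      define R where "R = map suc T @ wd D2 M"
      have W: "wd D M = wd D1 [] @ H @ R" unfolding D R_def by (simp add: wd_def)
      have "z \<in> set T" if z: "z \<in> set H" "z \<in> thr" for z
      proof (rule ccontr)
        assume nz: "z \<notin> set T"
        obtain H' T' where HT: "(H', T') \<in> set D" "z \<in> set T' \<or> z \<in> set (map suc T')" using z(2) by (auto simp: thr_def)
        have nR: "z \<notin> set R" "z \<notin> set (wd D1 [])" using d(2) z(1) unfolding W by auto
        then have "(H', T') \<noteq> (H, T)" using HT(2) nz by (auto simp: R_def)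
        then have HT': "(H', T') \<in> set D1 \<union> set D2" using HT(1) by (auto simp: D)
        have "set T' \<subseteq> set H'" using capx_set[OF d(5)[OF HT(1)]] .
        then have "z \<in> set (fst (H', T')) \<union> suc ` set (snd (H', T'))" using HT(2)
          by (simp only: fst_conv snd_conv set_map) blast
        then have "z \<in> set (wd D1 []) \<union> set (wd D2 M)" using HT' unfolding set_wd by blast
        then show False using nR by (auto simp: R_def)
      qed
      moreover have "y \<notin> set T" using y(2) 2(1) by (auto simp: thr_def)
      ultimately show ?thesis using W d(5)[OF 2(1)] 2(2) by blast
    qed
  qed
  have nest: "z \<notin> thr \<and> \<theta> y < \<theta> (?lk z) \<and> \<theta> (?lk z) < \<theta> (?lk y)"
    if y: "y \<in> ?Sl" "y \<notin> thr" "z \<in> ?Sl" "\<theta> y < \<theta> z" "\<theta> z < \<theta> (?lk y)" for y z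
  proof -
    obtain H T U R where W: "wd D M = U @ H @ R" "capx C H T" "y \<in> set H" "y \<notin> set T" "set H \<inter> thr \<subseteq> set T"
      using piece[OF y(1,2)] by blast
    have iH: "incr \<theta> H" using \<theta>(1) unfolding W(1) by (simp add: sorted_wrt_append)
    have n: "?lk y \<in> set H" "\<And>z. z \<in> set H \<Longrightarrow> btw \<theta> y (?lk y) z \<Longrightarrow> z \<notin> set T \<and> btw \<theta> y (?lk y) (?lk z)"
      using capx_nest[OF W(2) iH Clk W(3,4)] by blast+
    have "z \<in> set H"
    proof -
      have U: "\<theta> u < \<theta> y" if "u \<in> set U" for u using \<theta>(1) that W(3) unfolding W(1) by (simp add: sorted_wrt_append)
      have R: "\<theta> (?lk y) < \<theta> u" if "u \<in> set R" for u using \<theta>(1) that n(1) unfolding W(1) by (simp add: sorted_wrt_append)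
      have "z \<notin> set U" by (rule notI) (use U[of z] y(4) in simp)
      moreover have "z \<notin> set R" by (rule notI) (use R[of z] y(5) in simp)
      ultimately show ?thesis using y(3) unfolding W(1) by simp
    qed
    moreover have b: "btw \<theta> y (?lk y) w \<longleftrightarrow> \<theta> y < \<theta> w \<and> \<theta> w < \<theta> (?lk y)" for w
      using y(4,5) by (auto simp: btw_def)
    ultimately show ?thesis using n(2)[of z] y(4,5) W(5) by blast
  qed
  have "(\<exists>s r s' r'. X = {Inr (s, r), Inr (s', r')} \<and> fst s \<noteq> fst s') \<or> X = {}"
    using d(9) by (cases x) (simp_all only: if_True if_False simp_thms)
  then have X: "X \<subseteq> range Inr" "\<exists>s r s' r'. X \<subseteq> {Inr (s, r), Inr (s', r')} \<and> fst s \<noteq> fst s' \<or> X = {}"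
    by blast+
  have labInr: "(y = (s, 2 * r) \<or> y = (s, 2 * r - 1)) \<and> 0 < r" if "lab y = Inr (s, r)" for y s r
    using that by (cases y) (auto simp: lab_def split: if_splits)
  interpret graph_picture ?Sl \<theta> lab ?lk thr X k V E "Ns l" "sqs l"
  proof
    show "finite ?Sl" by simp
    show "0 < \<theta> y" "\<theta> y < 2 * pi" if "y \<in> ?Sl" for y using pos[OF that] by auto
    show "y = z" if "y \<in> ?Sl" "z \<in> ?Sl" "\<theta> y = \<theta> z" for y z using inj[OF that] .
    show "{lab x1, lab y1} = X" if h: "x1 \<in> ?Sl" "y1 \<in> ?Sl" "x2 \<in> ?Sl" "y2 \<in> ?Sl" "\<theta> x1 < \<theta> y1" "\<theta> y1 < \<theta> x2"
      "\<theta> x2 < \<theta> y2" "lab x1 = lab x2" "lab y1 = lab y2" "lab x1 \<noteq> lab y1" for x1 y1 x2 y2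
    proof (rule ccontr)
      assume n: "{lab x1, lab y1} \<noteq> X"
      have "subseq [x1, y1, x2, y2] (wd D M)" by (rule incr_subseq[OF \<theta>(1)]) (use h in auto)
      then have "subseq (map lab [x1, y1, x2, y2]) (map lab (wd D M))" by (rule subseq_map)
      then have "subseq [lab x1, lab y1, lab x1, lab y1] (map lab (wd D M))"
        unfolding list.map h(8)[symmetric] h(9)[symmetric] .
      then show False using d(4) n h(10) unfolding nc_def by blast
    qed
    show "?lk y \<in> ?Sl" "?lk (?lk y) = y" "?lk y \<noteq> y" if "y \<in> ?Sl" for y
      using that lks_lks[of y l] unfolding Sl by auto
    show "?lk y \<in> thr" if yt: "y \<in> thr" for y
    proof -
      obtain H T' z where z: "(H, T') \<in> set D" "z \<in> set T'" "y = z \<or> y = suc z" using yt unfolding thr_def by blast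
      have "?lk y = suc z \<or> ?lk y = z" using z(3) T(1,2)[OF z(1,2)] by blast
      then show ?thesis using z(1,2) unfolding thr_def by blast
    qed
    show "z \<notin> thr \<and> \<theta> y < \<theta> (?lk z) \<and> \<theta> (?lk z) < \<theta> (?lk y)"
      if "y \<in> ?Sl" "y \<notin> thr" "z \<in> ?Sl" "\<theta> y < \<theta> z" "\<theta> z < \<theta> (?lk y)" for y z using nest[OF that] .
    show "\<exists>z\<in>?Sl. z \<noteq> y \<and> lab z = lab y" if y: "y \<in> ?Sl" for y
    proof -
      obtain s i where si: "y = (s, i)" by (cases y)
      have s: "s \<in> A" "i \<le> 2 * l s" using y unfolding d(3) si by auto
      consider "i = 0" | r where "i = Suc (2 * r)" | r where "i = Suc (Suc (2 * r))"
        by (rule nat_parity_cases)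
      then show ?thesis
      proof cases
        case 1
        obtain s' where "s' \<in> A" "s' \<noteq> s" "vtx s' = vtx s" using deg[OF s(1)] by blast
        then show ?thesis unfolding si 1 d(3) by (intro bexI[of _ "(s', 0)"]) (auto simp: lab_def)
      next
        case (2 r)
        then have "Suc i \<le> 2 * l s" using s(2) by presburger
        then show ?thesis unfolding si d(3) using s(1) 2 by (intro bexI[of _ "(s, Suc i)"]) (auto simp: lab_def)
      next
        case (3 r)
        then show ?thesis unfolding si d(3) using s by (intro bexI[of _ "(s, i - 1)"]) (auto simp: lab_def)
      qed
    qed
    show "a = b \<or> b = c \<or> a = c" if aX: "lab a \<in> X" and abc: "lab b = lab a" "lab c = lab a" for a b c
    proof -
      obtain s r where sr: "lab a = Inr (s, r)" using aX X(1) by auto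
      show ?thesis using labInr[OF sr] labInr[of b s r] labInr[of c s r] abc sr by auto
    qed
    show "\<exists>y i. i < k \<and> (y = z \<or> y = ?lk z) \<and> 2 * pi * real i / real k < \<theta> y \<and>
        \<theta> y < 2 * pi * real i / real k + pi / real k \<and> \<theta> (?lk y) = \<theta> y + pi / real k"
      if zt: "z \<in> thr" for z
    proof -
      obtain H T' y where y: "(H, T') \<in> set D" "y \<in> set T'" "z = y \<or> z = suc y" using zt unfolding thr_def by blast
      obtain i where i: "i < k" "2 * pi * real i / K < \<theta> y" "\<theta> y < 2 * pi * real i / K + pi / K" "\<theta> (suc y) = \<theta> y + pi / K"
        using \<theta>(3) y by blast
      have K: "K = real k" using i(1) by (simp add: K_def)
      have "y = z \<or> y = ?lk z" using y(3) T(2)[OF y(1,2)] by auto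
      then show ?thesis using i T(1)[OF y(1,2)] unfolding K by (intro exI[of _ y] exI[of _ i]) simp
    qed
    show "finite E" by (rule finE)
    show "even (Ns l e)" "2 \<le> Ns l e" for e by (simp_all add: Ns_def)
    show "sqs l e i \<in> ?Sl" if "e \<in> E" "i < Ns l e" for e i
      unfolding Sl using sqs_top[OF that(2)] that(1) by simp
    show "?lk (sqs l e i) = sqs l e (if even i then Suc i else i - 1)" if "i < Ns l e" for e i using sqs_lk[OF that] .
    show "e = f \<and> i = j" if "i < Ns l e" "j < Ns l f" "sqs l e i = sqs l f j" for e f i j using sqs_inj[OF that] .
    show "lab (sqs l e 0) = Inl (fst e)" for e by (simp add: sqs_def lab_def vtx_def)
    show "lab (sqs l e (Ns l e - 1)) = Inl (snd e)" for e by (simp add: sqs_def Ns_def lab_def vtx_def)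
    have mid: "0 < snd (sqs l e i)" if "0 < i" "i < Ns l e - 1" for e i
      using that by (auto simp: sqs_def Ns_def)
    show "\<exists>c. lab (sqs l e i) = Inr c" if "0 < i" "i < Ns l e - 1" for e i
      using mid[OF that] by (auto simp: lab_def)
    show "e = f \<and> (i + 1) div 2 = (j + 1) div 2" if "0 < i" "i < Ns l e - 1" "0 < j" "j < Ns l f - 1"
      "lab (sqs l e i) = lab (sqs l f j)" for e f i j
    proof -
      have lb: "fst (sqs l e i) = fst (sqs l f j)" "(snd (sqs l e i) + 1) div 2 = (snd (sqs l f j) + 1) div 2"
        using that(5) mid[OF that(1,2)] mid[OF that(3,4)] by (simp_all add: lab_def prod_eq_iff)
      have e: "e = f" using arg_cong[OF lb(1), of fst] by simp
      have ij: "i < Ns l e" "j < Ns l e" using that(2,4) e by auto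
      show ?thesis using sqs_pass[OF ij] lb e by simp
    qed
    show "lab (sqs l e (Suc i)) = lab (sqs l e i)" if "odd i" "Suc i < Ns l e" for e i
    proof -
      have i: "i < Ns l e" using that(2) by simp
      show ?thesis using i
      proof (cases rule: sqs_cases)
        case 1
        then have "Suc i \<le> 2 * l (e, False)" using that(1) by presburger
        then show ?thesis using 1 that(1) by (auto simp: sqs_def lab_def elim!: oddE)
      next
        case (2 a)
        have "even a" using that(1) 2(1) by simp
        then have s: "sqs l e (Suc i) = ((e, True), 2 * l (e, True) - a - 1)" "a < 2 * l (e, True)"
          using 2 that(2) by (auto simp: sqs_def Ns_def)
        obtain c where c: "a = 2 * c" using \<open>even a\<close> by (auto elim: evenE)
        show ?thesis unfolding s(1) 2(3) using s(2) unfolding c by (auto simp: lab_def; presburger)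
      qed
    qed
    show "\<exists>y\<in>?Sl. lab y = Inl v" if vV: "v \<in> V" for v
    proof -
      obtain s where "s \<in> A" "vtx s = v" using V[OF vV] by blast
      then show ?thesis unfolding d(3) by (intro bexI[of _ "(s, 0)"]) (auto simp: lab_def)
    qed
    show "X \<subseteq> range Inr" by (rule X(1))
    show "lab (sqs l e i) = lab (sqs l e j)" if Xi: "lab (sqs l e i) \<in> X" "lab (sqs l e j) \<in> X" for e i j
    proof -
      obtain s r s' r' where *: "X \<subseteq> {Inr (s, r), Inr (s', r')}" "fst s \<noteq> fst s'" using X(2) Xi by blast
      have fs: "fst s = e" if "lab (sqs l e i) = Inr (s, r)" for i s r
        using that sqs_edge[of l e i] by (auto simp: lab_def split: if_splits)
      have "lab (sqs l e i) \<in> {Inr (s, r), Inr (s', r')}" "lab (sqs l e j) \<in> {Inr (s, r), Inr (s', r')}"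
        using * Xi by blast+
      then show ?thesis using fs[of i s r] fs[of i s' r'] fs[of j s r] fs[of j s' r'] *(2) by auto
    qed
  qed
  show ?thesis using drawing_gam[OF VE] card_crossings by blast
qed

theorem game_drawing:
  assumes "game {s. fst s \<in> E} k x []" "finite E"
    and "\<And>s. fst s \<in> E \<Longrightarrow> \<exists>s'. fst s' \<in> E \<and> s' \<noteq> s \<and> vtx s' = vtx s"
    and "\<And>v. v \<in> V \<Longrightarrow> \<exists>s. fst s \<in> E \<and> vtx s = v"
    and "\<And>e. e \<in> E \<Longrightarrow> fst e \<in> V \<and> snd e \<in> V"
  shows "\<exists>p \<gamma>. drawing (Nsurf k) V E p \<gamma> \<and> card (crossings E \<gamma>) \<le> 1"
proof -
  obtain D M l C X where "diag {s. fst s \<in> E} k x [] D M l C X" using game_diag[OF assms(1)] by blast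
  then show ?thesis by (rule diag_drawing) (use assms in auto)
qed

theorem Kmn_drawing:
  assumes "3 \<le> m" "3 \<le> n" "odd m" "odd n"
  shows "\<exists>p \<gamma>. drawing (Nsurf ((m - 2) * (n - 2) div 2)) (Kmn_V m n) (Kmn_E m n) p \<gamma> \<and> card (crossings (Kmn_E m n) \<gamma>) \<le> 1"
proof -
  have odd3: "\<exists>p. m = 2 * p + 3" if "3 \<le> m" "odd m" for m :: nat using that by presburger
  obtain p q where pq: "m = 2 * p + 3" "n = 2 * q + 3" using odd3 assms by metis
  have "(m - 2) * (n - 2) = 2 * ((m - 2) * q + p) + 1"
    unfolding pq by (simp add: algebra_simps)
  moreover have half: "a = 2 * b + 1 \<Longrightarrow> a div 2 = b" for a b :: nat by simp
  ultimately have k: "(m - 2) * (n - 2) div 2 = (m - 2) * q + p" using half by blast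
  have St: "St m n (Kmn_V m n) = {s. fst s \<in> Kmn_E m n}"
    by (auto simp: St_def vtx_def Kmn_E_def Kmn_V_def)
  show ?thesis unfolding k
  proof (rule game_drawing)
    show "game {s. fst s \<in> Kmn_E m n} ((m - 2) * q + p) True []"
      using game_Kmn[of p q] unfolding pq[symmetric] St .
    have "Kmn_E m n = (\<lambda>(i, j). (Inl i, Inr j)) ` ({..<m} \<times> {..<n})" by (auto simp: Kmn_E_def)
    then show "finite (Kmn_E m n)" by simp
    show "fst e \<in> Kmn_V m n \<and> snd e \<in> Kmn_V m n" if "e \<in> Kmn_E m n" for e
      using that by (auto simp: Kmn_E_def Kmn_V_def)
    show "\<exists>s. fst s \<in> Kmn_E m n \<and> vtx s = v" if v: "v \<in> Kmn_V m n" for v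
    proof (cases v)
      case (Inl i)
      then show ?thesis using v assms
        by (intro exI[of _ "((Inl i, Inr 0), False)"]) (auto simp: Kmn_E_def Kmn_V_def vtx_def)
    next
      case (Inr j)
      then show ?thesis using v assms
        by (intro exI[of _ "((Inl 0, Inr j), True)"]) (auto simp: Kmn_E_def Kmn_V_def vtx_def)
    qed
    show "\<exists>s'. fst s' \<in> Kmn_E m n \<and> s' \<noteq> s \<and> vtx s' = vtx s" if s: "fst s \<in> Kmn_E m n" for s
    proof -
      have other: "\<exists>i'<m. i' \<noteq> i" if "3 \<le> m" for i m :: nat
        using that by (intro exI[of _ "if i = 0 then 1 else 0"]) auto
      obtain i j where ij: "fst s = (Inl i, Inr j)" "i < m" "j < n" using s by (auto simp: Kmn_E_def)
      show ?thesis
      proof (cases "snd s")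
        case True
        obtain i' where "i' < m" "i' \<noteq> i" using other[OF assms(1)] by blast
        then show ?thesis using ij True
          by (intro exI[of _ "((Inl i', Inr j), True)"]) (auto simp: Kmn_E_def vtx_def)
      next
        case False
        obtain j' where "j' < n" "j' \<noteq> j" using other[OF assms(2)] by blast
        then show ?thesis using ij False
          by (intro exI[of _ "((Inl i, Inr j'), False)"]) (auto simp: Kmn_E_def vtx_def)
      qed
    qed
  qed
qed

section \<open>Discrete embeddings in a cell complex\<close>

text \<open>The colours are the classes of faces merged across the edges of \<open>C\<close>. Each
  edge identifies at most two colours and so loses at most one.\<close>

lemma merge_colours:
  assumes "finite C" "finite T"
  shows "\<exists>c :: 't \<Rightarrow> 't. (\<forall>e\<in>C. c (lf e) = c (rf e)) \<and> card T \<le> card (c ` T) + card C"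
  using assms(1)
proof induction
  case empty
  show ?case by (intro exI[of _ id]) simp
next
  case (insert e C)
  then obtain c :: "'t \<Rightarrow> 't" where c: "\<forall>e\<in>C. c (lf e) = c (rf e)" "card T \<le> card (c ` T) + card C" by blast
  define d where "d = (\<lambda>t. if c t = c (lf e) then c (rf e) else c t)"
  have "c ` T \<subseteq> insert (c (lf e)) (d ` T)" by (auto simp: d_def)
  then have "card (c ` T) \<le> card (insert (c (lf e)) (d ` T))" by (rule card_mono[rotated]) (use assms in simp)
  also have "\<dots> \<le> Suc (card (d ` T))" by (rule card_insert_le_m1) auto
  finally have "card T \<le> card (d ` T) + card (insert e C)" using c(2) insert by simp
  moreover have "\<forall>e\<in>insert e C. d (lf e) = d (rf e)" using c(1) by (auto simp: d_def)
  ultimately show ?case by blast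
qed

text \<open>Of a closed surface two facts are kept: the boundary of a set of faces is a cycle mod 2,
  and the dual graph is connected. Neither orientability nor the shape of the faces enters, so
  digons do no harm.\<close>

locale cells =
  fixes V :: "'v set" and E :: "'e set" and T :: "'t set"
    and src tgt :: "'e \<Rightarrow> 'v" and lf rf :: "'e \<Rightarrow> 't"
  assumes finV: "finite V" and finE: "finite E" and finT: "finite T"
    and ends: "\<And>e. e \<in> E \<Longrightarrow> src e \<in> V \<and> tgt e \<in> V"
    and sides: "\<And>e. e \<in> E \<Longrightarrow> lf e \<in> T \<and> rf e \<in> T"
    and even_bd: "\<And>U v. U \<subseteq> T \<Longrightarrow> v \<in> V \<Longrightarrow>
      even (\<Sum>e\<in>{e\<in>E. (lf e \<in> U) \<noteq> (rf e \<in> U)}. of_bool (src e = v) + of_bool (tgt e = v) :: nat)"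
    and dual_conn: "\<And>U. U \<subseteq> T \<Longrightarrow> U \<noteq> {} \<Longrightarrow> \<forall>e\<in>E. lf e \<in> U \<longleftrightarrow> rf e \<in> U \<Longrightarrow> U = T"
begin

section \<open>Boundaries mod 2, connected vertex sets, labelled forests\<close>

definition bd :: "'t set \<Rightarrow> 'e set" where
  "bd U = {e\<in>E. (lf e \<in> U) \<noteq> (rf e \<in> U)}"

definition deg :: "'e set \<Rightarrow> 'v \<Rightarrow> nat" where
  "deg S v = (\<Sum>e\<in>S. of_bool (src e = v) + of_bool (tgt e = v))"

lemma even_deg: "U \<subseteq> T \<Longrightarrow> v \<in> V \<Longrightarrow> even (deg (bd U) v)"
  unfolding deg_def bd_def by (rule even_bd)

text \<open>Connectedness of the induced graph is expressed by cuts, the form in which topological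
  connectedness delivers it and in which a forest is extended.\<close>

definition conn :: "'v set \<Rightarrow> bool" where
  "conn C \<longleftrightarrow> C \<subseteq> V \<and> (\<forall>W\<subseteq>C. W \<noteq> {} \<longrightarrow>
     (\<forall>e\<in>E. src e \<in> C \<longrightarrow> tgt e \<in> C \<longrightarrow> (src e \<in> W \<longleftrightarrow> tgt e \<in> W)) \<longrightarrow> W = C)"

lemma connD:
  assumes "conn C" "v \<in> C" "P v" "w \<in> C" "\<not> P w"
  obtains e where "e \<in> E" "src e \<in> C" "tgt e \<in> C" "P (src e) \<noteq> P (tgt e)"
proof -
  have "{v \<in> C. P v} \<noteq> C" "{v \<in> C. P v} \<noteq> {}" "{v \<in> C. P v} \<subseteq> C" using assms by auto
  then have "\<not> (\<forall>e\<in>E. src e \<in> C \<longrightarrow> tgt e \<in> C \<longrightarrow> (src e \<in> {v \<in> C. P v} \<longleftrightarrow> tgt e \<in> {v \<in> C. P v}))"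
    using assms(1) unfolding conn_def by blast
  then show ?thesis using that by blast
qed

text \<open>\<open>R\<close> holds the roots, \<open>W\<close> all vertices reached,
  \<open>A\<close> the edges used. The label \<open>b\<close> of a root is inherited by its whole
  tree, which later tells which vertex of the embedded graph a tree belongs to.\<close>

inductive forest :: "'v set \<Rightarrow> 'v set \<Rightarrow> ('v \<Rightarrow> 'x) \<Rightarrow> 'e set \<Rightarrow> bool" for R where
  root: "R \<subseteq> V \<Longrightarrow> forest R R b {}"
| leaf: "forest R W b A \<Longrightarrow> w \<in> W \<Longrightarrow> v \<in> V - W \<Longrightarrow> e \<in> E \<Longrightarrow> {src e, tgt e} = {v, w} \<Longrightarrow>
    forest R (insert v W) (b(v := b w)) (insert e A)"

lemma forest_props:
  assumes "forest R W b A"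
  shows "W \<subseteq> V" "R \<subseteq> W" "A \<subseteq> E" "\<And>e. e \<in> A \<Longrightarrow> src e \<in> W \<and> tgt e \<in> W \<and> b (src e) = b (tgt e)"
    "card W = card R + card A"
proof -
  from assms have "W \<subseteq> V \<and> R \<subseteq> W \<and> A \<subseteq> E \<and> (\<forall>e\<in>A. src e \<in> W \<and> tgt e \<in> W \<and> b (src e) = b (tgt e)) \<and> card W = card R + card A"
  proof induction
    case (leaf W b A w v e)
    have "finite W" "finite A" using leaf finV finE finite_subset by blast+
    moreover have "v \<noteq> w" "v \<notin> W" "v \<in> V" using leaf by auto
    moreover from leaf(5) \<open>v \<noteq> w\<close> have e: "src e = v \<and> tgt e = w \<or> src e = w \<and> tgt e = v" by (metis doubleton_eq_iff)
    moreover have "e \<notin> A" using leaf e \<open>v \<notin> W\<close> by blast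
    moreover have "src f \<noteq> v \<and> tgt f \<noteq> v" if "f \<in> A" for f using leaf.IH that \<open>v \<notin> W\<close> by blast
    ultimately show ?case using leaf.IH leaf.hyps(2,4) by auto
  qed auto
  then show "W \<subseteq> V" "R \<subseteq> W" "A \<subseteq> E" "\<And>e. e \<in> A \<Longrightarrow> src e \<in> W \<and> tgt e \<in> W \<and> b (src e) = b (tgt e)"
    "card W = card R + card A" by blast+
qed

text \<open>The leaf added last has degree one in the forest, so a set of edges with even degrees
  avoids its edge.\<close>

lemma forest_acyclic:
  assumes "forest R W b A" "S \<subseteq> A" "\<And>v. v \<in> V \<Longrightarrow> even (deg S v)"
  shows "S = {}"
  using assms
proof induction
  case (leaf W b A w v e)
  have v: "v \<notin> W" "v \<in> V" "v \<noteq> w" using leaf by auto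
  have A: "src f \<noteq> v \<and> tgt f \<noteq> v" if "f \<in> A" for f using forest_props(4)[OF leaf(1) that] v by blast
  have e: "src e = v \<and> tgt e = w \<or> src e = w \<and> tgt e = v" using leaf(5) v(3) by (metis doubleton_eq_iff)
  have "e \<notin> S"
  proof
    assume eS: "e \<in> S"
    have "finite S" using leaf.prems(1) forest_props(3)[OF leaf(1)] leaf(4) finE
      by (meson finite_subset insert_subset)
    then have "deg S v = of_bool (src e = v) + of_bool (tgt e = v) + deg (S - {e}) v"
      unfolding deg_def using eS by (simp add: sum.remove)
    also have "deg (S - {e}) v = 0" unfolding deg_def using leaf.prems(1) A by (intro sum.neutral) auto
    finally have "deg S v = 1" using e v(3) by auto
    then show False using leaf.prems(2)[OF v(2)] by simp
  qed
  then have "S \<subseteq> A" using leaf.prems(1) by blast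
  then show ?case using leaf.IH leaf.prems(2) by blast
qed auto

text \<open>As long as \<open>C\<close> is not exhausted, it contains an edge leaving
  \<open>W\<close>. The new vertex inherits the label of a vertex of \<open>C\<close>, so no foreign
  label enters \<open>C\<close>.\<close>

lemma forest_grow:
  assumes "forest R W b A" "conn C" "W \<inter> C \<noteq> {}"
  shows "\<exists>b' A'. forest R (W \<union> C) b' A' \<and> (\<forall>v\<in>W. b' v = b v) \<and> (\<forall>v\<in>C. b' v \<in> b ` (W \<inter> C))"
  using assms
proof (induction "card (C - W)" arbitrary: W b A)
  case 0
  have "finite C" using assms(2) finV finite_subset unfolding conn_def by blast
  then have "C \<subseteq> W" using 0 by simp
  then have "W \<union> C = W" "W \<inter> C = C" by auto
  then show ?case using 0(2) by auto
next
  case (Suc n)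
  have finC: "finite C" using assms(2) finV finite_subset unfolding conn_def by blast
  have "C - W \<noteq> {}" using Suc(2) by (metis card.empty nat.distinct(1))
  then obtain v0 w0 where "v0 \<in> C" "v0 \<in> W" "w0 \<in> C" "w0 \<notin> W" using Suc.prems(3) by blast
  then obtain e where e: "e \<in> E" "src e \<in> C" "tgt e \<in> C" "(src e \<in> W) \<noteq> (tgt e \<in> W)"
    using connD[OF assms(2), of v0 "\<lambda>v. v \<in> W" w0] by blast
  obtain v w where vw: "v \<in> C" "w \<in> C" "v \<notin> W" "w \<in> W" "{src e, tgt e} = {v, w}"
  proof (cases "src e \<in> W")
    case True then show ?thesis using e that[of "tgt e" "src e"] by blast
  next
    case False then show ?thesis using e that[of "src e" "tgt e"] by blast
  qed
  have "v \<in> V" using vw(1) assms(2) unfolding conn_def by blast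
  then have "v \<in> V - W" using vw(3) by simp
  then have f: "forest R (insert v W) (b(v := b w)) (insert e A)"
    by (rule forest.leaf[OF Suc.prems(1) vw(4) _ e(1) vw(5)])
  have "Suc (card (C - W - {v})) = card (C - W)"
    by (rule card_Suc_Diff1) (use vw(1,3) finC in simp_all)
  moreover have "C - W - {v} = C - insert v W" by (rule Diff_insert[symmetric])
  ultimately have "n = card (C - insert v W)" using Suc(2) by simp
  moreover have "insert v W \<inter> C \<noteq> {}" using vw(1) by blast
  ultimately obtain b' A' where b': "forest R (insert v W \<union> C) b' A'" "\<forall>u\<in>insert v W. b' u = (b(v := b w)) u"
    "\<forall>u\<in>C. b' u \<in> (b(v := b w)) ` (insert v W \<inter> C)"
    using Suc.hyps(1)[OF _ f Suc.prems(2)] by blast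
  have "insert v W \<union> C = W \<union> C" using vw(1) by blast
  moreover have "(b(v := b w)) ` (insert v W \<inter> C) \<subseteq> b ` (W \<inter> C)" using vw(2,4) by auto
  moreover have "b' u = b u" if "u \<in> W" for u using b'(2) vw(3) that by (cases "u = v") auto
  ultimately show ?case using b'(1,3) by (intro exI[of _ b'] exI[of _ A']) auto
qed

text \<open>The colour classes are the faces of the embedded graph, up to faces that are not discs.\<close>

lemma face_count:
  fixes b :: "'v \<Rightarrow> 'x"
  assumes f: "forest R V b A" and K: "K \<subseteq> X \<times> Y" "X \<inter> Y = {}" "finite K" "2 \<le> card K"
    and g: "\<And>\<kappa>. \<kappa> \<in> K \<Longrightarrow> g \<kappa> \<in> E \<and> {b (src (g \<kappa>)), b (tgt (g \<kappa>))} = {fst \<kappa>, snd \<kappa>}"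
  shows "2 * (int (card V) - int (card E) + int (card T) - int (card R) + int (card K)) \<le> int (card K)"
proof -
  note fp = forest_props[OF f]
  have gE: "g \<kappa> \<in> E" if "\<kappa> \<in> K" for \<kappa> using g[OF that] by simp
  have g2: "b (src (g \<kappa>)) = fst \<kappa> \<and> b (tgt (g \<kappa>)) = snd \<kappa> \<or> b (src (g \<kappa>)) = snd \<kappa> \<and> b (tgt (g \<kappa>)) = fst \<kappa>"
    if "\<kappa> \<in> K" for \<kappa> using conjunct2[OF g[OF that]] by (simp only: doubleton_eq_iff)
  have XY: "fst \<kappa> \<in> X" "snd \<kappa> \<in> Y" if "\<kappa> \<in> K" for \<kappa> using that K(1) by auto
  have ne: "x \<noteq> y" if "x \<in> X" "y \<in> Y" for x y using that K(2) by blast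
  have gA: "g \<kappa> \<notin> A" if "\<kappa> \<in> K" for \<kappa>
  proof
    assume "g \<kappa> \<in> A"
    then have "b (src (g \<kappa>)) = b (tgt (g \<kappa>))" using fp(4) by blast
    then have "fst \<kappa> = snd \<kappa>" using g2[OF that] by auto
    then show False using ne XY that by metis
  qed
  have gi: "inj_on g K"
  proof (rule inj_onI)
    fix \<kappa> \<mu> assume h: "\<kappa> \<in> K" "\<mu> \<in> K" "g \<kappa> = g \<mu>"
    have "fst \<kappa> \<noteq> snd \<mu>" "fst \<mu> \<noteq> snd \<kappa>" using ne XY h by metis+
    then have "fst \<kappa> = fst \<mu>" "snd \<kappa> = snd \<mu>" using g2[OF h(1)] g2[OF h(2)] h(3) by auto
    then show "\<kappa> = \<mu>" by (rule prod_eqI)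
  qed
  have finA: "finite A" using fp(3) finE finite_subset by blast
  define C where "C = E - (A \<union> g ` K)"
  have sub: "A \<union> g ` K \<subseteq> E" using fp(3) gE by blast
  have "card (A \<union> g ` K) = card A + card K"
    using card_Un_disjoint[OF finA finite_imageI[OF K(3)], of g] gA card_image[OF gi] by fastforce
  then have cC: "int (card C) = int (card E) - int (card A) - int (card K)"
    unfolding C_def using card_Diff_subset[OF _ sub] card_mono[OF finE sub] finite_subset[OF sub finE] by simp
  obtain c :: "'t \<Rightarrow> 't" where c: "\<forall>e\<in>C. c (lf e) = c (rf e)" "card T \<le> card (c ` T) + card C"
    using merge_colours[of C T lf rf] finE finT unfolding C_def by auto
  define U where "U a = {t \<in> T. c t = a}" for a
  define Q where "Q a = {\<kappa> \<in> K. g \<kappa> \<in> bd (U a)}" for a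
  have UT: "U a \<subseteq> T" for a by (auto simp: U_def)
  have bdU: "bd (U a) = {e \<in> E. (c (lf e) = a) \<noteq> (c (rf e) = a)}" for a
    using sides by (auto simp: bd_def U_def)
  have bdA: "bd (U a) \<subseteq> A \<union> g ` K" for a
  proof
    fix e assume "e \<in> bd (U a)"
    then have "e \<in> E" "c (lf e) \<noteq> c (rf e)" unfolding bdU by auto
    then have "e \<notin> C" using c(1) by blast
    then show "e \<in> A \<union> g ` K" using \<open>e \<in> E\<close> unfolding C_def by blast
  qed
  have finbd: "finite (bd (U a))" for a unfolding bd_def using finE by simp
  have finQ: "finite (Q a)" for a unfolding Q_def using K(3) by simp
  \<comment> \<open>The even degrees of the boundary are summed over all vertices labelled x. A
    forest edge has both ends there or none, so the joining edges at x alone give an even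
    sum.\<close>
  have even_Q: "even (\<Sum>\<kappa>\<in>Q a. of_bool (fst \<kappa> = x) + of_bool (snd \<kappa> = x) :: nat)" for a x
  proof -
    let ?w = "\<lambda>e. of_bool (b (src e) = x) + of_bool (b (tgt e) = x) :: nat"
    let ?Vx = "{v \<in> V. b v = x}"
    have one: "(\<Sum>v\<in>?Vx. of_bool (u = v) :: nat) = of_bool (b u = x)" if "u \<in> V" for u
      using finV that by (simp add: of_bool_def sum.delta)
    have "(\<Sum>v\<in>?Vx. deg (bd (U a)) v) = (\<Sum>e\<in>bd (U a). \<Sum>v\<in>?Vx. of_bool (src e = v) + of_bool (tgt e = v))"
      unfolding deg_def by (rule sum.swap)
    also have "\<dots> = (\<Sum>e\<in>bd (U a). ?w e)"
      using ends by (intro sum.cong) (auto simp: sum.distrib one bd_def)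
    also have "\<dots> = (\<Sum>e\<in>(bd (U a) \<inter> A) \<union> g ` Q a. ?w e)"
      by (rule sum.cong) (use bdA[of a] in \<open>auto simp: Q_def\<close>)
    also have "(\<Sum>e\<in>(bd (U a) \<inter> A) \<union> g ` Q a. ?w e) = (\<Sum>e\<in>bd (U a) \<inter> A. ?w e) + (\<Sum>e\<in>g ` Q a. ?w e)"
      using finA finQ gA by (intro sum.union_disjoint) (auto simp: Q_def)
    also have "(\<Sum>e\<in>g ` Q a. ?w e) = (\<Sum>\<kappa>\<in>Q a. ?w (g \<kappa>))"
      using gi by (subst sum.reindex) (auto simp: Q_def inj_on_def)
    also have "\<dots> = (\<Sum>\<kappa>\<in>Q a. of_bool (fst \<kappa> = x) + of_bool (snd \<kappa> = x))"
    proof (rule sum.cong)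
      fix \<kappa> assume "\<kappa> \<in> Q a"
      then have "\<kappa> \<in> K" by (simp add: Q_def)
      then show "?w (g \<kappa>) = of_bool (fst \<kappa> = x) + of_bool (snd \<kappa> = x)" 
        by (rule disjE[OF g2]) (simp_all only: add.commute)
    qed (rule refl)
    finally have *: "(\<Sum>v\<in>?Vx. deg (bd (U a)) v)
      = (\<Sum>e\<in>bd (U a) \<inter> A. ?w e) + (\<Sum>\<kappa>\<in>Q a. of_bool (fst \<kappa> = x) + of_bool (snd \<kappa> = x))" .
    have "even (\<Sum>v\<in>?Vx. deg (bd (U a)) v)" using even_deg[OF UT] by (intro dvd_sum) auto
    moreover have "even (\<Sum>e\<in>bd (U a) \<inter> A. ?w e)" using fp(4) by (intro dvd_sum) auto
    ultimately show ?thesis unfolding * by simp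
  qed
  \<comment> \<open>Parity at both ends: one joining edge forces a second one with the same end in
    \<open>X\<close>, a third one with the same end in \<open>Y\<close>, and a fourth one beside the
    third. They are distinct because distinct joining edges differ in an end and the graph is
    bipartite.\<close>
  have Q4: "4 \<le> card (Q a)" if a: "Q a \<noteq> {}" for a
  proof -
    have QK: "Q a \<subseteq> K" by (auto simp: Q_def)
    have ex: "\<exists>\<mu>\<in>Q a. \<mu> \<noteq> \<kappa> \<and> P \<mu>" if "\<kappa> \<in> Q a" "P \<kappa>" "even (\<Sum>\<mu>\<in>Q a. of_bool (P \<mu>) :: nat)" for P \<kappa>
    proof (rule ccontr)
      assume "\<not> ?thesis"
      then have "(\<Sum>\<mu>\<in>Q a. of_bool (P \<mu>) :: nat) = (\<Sum>\<mu>\<in>Q a. of_bool (\<mu> = \<kappa>))"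
        using that(1,2) by (intro sum.cong) auto
      also have "\<dots> = 1" using that(1) finQ by (simp add: of_bool_def sum.delta)
      finally show False using that(3) by simp
    qed
    have eX: "even (\<Sum>\<mu>\<in>Q a. of_bool (fst \<mu> = x) :: nat)" if "x \<in> X" for x
    proof -
      have "snd \<mu> \<noteq> x" if "\<mu> \<in> Q a" for \<mu> using that QK XY(2) ne \<open>x \<in> X\<close> by blast
      then have "(\<Sum>\<mu>\<in>Q a. of_bool (fst \<mu> = x) :: nat) = (\<Sum>\<mu>\<in>Q a. of_bool (fst \<mu> = x) + of_bool (snd \<mu> = x))"
        by (intro sum.cong) auto
      then show ?thesis using even_Q[of x a] by simp
    qed
    have eY: "even (\<Sum>\<mu>\<in>Q a. of_bool (snd \<mu> = y) :: nat)" if "y \<in> Y" for y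
    proof -
      have "fst \<mu> \<noteq> y" if "\<mu> \<in> Q a" for \<mu> using that QK XY(1) ne \<open>y \<in> Y\<close> by blast
      then have "(\<Sum>\<mu>\<in>Q a. of_bool (snd \<mu> = y) :: nat) = (\<Sum>\<mu>\<in>Q a. of_bool (fst \<mu> = y) + of_bool (snd \<mu> = y))"
        by (intro sum.cong) auto
      then show ?thesis using even_Q[of y a] by simp
    qed
    obtain \<kappa> where \<kappa>: "\<kappa> \<in> Q a" using a by blast
    obtain \<mu> where \<mu>: "\<mu> \<in> Q a" "\<mu> \<noteq> \<kappa>" "fst \<mu> = fst \<kappa>"
      using ex[OF \<kappa>, of "\<lambda>\<mu>. fst \<mu> = fst \<kappa>"] eX XY \<kappa> QK by blast
    obtain \<nu> where \<nu>: "\<nu> \<in> Q a" "\<nu> \<noteq> \<kappa>" "snd \<nu> = snd \<kappa>"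
      using ex[OF \<kappa>, of "\<lambda>\<mu>. snd \<mu> = snd \<kappa>"] eY XY \<kappa> QK by blast
    obtain \<rho> where \<rho>: "\<rho> \<in> Q a" "\<rho> \<noteq> \<nu>" "fst \<rho> = fst \<nu>"
      using ex[OF \<nu>(1), of "\<lambda>\<mu>. fst \<mu> = fst \<nu>"] eX XY \<nu> QK by blast
    have "fst \<nu> \<noteq> fst \<kappa>" using \<nu> by (simp add: prod_eq_iff)
    then have "card {\<kappa>, \<mu>, \<nu>, \<rho>} = 4" using \<mu> \<nu> \<rho> by (auto simp: card_insert_if)
    moreover have "{\<kappa>, \<mu>, \<nu>, \<rho>} \<subseteq> Q a" using \<kappa> \<mu> \<nu> \<rho> by blast
    ultimately show ?thesis using card_mono[OF finQ] by metis
  qed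
  \<comment> \<open>A class without joining edges has its boundary inside the forest. By acyclicity
    this is empty, so the class is everything; the bound then follows from
    \<open>2 \<le> card K\<close>.\<close>
  have one: "c ` T = {a}" if "a \<in> c ` T" "Q a = {}" for a
  proof -
    have "g \<kappa> \<notin> bd (U a)" if "\<kappa> \<in> K" for \<kappa> using \<open>Q a = {}\<close> that unfolding Q_def by blast
    then have "bd (U a) \<subseteq> A" using bdA[of a] by blast
    from forest_acyclic[OF f this even_deg[OF UT]] have "bd (U a) = {}" by simp
    then have "\<forall>e\<in>E. lf e \<in> U a \<longleftrightarrow> rf e \<in> U a" unfolding bd_def by blast
    moreover have "U a \<noteq> {}" using that(1) unfolding U_def by blast
    ultimately have "U a = T" using dual_conn[OF UT] by simp
    then show ?thesis using that(1) by (auto simp: U_def)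
  qed
  have "2 * card (c ` T) \<le> card K"
  proof (cases "\<exists>a\<in>c ` T. Q a = {}")
    case True
    then show ?thesis using one K(4) by fastforce
  next
    case False
    have "4 * card (c ` T) = (\<Sum>a\<in>c ` T. 4)" by simp
    also have "\<dots> \<le> (\<Sum>a\<in>c ` T. card (Q a))" using False Q4 by (intro sum_mono) blast
    also have "\<dots> = (\<Sum>a\<in>c ` T. \<Sum>\<kappa>\<in>K. of_bool (g \<kappa> \<in> bd (U a)))"
      unfolding Q_def using K(3) by (simp add: of_bool_def flip: sum.inter_filter)
    also have "\<dots> = (\<Sum>\<kappa>\<in>K. \<Sum>a\<in>c ` T. of_bool (g \<kappa> \<in> bd (U a)))" by (rule sum.swap)
    also have "\<dots> \<le> (\<Sum>\<kappa>\<in>K. 2)"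
    proof (rule sum_mono)
      fix \<kappa>
      have "(\<Sum>a\<in>c ` T. of_bool (g \<kappa> \<in> bd (U a)) :: nat) = card {a \<in> c ` T. g \<kappa> \<in> bd (U a)}"
        using finT by (simp add: of_bool_def flip: sum.inter_filter)
      also have "\<dots> \<le> card {c (lf (g \<kappa>)), c (rf (g \<kappa>))}"
        by (rule card_mono) (auto simp: bdU)
      also have "\<dots> \<le> 2" by (simp add: card_insert_if)
      finally show "(\<Sum>a\<in>c ` T. of_bool (g \<kappa> \<in> bd (U a)) :: nat) \<le> 2" .
    qed
    finally show ?thesis by simp
  qed
  then have "2 * int (card (c ` T)) \<le> int (card K)" by linarith
  moreover have "int (card V) = int (card R) + int (card A)" using fp(5) by simp
  moreover have "int (card T) \<le> int (card (c ` T)) + int (card C)" using c(2) by linarith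
  \<comment> \<open>With card A = card V - card R this is Euler's formula as an inequality: merging
    across the edges outside the forest and the joining edges leaves at least that many
    classes.\<close>
  ultimately show ?thesis using cC by (simp add: algebra_simps)
qed

text \<open>The forest is grown over the sets \<open>B x\<close>, from one root in each, then over
  the sets \<open>M \<kappa>\<close>, then over all vertices. Labels stay x on \<open>B x\<close>
  and stay among the two ends of \<kappa> on \<open>M \<kappa>\<close>; as both ends occur there,
  connectedness yields an edge inside \<open>M \<kappa>\<close> where the label changes, the joining
  edge of \<kappa>.\<close>

theorem fat_embedding:
  assumes K: "K \<subseteq> X \<times> Y" "X \<inter> Y = {}" "finite X" "finite Y" "2 \<le> card K"
    and V: "conn V"
    and B: "\<And>x. x \<in> X \<union> Y \<Longrightarrow> conn (B x) \<and> B x \<noteq> {}"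
      "\<And>x y. x \<in> X \<union> Y \<Longrightarrow> y \<in> X \<union> Y \<Longrightarrow> x \<noteq> y \<Longrightarrow> B x \<inter> B y = {}"
    and M: "\<And>\<kappa>. \<kappa> \<in> K \<Longrightarrow> conn (M \<kappa>) \<and> M \<kappa> \<inter> B (fst \<kappa>) \<noteq> {} \<and> M \<kappa> \<inter> B (snd \<kappa>) \<noteq> {}"
      "\<And>\<kappa> \<mu>. \<kappa> \<in> K \<Longrightarrow> \<mu> \<in> K \<Longrightarrow> \<kappa> \<noteq> \<mu> \<Longrightarrow> M \<kappa> \<inter> M \<mu> = {}"
      "\<And>\<kappa> x. \<kappa> \<in> K \<Longrightarrow> x \<in> X \<union> Y \<Longrightarrow> x \<noteq> fst \<kappa> \<Longrightarrow> x \<noteq> snd \<kappa> \<Longrightarrow> M \<kappa> \<inter> B x = {}"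
  shows "2 * (int (card V) - int (card E) + int (card T) - int (card (X \<union> Y)) + int (card K)) \<le> int (card K)"
proof -
  define LL where "LL = X \<union> Y"
  note B1 = B(1)[folded LL_def] and B2 = B(2)[folded LL_def] and M3 = M(3)[folded LL_def]
  have finK: "finite K" using K finite_subset by blast
  have finL: "finite LL" using K by (simp add: LL_def)
  define r where "r x = (SOME v. v \<in> B x)" for x
  have r: "r x \<in> B x" if "x \<in> LL" for x using B1[OF that] by (simp add: r_def some_in_eq)
  have rB: "r x \<in> B y \<longleftrightarrow> x = y" if "x \<in> LL" "y \<in> LL" for x y
    using r[OF that(1)] B2[OF that] by blast
  have ri: "inj_on r LL" using r rB by (metis inj_onI)
  define R where "R = r ` LL"
  have RV: "R \<subseteq> V" using r B1 unfolding R_def conn_def by blast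
  have cR: "card R = card LL" unfolding R_def using ri by (rule card_image)
  have s1: "\<exists>b A. forest R (R \<union> \<Union>(B ` L)) b A \<and> (\<forall>x\<in>LL. b (r x) = x) \<and> (\<forall>x\<in>L. \<forall>v\<in>B x. b v = x)"
    if "finite L" "L \<subseteq> LL" for L
    using that
  proof induction
    case empty
    have "forest R (R \<union> \<Union>(B ` {})) (the_inv_into LL r) {}" using root[OF RV] by simp
    moreover have "\<forall>x\<in>LL. the_inv_into LL r (r x) = x" using the_inv_into_f_f[OF ri] by blast
    ultimately show ?case by (intro exI[of _ "the_inv_into LL r"] exI[of _ "{}"]) simp
  next
    case (insert x L)
    have L: "L \<subseteq> LL" and x: "x \<in> LL" using insert.prems by simp_all
    obtain b A where b: "forest R (R \<union> \<Union>(B ` L)) b A" "\<forall>x\<in>LL. b (r x) = x" "\<forall>x\<in>L. \<forall>v\<in>B x. b v = x"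
      using insert.IH[OF L] by blast
    let ?W = "R \<union> \<Union>(B ` L)"
    have WB: "?W \<inter> B x = {r x}"
    proof -
      have "B x \<inter> B y = {}" if "y \<in> L" for y
        by (rule B2) (use x L that insert.hyps(2) in blast)+
      then have "\<Union>(B ` L) \<inter> B x = {}" by blast
      moreover have "R \<inter> B x = {r x}" using rB[OF _ x] r[OF x] x unfolding R_def by blast
      ultimately show ?thesis by blast
    qed
    obtain b' A' where b': "forest R (?W \<union> B x) b' A'" "\<forall>v\<in>?W. b' v = b v" "\<forall>v\<in>B x. b' v \<in> b ` {r x}"
      using forest_grow[OF b(1), of "B x"] B1[OF x] unfolding WB by blast
    have "?W \<union> B x = R \<union> \<Union>(B ` insert x L)" by blast
    moreover have "b' (r y) = y" if "y \<in> LL" for y using b'(2) b(2) that unfolding R_def by simp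
    moreover have "b' v = y" if "y \<in> insert x L" "v \<in> B y" for y v
    proof (cases "y = x")
      case True
      then have "b' v \<in> b ` {r x}" using b'(3) that(2) by blast
      then show ?thesis using b(2) x True by simp
    next
      case False
      then have "y \<in> L" using that(1) by blast
      then have "b' v = b v" "b v = y" using b'(2) b(3) that(2) by blast+
      then show ?thesis by simp
    qed
    ultimately show ?case using b'(1) by (intro exI[of _ b'] exI[of _ A']) simp
  qed
  define W0 where "W0 = \<Union>(B ` LL)"
  have "R \<union> W0 = W0" using r unfolding R_def W0_def by auto
  then obtain b0 A0 where b0: "forest R W0 b0 A0" "\<forall>x\<in>LL. \<forall>v\<in>B x. b0 v = x"
    using s1[OF finL subset_refl, folded W0_def] by metis
  have fs: "fst \<kappa> \<in> LL" "snd \<kappa> \<in> LL" "fst \<kappa> \<noteq> snd \<kappa>" if "\<kappa> \<in> K" for \<kappa>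
  proof -
    have xy: "fst \<kappa> \<in> X" "snd \<kappa> \<in> Y" using subsetD[OF K(1) that] by (simp_all add: mem_Times_iff)
    then show "fst \<kappa> \<in> LL" "snd \<kappa> \<in> LL" unfolding LL_def by simp_all
    show "fst \<kappa> \<noteq> snd \<kappa>" using K(2) xy by (metis disjoint_iff)
  qed
  have s2: "\<exists>b A. forest R (W0 \<union> \<Union>(M ` L)) b A \<and> (\<forall>x\<in>LL. \<forall>v\<in>B x. b v = x) \<and> (\<forall>\<kappa>\<in>L. \<forall>v\<in>M \<kappa>. b v \<in> {fst \<kappa>, snd \<kappa>})"
    if "finite L" "L \<subseteq> K" for L
    using that
  proof induction
    case empty
    show ?case using b0 by (intro exI[of _ b0] exI[of _ A0]) simp
  next
    case (insert \<kappa> L)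
    have L: "L \<subseteq> K" and \<kappa>: "\<kappa> \<in> K" using insert.prems by simp_all
    obtain b A where b: "forest R (W0 \<union> \<Union>(M ` L)) b A" "\<forall>x\<in>LL. \<forall>v\<in>B x. b v = x" "\<forall>\<kappa>\<in>L. \<forall>v\<in>M \<kappa>. b v \<in> {fst \<kappa>, snd \<kappa>}"
      using insert.IH[OF L] by blast
    let ?W = "W0 \<union> \<Union>(M ` L)"
    have WB: "?W \<inter> M \<kappa> \<subseteq> B (fst \<kappa>) \<union> B (snd \<kappa>)"
    proof
      fix v assume v: "v \<in> ?W \<inter> M \<kappa>"
      have "v \<notin> M \<mu>" if "\<mu> \<in> L" for \<mu>
      proof -
        have "M \<kappa> \<inter> M \<mu> = {}" by (rule M(2)) (use \<kappa> L that insert.hyps(2) in blast)+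
        then show ?thesis using v by blast
      qed
      then have "v \<in> W0" using v by blast
      then obtain x where x: "x \<in> LL" "v \<in> B x" unfolding W0_def by blast
      then have "x = fst \<kappa> \<or> x = snd \<kappa>" using M3[OF \<kappa>, of x] v by blast
      then show "v \<in> B (fst \<kappa>) \<union> B (snd \<kappa>)" using x(2) by blast
    qed
    have "M \<kappa> \<inter> B (fst \<kappa>) \<noteq> {}" using M(1)[OF \<kappa>] by blast
    then have "?W \<inter> M \<kappa> \<noteq> {}" using fs(1)[OF \<kappa>] unfolding W0_def by blast
    then obtain b' A' where b': "forest R (?W \<union> M \<kappa>) b' A'" "\<forall>v\<in>?W. b' v = b v" "\<forall>v\<in>M \<kappa>. b' v \<in> b ` (?W \<inter> M \<kappa>)"
      using forest_grow[OF b(1), of "M \<kappa>"] M(1)[OF \<kappa>] by blast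
    have "?W \<union> M \<kappa> = W0 \<union> \<Union>(M ` insert \<kappa> L)" by blast
    moreover have "b' v = x" if "x \<in> LL" "v \<in> B x" for x v
    proof -
      have "v \<in> ?W" using that unfolding W0_def by blast
      then show ?thesis using b'(2) b(2) that by simp
    qed
    moreover have "b' v \<in> {fst \<mu>, snd \<mu>}" if \<mu>: "\<mu> \<in> insert \<kappa> L" "v \<in> M \<mu>" for \<mu> v
    proof (cases "\<mu> = \<kappa>")
      case True
      then obtain w where w: "b' v = b w" "w \<in> ?W \<inter> M \<kappa>" using b'(3) \<mu>(2) by blast
      then have "w \<in> B (fst \<kappa>) \<or> w \<in> B (snd \<kappa>)" using WB by blast
      then have "b w = fst \<kappa> \<or> b w = snd \<kappa>" using b(2) fs(1,2)[OF \<kappa>] by blast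
      then show ?thesis using w(1) True by simp
    next
      case False
      then have "\<mu> \<in> L" using \<mu>(1) by blast
      then have "b' v = b v" "b v \<in> {fst \<mu>, snd \<mu>}" using b'(2) b(3) \<mu>(2) by blast+
      then show ?thesis by simp
    qed
    ultimately show ?case using b'(1) by (intro exI[of _ b'] exI[of _ A']) simp
  qed
  obtain b1 A1 where b1: "forest R (W0 \<union> \<Union>(M ` K)) b1 A1" "\<forall>x\<in>LL. \<forall>v\<in>B x. b1 v = x" "\<forall>\<kappa>\<in>K. \<forall>v\<in>M \<kappa>. b1 v \<in> {fst \<kappa>, snd \<kappa>}"
    using s2[OF finK subset_refl] by blast
  let ?W = "W0 \<union> \<Union>(M ` K)"
  have WV: "?W \<union> V = V" "?W \<inter> V = ?W" using forest_props(1)[OF b1(1)] by blast+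
  have "K \<noteq> {}" using K(5) by auto
  then obtain \<kappa>0 where "\<kappa>0 \<in> K" by blast
  then have "?W \<noteq> {}" using M(1)[of \<kappa>0] by blast
  then obtain b A where b: "forest R V b A" "\<forall>v\<in>?W. b v = b1 v"
    using forest_grow[OF b1(1) V] unfolding WV by blast
  have "\<exists>e. e \<in> E \<and> {b (src e), b (tgt e)} = {fst \<kappa>, snd \<kappa>}" if \<kappa>: "\<kappa> \<in> K" for \<kappa>
  proof -
    have MW: "M \<kappa> \<subseteq> ?W" using \<kappa> by blast
    have lab: "b v = fst \<kappa> \<or> b v = snd \<kappa>" if "v \<in> M \<kappa>" for v
    proof -
      have "b v = b1 v" "b1 v \<in> {fst \<kappa>, snd \<kappa>}" using that MW b(2) b1(3) \<kappa> by blast+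
      then show ?thesis by simp
    qed
    have Bl: "b v = x" if "x \<in> LL" "v \<in> B x" for v x
    proof -
      have "v \<in> ?W" using that unfolding W0_def by blast
      then show ?thesis using b(2) b1(2) that by simp
    qed
    obtain v where v: "v \<in> M \<kappa>" "v \<in> B (fst \<kappa>)" using M(1)[OF \<kappa>] by blast
    obtain w where w: "w \<in> M \<kappa>" "w \<in> B (snd \<kappa>)" using M(1)[OF \<kappa>] by blast
    have bv: "b v = fst \<kappa>" and bw: "b w \<noteq> fst \<kappa>"
      using Bl[OF fs(1)[OF \<kappa>] v(2)] Bl[OF fs(2)[OF \<kappa>] w(2)] fs(3)[OF \<kappa>] by simp_all
    have cM: "conn (M \<kappa>)" using M(1)[OF \<kappa>] by blast
    obtain e where e: "e \<in> E" "src e \<in> M \<kappa>" "tgt e \<in> M \<kappa>" "(b (src e) = fst \<kappa>) \<noteq> (b (tgt e) = fst \<kappa>)"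
      by (rule connD[OF cM v(1) _ w(1), where P = "\<lambda>v. b v = fst \<kappa>", OF bv bw])
    then have "{b (src e), b (tgt e)} = {fst \<kappa>, snd \<kappa>}"
      using lab[OF e(2)] lab[OF e(3)] fs(3)[OF \<kappa>] unfolding doubleton_eq_iff by blast
    then show ?thesis using e(1) by blast
  qed
  then obtain g where "\<And>\<kappa>. \<kappa> \<in> K \<Longrightarrow> g \<kappa> \<in> E \<and> {b (src (g \<kappa>)), b (tgt (g \<kappa>))} = {fst \<kappa>, snd \<kappa>}"
    by (meson that)
  from face_count[OF b(1) K(1,2) finK K(5) this] show ?thesis unfolding cR LL_def .
qed

end

section \<open>A triangulation of the surface\<close>

text \<open>Radial edges, diagonals and ring edges.\<close>

datatype gedge = EA nat nat | EB nat nat | ER nat nat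

text \<open>Polar coordinates (j, l), radius j / N and angle 2 pi l / L; row 0 is the centre of the disc.
  The boundary edges ER N l are listed for the first arc of each glued pair only.\<close>

locale grid =
  fixes k N :: nat
  assumes N: "2 \<le> N"
begin

definition L :: nat where "L = (if k = 0 then N else 2 * k * N)"

text \<open>Normal form of a boundary vertex under the gluing: the ends of all arcs are one vertex,
  represented by 0, and an inner point of an arc is represented by the corresponding point of the
  first arc of its pair. For k = 0 the whole boundary is one vertex.\<close>

definition kap :: "nat \<Rightarrow> nat" where
  "kap l = (if k = 0 \<or> l mod N = 0 then 0 else 2 * N * (l mod L div (2 * N)) + l mod N)"

definition vt :: "nat \<Rightarrow> nat \<Rightarrow> nat \<times> nat" where
  "vt j l = (if j = 0 then (0, 0) else if j = N then (N, kap l) else (j, l mod L))"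

definition Rep :: "nat set" where
  "Rep = (if k = 0 then {} else {l. l < L \<and> l mod (2 * N) < N})"

definition gverts :: "(nat \<times> nat) set" where "gverts = case_prod vt ` ({..N} \<times> {..<L})"
definition gedges :: "gedge set" where
  "gedges = case_prod EA ` ({..<N} \<times> {..<L}) \<union> case_prod EB ` ({..<N} \<times> {..<L})
      \<union> (case_prod ER ` ({1..<N} \<times> {..<L}) \<union> ER N ` Rep)"
text \<open>The two triangles of a square, \<open>True\<close> for the one at the outer ring edge
  and \<open>False\<close> for the one at the inner ring edge. In row 0, where the inner ring edge
  shrinks to the centre, the latter is a digon.\<close>

definition gfaces :: "(bool \<times> nat \<times> nat) set" where "gfaces = UNIV \<times> {..<N} \<times> {..<L}"

primrec src :: "gedge \<Rightarrow> nat \<times> nat" where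
  "src (EA j l) = vt j l" | "src (EB j l) = vt j l" | "src (ER j l) = vt j l"
primrec tgt :: "gedge \<Rightarrow> nat \<times> nat" where
  "tgt (EA j l) = vt (Suc j) l" | "tgt (EB j l) = vt (Suc j) (Suc l)" | "tgt (ER j l) = vt j (Suc l)"
primrec lf :: "gedge \<Rightarrow> bool \<times> nat \<times> nat" where
  "lf (EA j l) = (True, j, l)" | "lf (EB j l) = (True, j, l)" | "lf (ER j l) = (True, j - 1, l)"
text \<open>Beyond a boundary edge lies the outer triangle of the glued square, N places further on.
  The added \<open>L\<close> makes the cyclic predecessor of 0 come out right in natural
  numbers.\<close>

primrec rf :: "gedge \<Rightarrow> bool \<times> nat \<times> nat" where
  "rf (EA j l) = (False, j, (l + L - 1) mod L)" | "rf (EB j l) = (False, j, l)"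
| "rf (ER j l) = (if j = N then (True, N - 1, l + N) else (False, j, l))"

lemma L_pos: "0 < L" using N by (auto simp: L_def)

lemma mod_L: "0 < k \<Longrightarrow> l mod L mod N = l mod N"
  by (simp add: L_def mod_mod_cancel)

lemma kap_mod: "kap (l mod L) = kap l"
  unfolding kap_def using mod_L[of l] by (cases "k = 0") simp_all

lemma vt_mod[simp]: "vt j (l mod L) = vt j l"
  by (simp add: vt_def kap_mod)

lemma vt_cong: "l mod L = l' mod L \<Longrightarrow> vt j l = vt j l'"
  by (metis vt_mod)

lemma vt_gverts: "j \<le> N \<Longrightarrow> vt j l \<in> gverts"
  unfolding gverts_def using L_pos vt_mod[of j l, symmetric] by (intro image_eqI[of _ _ "(j, l mod L)"]) auto

lemma vt_0: "vt 0 l = vt 0 0" by (simp add: vt_def)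

lemma arc_decomp:
  assumes "l < L" "0 < k"
  obtains a r where "l = 2 * N * a + r" "a < k" "r < 2 * N"
proof -
  have "l = 2 * N * (l div (2 * N)) + l mod (2 * N)" "l mod (2 * N) < 2 * N" using N by simp_all
  moreover have "l div (2 * N) < k"
    using assms N by (simp add: L_def less_mult_imp_div_less algebra_simps)
  ultimately show ?thesis using that by blast
qed

lemma vt_glue:
  assumes "a < k" "r \<le> N" shows "vt N (2 * N * a + r + N) = vt N (2 * N * a + r)"
proof -
  have m: "(2 * N * a + s) mod N = s mod N" for s
    by (metis mod_mult_self4 mult.commute mult.assoc)
  have lt: "2 * N * a + s < L" if "s < 2 * N" for s
  proof -
    have "2 * N * Suc a \<le> 2 * N * k" by (rule mult_le_mono2) (use assms in simp)
    then show ?thesis using that assms by (simp add: L_def algebra_simps)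
  qed
  have "kap (2 * N * a + r + N) = kap (2 * N * a + r)"
  proof (cases "r = 0 \<or> r = N")
    case True
    then show ?thesis using m[of r] m[of "r + N"] by (auto simp: kap_def add.assoc)
  next
    case False
    then have r: "0 < r" "r < N" using assms by auto
    have "(2 * N * a + r + N) mod L = 2 * N * a + (r + N)" "(2 * N * a + r) mod L = 2 * N * a + r"
      using lt[of "r + N"] lt[of r] r by (simp_all add: add.assoc)
    moreover have "(2 * N * a + s) div (2 * N) = a" if "s < 2 * N" for s
      using that N by (simp add: div_mult_self4)
    ultimately show ?thesis using m[of r] m[of "r + N"] r by (simp add: kap_def add.assoc)
  qed
  then show ?thesis using N by (simp add: vt_def)
qed

lemma Rep_eq: "Rep = (\<lambda>(a, r). 2 * N * a + r) ` ({..<k} \<times> {..<N})"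
proof (intro set_eqI iffI)
  fix l assume "l \<in> Rep"
  then have l: "l < L" "l mod (2 * N) < N" "0 < k" by (auto simp: Rep_def split: if_splits)
  obtain a r where "l = 2 * N * a + r" "a < k" "r < 2 * N" by (rule arc_decomp[OF l(1,3)])
  then show "l \<in> (\<lambda>(a, r). 2 * N * a + r) ` ({..<k} \<times> {..<N})" using l(2) by auto
next
  fix l assume "l \<in> (\<lambda>(a, r). 2 * N * a + r) ` ({..<k} \<times> {..<N})"
  then obtain a r where l: "l = 2 * N * a + r" "a < k" "r < N" by auto
  have "2 * N * Suc a \<le> 2 * N * k" by (rule mult_le_mono2) (use l in simp)
  then have "l < L" using l by (simp add: L_def algebra_simps)
  then show "l \<in> Rep" using l by (simp add: Rep_def)
qed

lemma arc_inj: "inj_on (\<lambda>(a, r). 2 * N * a + r) ({..<k} \<times> {..<N})"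
proof (rule inj_onI, clarsimp)
  fix a r a' r' assume h: "2 * N * a + r = 2 * N * a' + r'" "r < N" "r' < N"
  have "(2 * N * a + r) div (2 * N) = a" "(2 * N * a' + r') div (2 * N) = a'" using h(2,3) N by simp_all
  then have "a = a'" unfolding h(1) by simp
  then show "a = a' \<and> r = r'" using h by simp
qed

lemma card_Rep: "card Rep = k * N"
  unfolding Rep_eq card_image[OF arc_inj] by simp

lemma Rep_split:
  assumes "0 < k"
  shows "{..<L} = Rep \<union> (\<lambda>l. l + N) ` Rep" "Rep \<inter> (\<lambda>l. l + N) ` Rep = {}"
proof -
  have R: "l \<in> Rep \<longleftrightarrow> l < L \<and> l mod (2 * N) < N" for l using assms by (simp add: Rep_def)
  show "{..<L} = Rep \<union> (\<lambda>l. l + N) ` Rep"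
  proof (intro set_eqI iffI)
    fix l assume "l \<in> {..<L}"
    then obtain a r where l: "l = 2 * N * a + r" "a < k" "r < 2 * N" using arc_decomp assms by blast
    show "l \<in> Rep \<union> (\<lambda>l. l + N) ` Rep"
    proof (cases "r < N")
      case True then show ?thesis using l unfolding Rep_eq by auto
    next
      case False
      then have "2 * N * a + (r - N) \<in> Rep" "l = 2 * N * a + (r - N) + N"
        using l unfolding Rep_eq by (auto intro!: image_eqI[of _ _ "(a, r - N)"])
      then show ?thesis by blast
    qed
  next
    fix l assume "l \<in> Rep \<union> (\<lambda>l. l + N) ` Rep"
    then obtain a r where l: "l = 2 * N * a + r \<or> l = 2 * N * a + r + N" "a < k" "r < N" unfolding Rep_eq by auto
    have "2 * N * Suc a \<le> 2 * N * k" by (rule mult_le_mono2) (use l in simp)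
    then show "l \<in> {..<L}" using l assms by (auto simp: L_def algebra_simps)
  qed
  show "Rep \<inter> (\<lambda>l. l + N) ` Rep = {}"
  proof -
    have False if h: "x \<in> Rep" "y \<in> Rep" "x = y + N" for x y
    proof -
      obtain a r where y: "y = 2 * N * a + r" "r < N" using h(2) unfolding Rep_eq by auto
      have "x mod (2 * N) = (2 * N * a + (r + N)) mod (2 * N)" unfolding h(3) y by (simp add: add.assoc)
      also have "\<dots> = r + N" using y(2) by simp
      finally show False using h(1) R by simp
    qed
    then show ?thesis by blast
  qed
qed

lemma gedges_cases:
  assumes "e \<in> gedges"
  obtains j l where "e = EA j l" "j < N" "l < L" | j l where "e = EB j l" "j < N" "l < L"
  | j l where "e = ER j l" "0 < j" "j < N" "l < L" | l where "e = ER N l" "l \<in> Rep"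
  using assms unfolding gedges_def by force

lemma gedges_I: "j < N \<Longrightarrow> l < L \<Longrightarrow> EA j l \<in> gedges" "j < N \<Longrightarrow> l < L \<Longrightarrow> EB j l \<in> gedges"
  "0 < j \<Longrightarrow> j < N \<Longrightarrow> l < L \<Longrightarrow> ER j l \<in> gedges"
  unfolding gedges_def by force+

lemma finite_G: "finite gverts" "finite gedges" "finite gfaces" "finite Rep"
  by (simp_all add: gverts_def gedges_def gfaces_def Rep_def)

lemma RepD: "l \<in> Rep \<Longrightarrow> l < L \<and> l + N < L \<and> 0 < k"
proof -
  assume l: "l \<in> Rep"
  then have "0 < k" by (auto simp: Rep_def split: if_splits)
  then show ?thesis using Rep_split(1) l by blast
qed

lemma gedges_disjoint:
  "case_prod EA ` S \<inter> case_prod EB ` S' = {}"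
  "(case_prod EA ` S \<union> case_prod EB ` S') \<inter> (case_prod ER ` S'' \<union> ER N ` Y) = {}"
  "case_prod ER ` ({1..<N} \<times> Z) \<inter> ER N ` Y = {}"
  by auto

lemma sum_gedges:
  fixes f :: "gedge \<Rightarrow> nat"
  shows "sum f gedges = (\<Sum>j<N. \<Sum>l<L. f (EA j l)) + (\<Sum>j<N. \<Sum>l<L. f (EB j l))
    + ((\<Sum>j\<in>{1..<N}. \<Sum>l<L. f (ER j l)) + (\<Sum>l\<in>Rep. f (ER N l)))"
proof -
  have inj: "inj_on (case_prod EA) X" "inj_on (case_prod EB) X" "inj_on (case_prod ER) X" "inj_on (ER N) Y" for X Y
    by (auto simp: inj_on_def)
  have "sum f gedges = sum f (case_prod EA ` ({..<N} \<times> {..<L})) + sum f (case_prod EB ` ({..<N} \<times> {..<L}))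
      + (sum f (case_prod ER ` ({1..<N} \<times> {..<L})) + sum f (ER N ` Rep))"
    unfolding gedges_def
    by (simp only: sum.union_disjoint[OF _ _ gedges_disjoint(2)] sum.union_disjoint[OF _ _ gedges_disjoint(1)]
        sum.union_disjoint[OF _ _ gedges_disjoint(3)] finite_imageI finite_cartesian_product finite_lessThan finite_atLeastLessThan
        finite_UnI finite_G(4))
  then show ?thesis
    unfolding sum.reindex[OF inj(1)] sum.reindex[OF inj(2)] sum.reindex[OF inj(3)] sum.reindex[OF inj(4)]
    by (simp add: sum.cartesian_product case_prod_unfold)
qed

text \<open>Reindexing by the cyclic predecessor, by which the radial edges are charged to the
  triangle on their right side.\<close>

lemma sum_shift:
  fixes f :: "nat \<Rightarrow> nat"
  assumes "\<And>l. g (Suc l mod L) = h l"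
  shows "(\<Sum>l<L. f ((l + L - 1) mod L) * g l) = (\<Sum>l<L. f l * h l)"
proof -
  have "(\<Sum>l<L. f l * h l) = (\<Sum>l<L. f ((l + L - 1) mod L) * g l)"
  proof (rule sum.reindex_bij_witness[where j = "\<lambda>l. Suc l mod L" and i = "\<lambda>l. (l + L - 1) mod L"])
    fix l assume l: "l \<in> {..<L}"
    have c: "Suc l = L \<or> Suc l < L" using l by auto
    then show inv: "(Suc l mod L + L - 1) mod L = l" using L_pos by auto
    show "Suc l mod L \<in> {..<L}" using L_pos by simp
    show "f ((Suc l mod L + L - 1) mod L) * g (Suc l mod L) = f l * h l" unfolding inv assms ..
  next
    fix l assume l: "l \<in> {..<L}"
    show "Suc ((l + L - 1) mod L) mod L = l"
    proof (cases l)
      case 0 then show ?thesis using L_pos by simp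
    next
      case (Suc i) then show ?thesis using l by simp
    qed
    show "(l + L - 1) mod L \<in> {..<L}" using L_pos by simp
  qed
  then show ?thesis ..
qed

text \<open>Weighting each edge by the number of its sides in \<open>U\<close> and regrouping by
  faces, every triangle counts each of its corners twice. \<open>X\<close> and \<open>Y\<close>
  supply the missing ring edges at the boundary and at the centre. \<open>Y\<close> is even as its
  edges are collapsed; \<open>X\<close> is the share of the glued edges, or even if k = 0.\<close>

lemma even_boundary:
  "even (\<Sum>e\<in>{e\<in>gedges. (lf e \<in> U) \<noteq> (rf e \<in> U)}. of_bool (src e = v) + of_bool (tgt e = v) :: nat)"
proof -
  define p :: "nat \<Rightarrow> nat \<Rightarrow> nat" where "p j l = of_bool (vt j l = v)" for j l
  define D :: "nat \<Rightarrow> nat \<Rightarrow> nat" where "D j l = of_bool ((True, j, l) \<in> U)" for j l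
  define F :: "nat \<Rightarrow> nat \<Rightarrow> nat" where "F j l = of_bool ((False, j, l) \<in> U)" for j l
  define d :: "gedge \<Rightarrow> nat" where "d e = of_bool (src e = v) + of_bool (tgt e = v)" for e
  define u :: "gedge \<Rightarrow> nat" where "u e = of_bool (lf e \<in> U) + of_bool (rf e \<in> U)" for e
  let ?S = "\<lambda>f :: nat \<Rightarrow> nat \<Rightarrow> nat. \<Sum>j<N. \<Sum>l<L. f j l"
  \<comment> \<open>Edges with both sides in \<open>U\<close> have weight two and drop out mod
    2.\<close>
  define q where "q e = (if lf e \<in> U \<and> rf e \<in> U then d e else 0)" for e
  have "(\<Sum>e\<in>gedges. u e * d e) = (\<Sum>e\<in>gedges. (if (lf e \<in> U) \<noteq> (rf e \<in> U) then d e else 0) + 2 * q e)"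
    by (intro sum.cong) (auto simp: u_def q_def)
  also have "\<dots> = (\<Sum>e\<in>gedges. if (lf e \<in> U) \<noteq> (rf e \<in> U) then d e else 0) + 2 * (\<Sum>e\<in>gedges. q e)"
    unfolding sum.distrib sum_distrib_left ..
  also have "(\<Sum>e\<in>gedges. if (lf e \<in> U) \<noteq> (rf e \<in> U) then d e else 0) = (\<Sum>e\<in>{e\<in>gedges. (lf e \<in> U) \<noteq> (rf e \<in> U)}. d e)"
    by (rule sum.inter_filter[OF finite_G(2), symmetric])
  finally have 1: "even (\<Sum>e\<in>{e\<in>gedges. (lf e \<in> U) \<noteq> (rf e \<in> U)}. d e) \<longleftrightarrow> even (\<Sum>e\<in>gedges. u e * d e)" by simp
  have dA: "d (EA j l) = p j l + p (Suc j) l" and dB: "d (EB j l) = p j l + p (Suc j) (Suc l)"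
    and dR: "d (ER j l) = p j l + p j (Suc l)" for j l by (simp_all add: d_def p_def)
  let ?f = "\<lambda>e. u e * d e"
  have SA: "?S (\<lambda>j l. ?f (EA j l)) = ?S (\<lambda>j l. D j l * (p j l + p (Suc j) l) + F j l * (p j (Suc l) + p (Suc j) (Suc l)))"
  proof -
    have sh: "(\<Sum>l<L. F j ((l + L - 1) mod L) * (p j l + p (Suc j) l)) = (\<Sum>l<L. F j l * (p j (Suc l) + p (Suc j) (Suc l)))" for j
      by (rule sum_shift) (simp add: p_def)
    have "?S (\<lambda>j l. ?f (EA j l)) = (\<Sum>j<N. (\<Sum>l<L. D j l * (p j l + p (Suc j) l)) + (\<Sum>l<L. F j ((l + L - 1) mod L) * (p j l + p (Suc j) l)))"
      unfolding sum.distrib[symmetric] by (intro sum.cong refl) (simp only: u_def dA D_def F_def lf.simps rf.simps add_mult_distrib)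
    also have "\<dots> = (\<Sum>j<N. (\<Sum>l<L. D j l * (p j l + p (Suc j) l)) + (\<Sum>l<L. F j l * (p j (Suc l) + p (Suc j) (Suc l))))"
      unfolding sh ..
    finally show ?thesis by (simp only: sum.distrib)
  qed
  have SB: "?S (\<lambda>j l. ?f (EB j l)) = ?S (\<lambda>j l. D j l * (p j l + p (Suc j) (Suc l)) + F j l * (p j l + p (Suc j) (Suc l)))"
    by (intro sum.cong refl) (simp only: u_def dB D_def F_def lf.simps rf.simps add_mult_distrib)
  define SR where "SR = (\<Sum>j\<in>{1..<N}. \<Sum>l<L. ?f (ER j l))"
  define SN where "SN = (\<Sum>l\<in>Rep. ?f (ER N l))"
  have 2: "sum ?f gedges = ?S (\<lambda>j l. D j l * (p j l + p (Suc j) l) + F j l * (p j (Suc l) + p (Suc j) (Suc l)))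
    + ?S (\<lambda>j l. D j l * (p j l + p (Suc j) (Suc l)) + F j l * (p j l + p (Suc j) (Suc l))) + (SR + SN)"
    unfolding sum_gedges SA SB SR_def SN_def ..
  define X where "X = (\<Sum>l<L. D (N - 1) l * (p N l + p N (Suc l)))"
  define Y where "Y = (\<Sum>l<L. F 0 l * (p 0 l + p 0 (Suc l)))"
  have R1: "SR + X + Y = ?S (\<lambda>j l. D j l * (p (Suc j) l + p (Suc j) (Suc l)) + F j l * (p j l + p j (Suc l)))"
  proof -
    have a: "SR = (\<Sum>j\<in>{1..<N}. \<Sum>l<L. D (j - 1) l * (p j l + p j (Suc l))) + (\<Sum>j\<in>{1..<N}. \<Sum>l<L. F j l * (p j l + p j (Suc l)))"
      unfolding SR_def sum.distrib[symmetric] by (intro sum.cong refl) (simp add: u_def dR D_def F_def algebra_simps)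
    have b: "(\<Sum>j\<in>{1..<N}. \<Sum>l<L. D (j - 1) l * (p j l + p j (Suc l))) + X = (\<Sum>j<N. \<Sum>l<L. D j l * (p (Suc j) l + p (Suc j) (Suc l)))"
    proof -
      define G where "G i j = (\<Sum>l<L. D i l * (p j l + p j (Suc l)))" for i j
      have N1: "N = Suc (N - 1)" using N by simp
      have "(\<Sum>j\<in>{1..<N}. G (j - 1) j) = (\<Sum>j<N - 1. G j (Suc j))"
        by (rule sum.reindex_bij_witness[where i = Suc and j = "\<lambda>j. j - 1"]) (use N in auto)
      moreover have "(\<Sum>j<Suc (N - 1). G j (Suc j)) = (\<Sum>j<N - 1. G j (Suc j)) + G (N - 1) (Suc (N - 1))"
        by (rule sum.lessThan_Suc)
      ultimately show ?thesis unfolding X_def G_def[symmetric] N1[symmetric] by simp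
    qed
    have c: "(\<Sum>j\<in>{1..<N}. \<Sum>l<L. F j l * (p j l + p j (Suc l))) + Y = (\<Sum>j<N. \<Sum>l<L. F j l * (p j l + p j (Suc l)))"
    proof -
      have "{..<N} = insert 0 {1..<N}" using N by auto
      then show ?thesis unfolding Y_def by simp
    qed
    show ?thesis unfolding a sum.distrib using b c by simp
  qed
  have R2: "even X \<longleftrightarrow> even SN"
  proof (cases "k = 0")
    case True
    then have z: "p N l = p N 0" for l unfolding p_def vt_def kap_def by simp
    have "X = (\<Sum>l<L. D (N - 1) l * (p N 0 + p N 0))" unfolding X_def
    proof (rule sum.cong[OF refl])
      show "D (N - 1) l * (p N l + p N (Suc l)) = D (N - 1) l * (p N 0 + p N 0)" for l
        using z[of l] z[of "Suc l"] by simp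
    qed
    then have "even X" by (simp add: dvd_sum flip: mult_2)
    moreover have "Rep = {}" unfolding Rep_def using True by simp
    ultimately show ?thesis by (simp add: SN_def)
  next
    case False
    have e: "{..<L} = Rep \<union> (\<lambda>l. l + N) ` Rep" "Rep \<inter> (\<lambda>l. l + N) ` Rep = {}"
      using Rep_split False by auto
    have pN: "p N (l + N) = p N l" "p N (Suc (l + N)) = p N (Suc l)" if lR: "l \<in> Rep" for l
    proof -
      obtain a r where l: "l = 2 * N * a + r" "a < k" "r < N" using lR unfolding Rep_eq by auto
      show "p N (l + N) = p N l" "p N (Suc (l + N)) = p N (Suc l)"
        using vt_glue[OF l(2), of r] vt_glue[OF l(2), of "Suc r"] l(1,3) by (simp_all add: p_def)
    qed
    have "X = (\<Sum>l\<in>Rep. D (N - 1) l * (p N l + p N (Suc l))) + (\<Sum>l\<in>Rep. D (N - 1) (l + N) * (p N (l + N) + p N (Suc (l + N))))"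
      unfolding X_def e(1) using e(2) finite_G(4) by (subst sum.union_disjoint) (simp_all add: sum.reindex)
    also have "(\<Sum>l\<in>Rep. D (N - 1) (l + N) * (p N (l + N) + p N (Suc (l + N)))) = (\<Sum>l\<in>Rep. D (N - 1) (l + N) * (p N l + p N (Suc l)))"
      by (intro sum.cong refl) (simp add: pN)
    finally have "X = SN"
      unfolding SN_def sum.distrib[symmetric] by (simp add: u_def dR D_def algebra_simps)
    then show ?thesis by simp
  qed
  have Y: "even Y"
  proof -
    have z: "p 0 l = p 0 0" for l using vt_0[of l] by (simp add: p_def)
    have "Y = (\<Sum>l<L. F 0 l * (p 0 0 + p 0 0))" unfolding Y_def
    proof (rule sum.cong[OF refl])
      show "F 0 l * (p 0 l + p 0 (Suc l)) = F 0 l * (p 0 0 + p 0 0)" for l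
        using z[of l] z[of "Suc l"] by simp
    qed
    then show ?thesis by (simp add: dvd_sum flip: mult_2)
  qed
  have "sum ?f gedges + X + Y = SN +
     ?S (\<lambda>j l. 2 * (D j l * (p j l + p (Suc j) l + p (Suc j) (Suc l)) + F j l * (p j l + p j (Suc l) + p (Suc j) (Suc l))))"
  proof -
    have f1: "sum ?f gedges + X + Y = SN + (?S (\<lambda>j l. D j l * (p j l + p (Suc j) l) + F j l * (p j (Suc l) + p (Suc j) (Suc l)))
      + ?S (\<lambda>j l. D j l * (p j l + p (Suc j) (Suc l)) + F j l * (p j l + p (Suc j) (Suc l))) + (SR + X + Y))"
      unfolding 2 by linarith
    have e: "D j l * (p j l + p (Suc j) l) + F j l * (p j (Suc l) + p (Suc j) (Suc l))
        + (D j l * (p j l + p (Suc j) (Suc l)) + F j l * (p j l + p (Suc j) (Suc l)))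
        + (D j l * (p (Suc j) l + p (Suc j) (Suc l)) + F j l * (p j l + p j (Suc l)))
      = 2 * (D j l * (p j l + p (Suc j) l + p (Suc j) (Suc l)) + F j l * (p j l + p j (Suc l) + p (Suc j) (Suc l)))" for j l
      by (simp add: algebra_simps)
    show ?thesis using f1 unfolding R1 sum.distrib[symmetric] e .
  qed
  moreover have "even (?S (\<lambda>j l. 2 * (D j l * (p j l + p (Suc j) l + p (Suc j) (Suc l)) + F j l * (p j l + p j (Suc l) + p (Suc j) (Suc l)))))"
    by (intro dvd_sum dvd_triv_left)
  moreover have "even x" if "x + X + Y = SN + z" "even z" for x z
    using that R2 Y by (metis even_add)
  ultimately have "even (sum ?f gedges)" by blast
  then have "even (\<Sum>e\<in>{e\<in>gedges. (lf e \<in> U) \<noteq> (rf e \<in> U)}. d e)" using 1 by blast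
  then show ?thesis unfolding d_def .
qed

text \<open>Faces are linked across diagonals, then around a row across radial edges, then from row
  to row across ring edges.\<close>

lemma dual_connected:
  assumes U: "U \<subseteq> gfaces" "U \<noteq> {}" "\<forall>e\<in>gedges. lf e \<in> U \<longleftrightarrow> rf e \<in> U"
  shows "U = gfaces"
proof -
  have B: "(True, j, l) \<in> U \<longleftrightarrow> (False, j, l) \<in> U" if "j < N" "l < L" for j l
    using bspec[OF U(3) gedges_I(2)[OF that]] by simp
  have A: "(True, j, l) \<in> U \<longleftrightarrow> (True, j, 0) \<in> U" if "j < N" "l < L" for j l
    using that(2)
  proof (induction l)
    case (Suc l)
    have "(Suc l + L - 1) mod L = l" using Suc.prems by simp
    then have "(True, j, Suc l) \<in> U \<longleftrightarrow> (False, j, l) \<in> U"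
      using bspec[OF U(3) gedges_I(1)[OF that(1) Suc.prems]] by simp
    then show ?case using Suc B[OF that(1), of l] by simp
  qed simp
  have R: "(True, j, 0) \<in> U \<longleftrightarrow> (True, 0, 0) \<in> U" if "j < N" for j
    using that
  proof (induction j)
    case (Suc j)
    have "(True, j, 0) \<in> U \<longleftrightarrow> (False, Suc j, 0) \<in> U"
      using bspec[OF U(3) gedges_I(3)[of "Suc j" 0]] Suc.prems L_pos by simp
    then show ?case using Suc B[OF Suc.prems L_pos] by simp
  qed simp
  have all: "(c, j, l) \<in> U \<longleftrightarrow> (True, 0, 0) \<in> U" if "j < N" "l < L" for c j l
    using A[OF that] B[OF that] R[OF that(1)] by (cases c) simp_all
  obtain c j l where "(c, j, l) \<in> U" using U(2) by (metis all_not_in_conv prod_cases3)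
  moreover have "j < N" "l < L" using calculation U(1) by (auto simp: gfaces_def)
  ultimately have "(True, 0, 0) \<in> U" using all by blast
  then have "(c, j, l) \<in> U" if "j < N" "l < L" for c j l using all[OF that] by blast
  then show ?thesis using U(1) unfolding gfaces_def by force
qed

sublocale cells gverts gedges gfaces src tgt lf rf
proof
  show "src e \<in> gverts \<and> tgt e \<in> gverts" if "e \<in> gedges" for e
    using that by (cases rule: gedges_cases) (simp_all add: vt_gverts)
  show "lf e \<in> gfaces \<and> rf e \<in> gfaces" if "e \<in> gedges" for e
    using that
  proof (cases rule: gedges_cases)
    case (4 l)
    then show ?thesis using RepD[OF 4(2)] N by (simp add: gfaces_def)
  qed (use L_pos in \<open>simp_all add: gfaces_def\<close>)
qed (use finite_G even_boundary dual_connected in simp_all)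

text \<open>Radial edges lead from every vertex to the centre.\<close>

lemma conn_gverts: "conn gverts"
  unfolding conn_def
proof (intro conjI allI impI)
  fix W assume W: "W \<subseteq> gverts" "W \<noteq> {}" "\<forall>e\<in>gedges. src e \<in> gverts \<longrightarrow> tgt e \<in> gverts \<longrightarrow> (src e \<in> W \<longleftrightarrow> tgt e \<in> W)"
  have *: "vt j l \<in> W \<longleftrightarrow> vt 0 0 \<in> W" if "j \<le> N" for j l
    using that
  proof (induction j)
    case 0 then show ?case by (simp add: vt_def)
  next
    case (Suc j)
    have "vt j (l mod L) \<in> W \<longleftrightarrow> vt (Suc j) (l mod L) \<in> W"
      using bspec[OF W(3) gedges_I(1)[of j "l mod L"]] Suc.prems L_pos vt_gverts by simp
    then show ?case using Suc by simp
  qed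
  have GVE: "\<exists>j l. v = vt j l \<and> j \<le> N" if "v \<in> gverts" for v using that unfolding gverts_def by auto
  obtain v where "v \<in> W" using W(2) by blast
  then have "vt 0 0 \<in> W" using W(1) * GVE[of v] by blast
  then have "gverts \<subseteq> W" using * GVE by blast
  then show "W = gverts" using W(1) by blast
qed simp

section \<open>Corners of squares and the Euler characteristic\<close>

definition cor :: "nat \<times> nat \<Rightarrow> (nat \<times> nat) set" where
  "cor s = {vt (fst s) (snd s), vt (Suc (fst s)) (snd s), vt (fst s) (Suc (snd s)), vt (Suc (fst s)) (Suc (snd s))}"

lemma cor_gverts: "fst s < N \<Longrightarrow> cor s \<subseteq> gverts"
  by (simp add: cor_def vt_gverts)

text \<open>Two radial sides and the diagonal connect the four corners, also where a ring edge is
  collapsed.\<close>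

lemma cor_connected:
  assumes s: "fst s < N" "snd s < L" and C: "cor s \<subseteq> C"
    and W: "\<forall>e\<in>gedges. src e \<in> C \<longrightarrow> tgt e \<in> C \<longrightarrow> (src e \<in> W \<longleftrightarrow> tgt e \<in> W)"
    and v: "v \<in> cor s" "w \<in> cor s" "v \<in> W"
  shows "w \<in> W"
proof -
  obtain j l where jl: "s = (j, l)" by (cases s)
  have C': "vt j l \<in> C" "vt (Suc j) l \<in> C" "vt j (Suc l) \<in> C" "vt (Suc j) (Suc l) \<in> C"
    using C by (simp_all add: cor_def jl)
  have "vt j l \<in> W \<longleftrightarrow> vt (Suc j) l \<in> W"
    using bspec[OF W gedges_I(1)[of j l]] s C' by (simp add: jl)
  moreover have "vt j l \<in> W \<longleftrightarrow> vt (Suc j) (Suc l) \<in> W"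
    using bspec[OF W gedges_I(2)[of j l]] s C' by (simp add: jl)
  moreover have "vt j (Suc l) \<in> W \<longleftrightarrow> vt (Suc j) (Suc l) \<in> W"
    using bspec[OF W gedges_I(1)[of j "Suc l mod L"]] s L_pos C' by (simp add: jl)
  ultimately show ?thesis using v unfolding cor_def jl by auto
qed

lemma card_gverts: "card gverts = 1 + (N - 1) * L + (if k = 0 then 1 else 1 + k * (N - 1))"
proof -
  have gverts: "gverts = {(0, 0)} \<union> ({1..<N} \<times> {..<L} \<union> Pair N ` kap ` {..<L})"
  proof (intro set_eqI iffI)
    fix v assume "v \<in> gverts"
    then obtain j l where "v = vt j l" "j \<le> N" "l < L" unfolding gverts_def by auto
    then show "v \<in> {(0, 0)} \<union> ({1..<N} \<times> {..<L} \<union> Pair N ` kap ` {..<L})" by (auto simp: vt_def)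
  next
    fix v assume "v \<in> {(0, 0)} \<union> ({1..<N} \<times> {..<L} \<union> Pair N ` kap ` {..<L})"
    then consider "v = (0, 0)" | j l where "v = (j, l)" "1 \<le> j" "j < N" "l < L" | l where "v = (N, kap l)"
      by (auto simp: image_iff)
    then show "v \<in> gverts"
    proof cases
      case 1 then show ?thesis using vt_gverts[of 0 0] by (simp add: vt_def)
    next
      case (2 j l) then show ?thesis using vt_gverts[of j l] by (simp add: vt_def)
    next
      case (3 l) then show ?thesis using vt_gverts[of N l] N by (simp add: vt_def)
    qed
  qed
  have kap: "kap ` {..<L} = insert 0 ((\<lambda>(a, r). 2 * N * a + r) ` ({..<k} \<times> {1..<N}))"
  proof (intro set_eqI iffI)
    fix x assume "x \<in> kap ` {..<L}"
    then obtain l where l: "x = kap l" "l < L" by auto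
    show "x \<in> insert 0 ((\<lambda>(a, r). 2 * N * a + r) ` ({..<k} \<times> {1..<N}))"
    proof (cases "k = 0 \<or> l mod N = 0")
      case False
      then obtain a r where a: "l = 2 * N * a + r" "a < k" "r < 2 * N" using arc_decomp l(2) by blast
      then have "x = 2 * N * a + l mod N" using l False by (simp add: kap_def)
      moreover have "l mod N \<in> {1..<N}" using False N by simp
      ultimately show ?thesis using a(2) by auto
    qed (use l in \<open>simp add: kap_def\<close>)
  next
    fix x assume "x \<in> insert 0 ((\<lambda>(a, r). 2 * N * a + r) ` ({..<k} \<times> {1..<N}))"
    then consider "x = 0" | a r where "x = 2 * N * a + r" "a < k" "1 \<le> r" "r < N" by auto
    then show "x \<in> kap ` {..<L}"
    proof cases
      case 1 then show ?thesis using L_pos by (intro image_eqI[of _ _ 0]) (simp_all add: kap_def)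
    next
      case (2 a r)
      have "2 * N * Suc a \<le> 2 * N * k" by (rule mult_le_mono2) (use 2 in simp)
      then have "x < L" using 2 by (simp add: L_def algebra_simps)
      moreover have "x mod N = r" unfolding 2(1) using 2(4) by (metis mod_less mod_mult_self4 mult.commute mult.assoc)
      ultimately have "kap x = x" using 2 by (simp add: kap_def)
      then show ?thesis using \<open>x < L\<close> by (metis imageI lessThan_iff)
    qed
  qed
  have "inj_on (\<lambda>(a, r). 2 * N * a + r) ({..<k} \<times> {1..<N})" by (rule inj_on_subset[OF arc_inj]) auto
  then have "card (kap ` {..<L}) = 1 + k * (N - 1)" unfolding kap using N
    by (subst card_insert_disjoint) (auto simp: card_image)
  then have "card (Pair N ` kap ` {..<L}) = 1 + k * (N - 1)" by (subst card_image) (auto simp: inj_on_def)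
  moreover have "card ({1..<N} \<times> {..<L} \<union> Pair N ` kap ` {..<L}) = (N - 1) * L + card (Pair N ` kap ` {..<L})"
    by (subst card_Un_disjoint) (auto simp: card_cartesian_product)
  moreover have "card ({(0, 0)} \<union> ({1..<N} \<times> {..<L} \<union> Pair N ` kap ` {..<L})) = 1 + card ({1..<N} \<times> {..<L} \<union> Pair N ` kap ` {..<L})"
    using N by (subst card_Un_disjoint) auto
  ultimately show ?thesis unfolding gverts by simp
qed

lemma card_gedges: "card gedges = N * L + N * L + ((N - 1) * L + k * N)"
proof -
  have "card gedges = sum (\<lambda>_. 1) gedges" by simp
  also have "\<dots> = N * L + N * L + ((N - 1) * L + card Rep)" unfolding sum_gedges by simp
  finally show ?thesis unfolding card_Rep .
qed

text \<open>The centre contributes 1 and the boundary circle 1 + k (N - 1) - k N = 1 - k, which is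
  right for the collapsed boundary too; everything in between cancels.\<close>

lemma euler: "int (card gverts) - int (card gedges) + int (card gfaces) = 2 - int k"
proof -
  have T: "card gfaces = 2 * N * L" by (simp add: gfaces_def card_cartesian_product)
  obtain n where n: "N - 1 = n" "N = Suc n" using N by (cases N) auto
  show ?thesis unfolding card_gverts card_gedges T n(1)
    by (cases "k = 0") (simp_all add: n(2) algebra_simps)
qed

end

section \<open>The surfaces are Hausdorff\<close>

lemma polar_form: "\<exists>\<theta>. 0 \<le> \<theta> \<and> \<theta> < 2 * pi \<and> z = of_real (norm z) * cis \<theta>"
  using Arg2pi_ge_0[of z] Arg2pi_lt_2pi[of z] Arg2pi_eq[of z] by (auto simp: cis_conv_exp)

lemma nat_floor_bounds:
  assumes "0 \<le> x" shows "real (nat \<lfloor>x\<rfloor>) \<le> x" "x < real (nat \<lfloor>x\<rfloor>) + 1"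
  using assms by (auto simp: of_nat_nat)

text \<open>A boundary point that is no corner lies strictly inside a first or a second arc, and
  \<open>glue_rel_side\<close> applies to the point itself or to its partner.\<close>

lemma glue_rel_boundary:
  assumes k: "0 < k" and z: "norm z = 1"
  shows "z \<in> (\<lambda>i. cis (pi * real i / real k)) ` {..<2 * k} \<or>
    (\<forall>w. (z, w) \<in> glue_rel k \<longrightarrow> w = z \<or> (z, w) \<in> glue k \<or> (w, z) \<in> glue k)"
proof -
  obtain \<theta> where \<theta>: "0 \<le> \<theta>" "\<theta> < 2 * pi" "z = cis \<theta>" using polar_form[of z] z by auto
  define u where "u = k * \<theta> / pi"
  have u: "0 \<le> u" "u < 2 * real k" "\<theta> = pi * u / k" using \<theta> k by (auto simp: u_def field_simps)
  define i where "i = nat \<lfloor>u\<rfloor>"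
  have i: "real i \<le> u" "u < real i + 1" unfolding i_def using nat_floor_bounds[OF u(1)] by simp_all
  have ik: "i < 2 * k" using i(1) u(2) by linarith
  define c where "c = pi / real k"
  have c: "0 < c" "\<theta> = c * u" "pi / real k = c" "2 * pi * real a / real k = c * (2 * real a)" for a
    using k by (simp_all add: c_def u(3))
  have pu: "c * u < c * (real i + 1)" using i(2) c(1) by (intro mult_strict_left_mono)
  show ?thesis
  proof (cases "u = i")
    case True
    then show ?thesis using u(3) \<theta>(3) ik by auto
  next
    case False
    then have iu: "c * real i < c * u" using i(1) c(1) by (intro mult_strict_left_mono) simp_all
    have "w = z \<or> (z, w) \<in> glue k \<or> (w, z) \<in> glue k" if zw: "(z, w) \<in> glue_rel k" for w
    proof (cases "even i")
      case True
      then obtain a where a: "i = 2 * a" by (auto elim: evenE)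
      have ak: "a < k" using ik a by simp
      have b: "2 * pi * real a / real k < \<theta>" "\<theta> < 2 * pi * real a / real k + pi / real k"
        unfolding c(3,4) using iu pu unfolding c(2) a by (simp_all only: distrib_left of_nat_mult of_nat_numeral mult_1_right)
      then have "(cis \<theta>, cis (\<theta> + pi / k)) \<in> glue k" unfolding glue_def using k ak
        by (auto intro!: exI[of _ \<theta>] exI[of _ a])
      moreover have "w = cis \<theta> \<or> w = cis (\<theta> + pi / k)"
        by (rule glue_rel_side[OF _ ak b]) (use zw \<theta> in simp)
      ultimately show ?thesis using \<theta>(3) by auto
    next
      case False
      then obtain a where a: "i = 2 * a + 1" by (auto elim: oddE)
      have ak: "a < k" using ik a by simp
      define \<phi> where "\<phi> = \<theta> - pi / k"
      have b: "2 * pi * real a / real k < \<phi>" "\<phi> < 2 * pi * real a / real k + pi / real k"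
        unfolding \<phi>_def c(3,4) using iu pu unfolding c(2) a by (simp_all only: distrib_left of_nat_mult of_nat_add of_nat_numeral of_nat_1 mult_1_right)
      have "(cis \<phi>, cis (\<phi> + pi / k)) \<in> glue k" unfolding glue_def using k ak b
        by (auto intro!: exI[of _ \<phi>] exI[of _ a])
      then have g: "(cis \<phi>, z) \<in> glue k" by (simp add: \<phi>_def \<theta>(3))
      then have "w = cis \<phi> \<or> w = cis (\<phi> + pi / k)"
        by (intro glue_rel_side[OF _ ak b] glue_rel_trans[OF glue_rel_glue zw])
      then show ?thesis using g by (auto simp: \<phi>_def \<theta>(3))
    qed
    then show ?thesis by blast
  qed
qed

lemma compact_glue: "compact (glue k)"
proof (cases "k = 0")
  case True
  have "glue k = sphere 0 1 \<times> sphere 0 1" using True by (auto simp: glue_def)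
  then show ?thesis by (simp add: compact_Times)
next
  case False
  let ?I = "\<lambda>i. {2 * pi * real i / real k..2 * pi * real i / real k + pi / real k}"
  have "glue k = (\<Union>i<k. (\<lambda>\<theta>. (cis \<theta>, cis (\<theta> + pi / k))) ` ?I i)" 
  proof (intro set_eqI iffI)
    fix x assume "x \<in> glue k"
    then obtain \<theta> i where "x = (cis \<theta>, cis (\<theta> + pi / k))" "i < k" "\<theta> \<in> ?I i"
      using False unfolding glue_def by auto
    then show "x \<in> (\<Union>i<k. (\<lambda>\<theta>. (cis \<theta>, cis (\<theta> + pi / k))) ` ?I i)" by blast
  next
    fix x assume "x \<in> (\<Union>i<k. (\<lambda>\<theta>. (cis \<theta>, cis (\<theta> + pi / k))) ` ?I i)"
    then obtain \<theta> i where "x = (cis \<theta>, cis (\<theta> + pi / k))" "i < k" "\<theta> \<in> ?I i" by blast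
    then show "x \<in> glue k" using False unfolding glue_def by (simp only: if_False) force
  qed
  moreover have "compact (\<Union>i<k. (\<lambda>\<theta>. (cis \<theta>, cis (\<theta> + pi / k))) ` ?I i)"
    by (intro compact_UN finite_lessThan compact_continuous_image continuous_intros compact_Icc)
  ultimately show ?thesis by simp
qed

text \<open>To the diagonal and the direct gluings the generated equivalence adds only pairs of
  corners, which are finitely many. For k = 0 \<open>glue\<close> already contains all pairs of
  boundary points.\<close>

lemma compact_glue_rel: "compact (glue_rel k \<inter> disc \<times> disc)"
proof -
  define Co where "Co = (if k = 0 then {} else (\<lambda>i. cis (pi * real i / real k)) ` {..<2 * k})"
  have cG: "compact ((glue k)\<inverse>)"
  proof -
    have "(glue k)\<inverse> = prod.swap ` glue k" by force
    then show ?thesis using compact_continuous_image[OF continuous_on_swap compact_glue] by simp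
  qed
  have cD: "compact ((\<lambda>z. (z, z)) ` disc)"
    by (intro compact_continuous_image continuous_intros) (simp add: disc_def)
  have fin: "finite (glue_rel k \<inter> Co \<times> Co)"
  proof -
    have f: "finite Co" unfolding Co_def by (cases "k = 0") simp_all
    show ?thesis by (rule finite_subset[OF Int_lower2 finite_cartesian_product[OF f f]])
  qed
  have sub: "(z, w) \<in> (\<lambda>z. (z, z)) ` disc \<union> (glue k \<union> (glue k)\<inverse>) \<union> (glue_rel k \<inter> Co \<times> Co)"
    if zw: "(z, w) \<in> glue_rel k" "z \<in> disc" "w \<in> disc" for z w
  proof (cases "norm z < 1 \<or> norm w < 1")
    case True
    then have "w = z" using glue_rel_interior[OF zw(1)] glue_rel_interior[OF glue_rel_sym[OF zw(1)]] by metis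
    then show ?thesis using zw(2) by blast
  next
    case False
    then have n: "norm z = 1" "norm w = 1" using zw by (auto simp: disc_def)
    show ?thesis
    proof (cases "k = 0")
      case True
      then have "(z, w) \<in> glue k" using n unfolding glue_def by simp
      then show ?thesis by blast
    next
      case False
      then have k: "0 < k" by simp
      have "(z \<in> Co \<and> w \<in> Co) \<or> w = z \<or> (z, w) \<in> glue k \<or> (w, z) \<in> glue k"
        using glue_rel_boundary[OF k n(1)] glue_rel_boundary[OF k n(2)] zw(1) glue_rel_sym[OF zw(1)] False
        unfolding Co_def if_not_P[OF False] by blast
      then show ?thesis using zw by blast
    qed
  qed
  have "glue_rel k \<inter> disc \<times> disc = (\<lambda>z. (z, z)) ` disc \<union> (glue k \<union> (glue k)\<inverse>) \<union> (glue_rel k \<inter> Co \<times> Co)"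
  proof
    show "glue_rel k \<inter> disc \<times> disc \<subseteq> (\<lambda>z. (z, z)) ` disc \<union> (glue k \<union> (glue k)\<inverse>) \<union> (glue_rel k \<inter> Co \<times> Co)"
      using sub by blast
    have "Co \<subseteq> disc" unfolding Co_def disc_def by auto
    moreover have "glue k \<subseteq> disc \<times> disc"
    proof
      fix p assume p: "p \<in> glue k"
      obtain z w where zw: "p = (z, w)" by (cases p)
      then show "p \<in> disc \<times> disc" using glue_norm[of z w k] p by (simp add: disc_def)
    qed
    moreover have "glue k \<subseteq> glue_rel k" "(glue k)\<inverse> \<subseteq> glue_rel k" "(\<lambda>z. (z, z)) ` disc \<subseteq> glue_rel k"
      using glue_rel_glue glue_rel_sym glue_rel_refl by auto
    ultimately show "(\<lambda>z. (z, z)) ` disc \<union> (glue k \<union> (glue k)\<inverse>) \<union> (glue_rel k \<inter> Co \<times> Co) \<subseteq> glue_rel k \<inter> disc \<times> disc"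
      by blast
  qed
  then show ?thesis using cD compact_glue cG finite_imp_compact[OF fin] by (simp add: compact_Un)
qed

text \<open>The saturation of a closed set is the projection of a compact part of the relation,
  hence closed.\<close>

lemma closed_map_prj: "closed_map (top_of_set disc) (Nsurf k) (prj k)"
  unfolding closed_map_def
proof (intro allI impI)
  fix C assume C: "closedin (top_of_set disc) C"
  have cd: "compact disc" by (simp add: disc_def)
  have "compact C" "C \<subseteq> disc" using closedin_compact[OF cd C] closedin_subset[OF C] by simp_all
  have "{w \<in> disc. prj k w \<in> prj k ` C} = snd ` (glue_rel k \<inter> disc \<times> disc \<inter> C \<times> disc)"
  proof (intro set_eqI iffI)
    fix w assume "w \<in> {w \<in> disc. prj k w \<in> prj k ` C}"
    then obtain z where z: "w \<in> disc" "z \<in> C" "prj k z = prj k w" by auto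
    then have "(z, w) \<in> glue_rel k" by (simp only: prj_eq_iff)
    then have "(z, w) \<in> glue_rel k \<inter> disc \<times> disc \<inter> C \<times> disc" using z \<open>C \<subseteq> disc\<close> by blast
    then show "w \<in> snd ` (glue_rel k \<inter> disc \<times> disc \<inter> C \<times> disc)" by force
  next
    fix w assume "w \<in> snd ` (glue_rel k \<inter> disc \<times> disc \<inter> C \<times> disc)"
    then obtain z where z: "(z, w) \<in> glue_rel k" "z \<in> C" "w \<in> disc" by auto
    then have "prj k w = prj k z" by (simp only: prj_eq_iff glue_rel_sym)
    then show "w \<in> {w \<in> disc. prj k w \<in> prj k ` C}" using z by blast
  qed
  moreover have "compact (snd ` (glue_rel k \<inter> disc \<times> disc \<inter> C \<times> disc))"
    by (intro compact_continuous_image continuous_intros compact_Int compact_glue_rel compact_Times \<open>compact C\<close> cd)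
  ultimately have "closedin (top_of_set disc) {w \<in> disc. prj k w \<in> prj k ` C}"
    by (auto intro!: closed_subset compact_imp_closed)
  moreover have "prj k ` C \<subseteq> topspace (Nsurf k)" using \<open>C \<subseteq> disc\<close> unfolding topspace_Nsurf by blast
  ultimately show "closedin (Nsurf k) (prj k ` C)"
    using quotient_map_prj[of k] unfolding quotient_map_closedin by simp
qed

text \<open>Normality and closedness of points pass from the disc to its image under a closed
  continuous surjection.\<close>

lemma Hausdorff_Nsurf: "Hausdorff_space (Nsurf k)"
proof (rule normal_t1_imp_Hausdorff_space)
  have sur: "prj k ` topspace (top_of_set disc) = topspace (Nsurf k)" by (simp add: topspace_Nsurf)
  show "normal_space (Nsurf k)"
    by (rule normal_space_continuous_closed_map_image[OF _ continuous_map_prj closed_map_prj sur])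
      (intro metrizable_imp_normal_space metrizable_space_subtopology metrizable_space_euclidean)
  have "Hausdorff_space (top_of_set disc)" by (simp add: Hausdorff_space_subtopology)
  then show "t1_space (Nsurf k)"
    using t1_space_closed_map_image[OF closed_map_prj sur] t1_or_Hausdorff_space by blast
qed

text \<open>The product of the two preimages is compact and misses the closed relation, so it has
  positive distance from it. This serves in place of a metric on the surface.\<close>

lemma disjoint_closed_separated:
  assumes "closedin (Nsurf k) A" "closedin (Nsurf k) B" "A \<inter> B = {}"
  obtains d where "0 < d" "\<And>z w a b. z \<in> disc \<Longrightarrow> w \<in> disc \<Longrightarrow> prj k z \<in> A \<Longrightarrow> prj k w \<in> B \<Longrightarrow> a \<in> disc \<Longrightarrow> b \<in> disc
    \<Longrightarrow> (a, b) \<in> glue_rel k \<Longrightarrow> d \<le> dist z a + dist w b"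
proof -
  let ?A = "{z \<in> disc. prj k z \<in> A}" and ?B = "{z \<in> disc. prj k z \<in> B}"
  let ?R = "glue_rel k \<inter> disc \<times> disc"
  have cd: "compact disc" by (simp add: disc_def)
  have c: "compact {z \<in> disc. prj k z \<in> S}" if "closedin (Nsurf k) S" for S
  proof -
    have "closedin (top_of_set disc) {z \<in> topspace (top_of_set disc). prj k z \<in> S}"
      by (rule closedin_continuous_map_preimage[OF continuous_map_prj that])
    then show ?thesis using closedin_compact[OF cd] by simp
  qed
  have "?A \<times> ?B \<inter> ?R = {}"
  proof -
    have False if "z \<in> ?A" "w \<in> ?B" "(z, w) \<in> glue_rel k" for z w
    proof -
      have "prj k z = prj k w" using that(3) by (simp only: prj_eq_iff)
      then show False using that assms(3) by auto
    qed
    then show ?thesis by blast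
  qed
  from separate_compact_closed[OF compact_Times[OF c[OF assms(1)] c[OF assms(2)]] compact_imp_closed[OF compact_glue_rel] this]
  obtain d where d: "0 < d" "\<forall>x\<in>?A \<times> ?B. \<forall>y\<in>?R. d \<le> dist x y" by (elim exE conjE)
  show ?thesis
  proof (rule that[OF d(1)])
    fix z w a b assume h: "z \<in> disc" "w \<in> disc" "prj k z \<in> A" "prj k w \<in> B" "a \<in> disc" "b \<in> disc" "(a, b) \<in> glue_rel k"
    then have "d \<le> dist (z, w) (a, b)" using d(2) by blast
    also have "\<dots> \<le> dist z a + dist w b" unfolding dist_Pair_Pair by (rule sqrt_sum_squares_le_sum) simp_all
    finally show "d \<le> dist z a + dist w b" .
  qed
qed

section \<open>Neighbourhoods in the triangulation\<close>

lemma dist_cis: "norm (cis a - cis b) \<le> \<bar>a - b\<bar>"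
proof -
  have "cis a - cis b = cis b * (cis (a - b) - 1)" by (simp add: right_diff_distrib cis_mult)
  then have "cis a - cis b = cis b * (exp (\<i> * of_real (a - b)) - 1)" by (simp only: cis_conv_exp)
  then have "norm (cis a - cis b) = norm (exp (\<i> * of_real (a - b)) - 1)" by (simp only: norm_mult norm_cis mult_1)
  also have "\<dots> = 2 * \<bar>sin ((a - b) / 2)\<bar>" by (rule dist_exp_i_1)
  also have "\<dots> \<le> \<bar>a - b\<bar>" using abs_sin_x_le_abs_x[of "(a - b) / 2"] by simp
  finally show ?thesis .
qed

context grid
begin

definition sq :: "nat \<times> nat \<Rightarrow> complex set" where
  "sq s = (\<lambda>(r, \<theta>). of_real r * cis \<theta>) `
    ({real (fst s) / N..real (fst s + 1) / N} \<times> {2 * pi * real (snd s) / L..2 * pi * real (snd s + 1) / L})"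

text \<open>A vertex shared by all squares that contain z or a point glued to z.\<close>

definition rho :: "complex \<Rightarrow> nat \<times> nat" where
  "rho z = vt (nat \<lfloor>N * norm z\<rfloor>) (nat \<lfloor>L * Arg2pi z / (2 * pi)\<rfloor>)"

definition pt :: "nat \<Rightarrow> nat \<Rightarrow> complex" where
  "pt j l = of_real (real j / N) * cis (2 * pi * real l / L)"

lemma sqE:
  assumes "z \<in> sq s"
  obtains r \<theta> :: real where "z = of_real r * cis \<theta>" "real (fst s) \<le> N * r" "N * r \<le> real (fst s) + 1"
    "real (snd s) \<le> L * \<theta> / (2 * pi)" "L * \<theta> / (2 * pi) \<le> real (snd s) + 1" "0 \<le> r" "0 \<le> \<theta>" "norm z = r"
proof -
  obtain r \<theta> where z: "z = of_real r * cis \<theta>" "real (fst s) / N \<le> r" "r \<le> real (fst s + 1) / N"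
    "2 * pi * real (snd s) / L \<le> \<theta>" "\<theta> \<le> 2 * pi * real (snd s + 1) / L" using assms unfolding sq_def by auto
  have N0: "0 < real N" using N by simp
  have L0: "0 < real L" using L_pos by simp
  have r0: "0 \<le> r" using z(2) by (meson divide_nonneg_nonneg of_nat_0_le_iff order_trans)
  have t0: "0 \<le> \<theta>" using z(4) by (meson divide_nonneg_nonneg mult_nonneg_nonneg of_nat_0_le_iff order_trans pi_ge_zero zero_le_numeral)
  show ?thesis
  proof (rule that[OF z(1)])
    show "real (fst s) \<le> N * r" "N * r \<le> real (fst s) + 1" using z(2,3) N0 by (simp_all add: field_simps)
    show "real (snd s) \<le> L * \<theta> / (2 * pi)" "L * \<theta> / (2 * pi) \<le> real (snd s) + 1"
      using z(4,5) L0 by (simp_all add: field_simps)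
  qed (use r0 t0 z(1) in \<open>simp_all add: norm_mult\<close>)
qed

lemma sqI:
  fixes r \<theta> :: real
  assumes "real (fst s) \<le> N * r" "N * r \<le> real (fst s) + 1"
    "real (snd s) \<le> L * \<theta> / (2 * pi)" "L * \<theta> / (2 * pi) \<le> real (snd s) + 1"
  shows "of_real r * cis \<theta> \<in> sq s"
proof -
  have N0: "0 < real N" using N by simp
  have L0: "0 < real L" using L_pos by simp
  have "real (fst s) / N \<le> r" "r \<le> real (fst s + 1) / N" using assms(1,2) N0 by (simp_all add: field_simps)
  moreover have "2 * pi * real (snd s) / L \<le> \<theta>" "\<theta> \<le> 2 * pi * real (snd s + 1) / L"
    using assms(3,4) L0 by (simp_all add: field_simps)
  ultimately show ?thesis unfolding sq_def by (intro image_eqI[of _ _ "(r, \<theta>)"]) auto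
qed

lemma compact_sq: "compact (sq s)"
  unfolding sq_def case_prod_unfold
  by (intro compact_continuous_image continuous_intros compact_Times compact_Icc)

lemma sq_disc: "fst s < N \<Longrightarrow> sq s \<subseteq> disc"
proof
  fix z assume s: "fst s < N" "z \<in> sq s"
  obtain r \<theta> :: real where z: "N * r \<le> real (fst s) + 1" "norm z = r" by (rule sqE[OF s(2)])
  have "real (fst s) + 1 \<le> real N" using s(1) by linarith
  then have "real N * r \<le> real N * 1" using z(1) by linarith
  then have "r \<le> 1" by (rule mult_left_le_imp_le) (use N in simp)
  then show "z \<in> disc" using z(2) unfolding disc_def by simp
qed

lemma sq_cover:
  assumes "z \<in> disc"
  obtains s where "fst s < N" "snd s < L" "z \<in> sq s"
proof -
  obtain \<theta> where \<theta>: "0 \<le> \<theta>" "\<theta> < 2 * pi" "z = of_real (norm z) * cis \<theta>" using polar_form by blast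
  have L0: "0 < real L" using L_pos by simp
  define y where "y = N * norm z"
  define x where "x = L * \<theta> / (2 * pi)"
  have y: "0 \<le> y" "y \<le> N" using assms by (simp_all add: y_def disc_def mult_left_le)
  have x: "0 \<le> x" "x < L" using \<theta> L0 by (simp_all add: x_def field_simps)
  define j where "j = (if y = N then N - 1 else nat \<lfloor>y\<rfloor>)"
  have j: "real j \<le> y" "y \<le> real j + 1" "j < N"
    using nat_floor_bounds[OF y(1)] y(2) N unfolding j_def by (auto simp: of_nat_diff) 
  have l: "real (nat \<lfloor>x\<rfloor>) \<le> x" "x \<le> real (nat \<lfloor>x\<rfloor>) + 1" "nat \<lfloor>x\<rfloor> < L" 
    using nat_floor_bounds[OF x(1)] x(2) by linarith+
  have "of_real (norm z) * cis \<theta> \<in> sq (j, nat \<lfloor>x\<rfloor>)"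
    by (rule sqI) (use j l in \<open>simp_all add: y_def x_def\<close>)
  then show ?thesis using that[of "(j, nat \<lfloor>x\<rfloor>)"] j(3) l(3) \<theta>(3) by simp
qed

lemma rho_polar:
  fixes r \<theta> :: real
  assumes "0 < r" "0 \<le> \<theta>" "\<theta> \<le> 2 * pi"
  shows "rho (of_real r * cis \<theta>) = vt (nat \<lfloor>N * r\<rfloor>) (nat \<lfloor>L * \<theta> / (2 * pi)\<rfloor>)"
proof (cases "\<theta> = 2 * pi")
  case True
  have "Arg2pi (of_real r * cis \<theta>) = 0"
    by (rule Arg2pi_unique[of r]) (use assms True in simp_all)
  moreover have "L * \<theta> / (2 * pi) = real L" using True by simp
  moreover have "vt j L = vt j 0" for j by (rule vt_cong) simp
  ultimately show ?thesis using assms by (simp add: rho_def norm_mult)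
next
  case False
  have "Arg2pi (of_real r * cis \<theta>) = \<theta>"
    by (rule Arg2pi_unique[of r]) (use assms False in \<open>simp_all add: cis_conv_exp\<close>)
  then show ?thesis using assms by (simp add: rho_def norm_mult)
qed

lemma nat_floor_cases:
  assumes "real j \<le> x" "x \<le> real j + 1" shows "nat \<lfloor>x\<rfloor> = j \<or> nat \<lfloor>x\<rfloor> = Suc j"
  using assms by linarith

lemma rho_cor:
  assumes s: "fst s < N" "snd s < L" and z: "z \<in> sq s"
  shows "rho z \<in> cor s"
proof -
  obtain r \<theta> :: real where r: "z = of_real r * cis \<theta>" "real (fst s) \<le> N * r" "N * r \<le> real (fst s) + 1"
    "real (snd s) \<le> L * \<theta> / (2 * pi)" "L * \<theta> / (2 * pi) \<le> real (snd s) + 1" "0 \<le> r" "0 \<le> \<theta>" "norm z = r"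
    by (rule sqE[OF z])
  show ?thesis
  proof (cases "r = 0")
    case True
    then have "rho z = vt 0 (snd s)" using r(8) by (simp add: rho_def vt_0[of "snd s"] vt_0[of "nat _"])
    moreover have "fst s = 0" using True r(2) by simp
    ultimately show ?thesis by (simp add: cor_def)
  next
    case False
    have L0: "0 < real L" using L_pos by simp
    have "real (snd s) + 1 \<le> L" using s(2) by linarith
    then have "L * \<theta> / (2 * pi) \<le> L" using r(5) by linarith
    then have "\<theta> \<le> 2 * pi" using L0 by (simp add: field_simps)
    then have "rho z = vt (nat \<lfloor>N * r\<rfloor>) (nat \<lfloor>L * \<theta> / (2 * pi)\<rfloor>)"
      unfolding r(1) using rho_polar[of r \<theta>] False r(6,7) by simp
    then show ?thesis using nat_floor_cases[OF r(2,3)] nat_floor_cases[OF r(4,5)] unfolding cor_def by auto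
  qed
qed

text \<open>Rounding down commutes with the rotation by pi / k, as this is a shift by N steps of the
  grid.\<close>

lemma rho_glue:
  assumes "(a, b) \<in> glue k" shows "rho a = rho b"
proof (cases "k = 0")
  case True
  have "norm a = 1" "norm b = 1" using glue_norm[OF assms] by simp_all
  moreover have "kap l = 0" for l unfolding kap_def using True by simp
  ultimately show ?thesis using N by (simp add: rho_def vt_def)
next
  case False
  then obtain \<phi> i where ab: "a = cis \<phi>" "b = cis (\<phi> + pi / real k)" "i < k"
      "2 * pi * real i / real k \<le> \<phi>" "\<phi> \<le> 2 * pi * real i / real k + pi / real k"
    using assms by (auto simp: glue_def)
  have k0: "0 < real k" using False by simp
  have L: "real L = 2 * real k * real N" using False by (simp add: L_def)
  have \<phi>: "0 \<le> \<phi>" "\<phi> + pi / k \<le> 2 * pi"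
  proof -
    have "0 \<le> 2 * pi * real i / real k" by simp
    then show "0 \<le> \<phi>" using ab(4) by linarith
    have "real i + 1 \<le> real k" using ab(3) by linarith
    then have "pi * 2 * (real i + 1) \<le> pi * 2 * real k" by (intro mult_left_mono) simp_all
    then have "2 * pi * real i / real k + pi / real k + pi / real k \<le> 2 * pi"
      using k0 by (simp add: field_simps)
    then show "\<phi> + pi / k \<le> 2 * pi" using ab(5) by linarith
  qed
  define x where "x = L * \<phi> / (2 * pi)"
  have x: "real (2 * N * i) \<le> x" "x \<le> real (2 * N * i) + real N"
  proof -
    have "real L * (2 * pi * real i / real k) / (2 * pi) = real (2 * N * i)"
      "real L * (2 * pi * real i / real k + pi / real k) / (2 * pi) = real (2 * N * i) + real N"
      unfolding L using k0 by (simp_all add: field_simps)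
    moreover have "real L * (2 * pi * real i / real k) / (2 * pi) \<le> x"
      "x \<le> real L * (2 * pi * real i / real k + pi / real k) / (2 * pi)"
      unfolding x_def using ab(4,5) by (intro divide_right_mono mult_left_mono; simp)+
    ultimately show "real (2 * N * i) \<le> x" "x \<le> real (2 * N * i) + real N" by linarith+
  qed
  define r where "r = nat \<lfloor>x\<rfloor> - 2 * N * i"
  have r: "nat \<lfloor>x\<rfloor> = 2 * N * i + r" "r \<le> N" unfolding r_def using x by linarith+
  have xN: "L * (\<phi> + pi / k) / (2 * pi) = x + real N" unfolding x_def L using k0 by (simp add: field_simps)
  have "0 \<le> pi / k" by simp
  then have \<phi>2: "\<phi> \<le> 2 * pi" "0 \<le> \<phi> + pi / k" using \<phi> by linarith+
  have "0 \<le> x" using x(1) by (meson of_nat_0_le_iff order_trans)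
  then have fl: "nat \<lfloor>x + real N\<rfloor> = nat \<lfloor>x\<rfloor> + N" by (simp add: nat_add_distrib)
  have "rho a = vt N (2 * N * i + r)"
    using rho_polar[of 1 \<phi>] \<phi> \<phi>2 ab(1) r(1) by (simp add: x_def)
  moreover have "rho b = vt N (2 * N * i + r + N)"
    using rho_polar[of 1 "\<phi> + pi / k"] \<phi> \<phi>2 ab(2) r(1) by (simp only: xN fl of_real_1 mult_1 zero_less_one) simp
  ultimately show ?thesis using vt_glue[OF ab(3) r(2)] by simp
qed

lemma rho_rel: "(z, w) \<in> glue_rel k \<Longrightarrow> rho z = rho w"
  using glue_rel_invariant[of z w k "{x. rho x = rho z}"] rho_glue by auto

lemma pt_sq:
  assumes "j' = j \<or> j' = Suc j" "l' = l \<or> l' = Suc l"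
  shows "pt j' l' \<in> sq (j, l)"
proof -
  have "N * (real j' / N) = real j'" "L * (2 * pi * real l' / L) / (2 * pi) = real l'" using N L_pos by simp_all
  then show ?thesis unfolding pt_def by (intro sqI) (use assms in auto)
qed

lemma pt_mod: "pt j (l mod L) = pt j l"
proof -
  have "real l = real (l mod L) + real L * real (l div L)"
    by (metis mod_mult_div_eq of_nat_add of_nat_mult)
  then have "2 * pi * real l / L = 2 * pi * real (l mod L) / L + 2 * pi * real (l div L)"
    using L_pos by (simp add: field_simps)
  moreover have "cis (x + 2 * pi * real n) = cis x" for x n
    by (simp add: cis_mult[symmetric] cis_multiple_2pi)
  ultimately show ?thesis by (simp add: pt_def)
qed

lemma pt_glue:
  assumes "a < k" "r \<le> N" shows "(pt N (2 * N * a + r), pt N (2 * N * a + r + N)) \<in> glue_rel k"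
proof -
  have k0: "0 < real k" and N0: "0 < real N" using assms N by auto
  have L: "real L = 2 * real k * real N" using assms by (simp add: L_def)
  define \<theta> where "\<theta> = 2 * pi * real (2 * N * a + r) / L"
  have \<theta>: "\<theta> = 2 * pi * real a / k + pi / k * (real r / N)" unfolding \<theta>_def L using k0 N0 by (simp add: field_simps)
  have "0 \<le> pi / k * (real r / N)" by simp
  moreover have "pi / k * (real r / N) \<le> pi / k * 1" by (rule mult_left_mono) (use assms N0 in \<open>simp_all add: field_simps\<close>)
  ultimately have b: "2 * pi * real a / k \<le> \<theta>" "\<theta> \<le> 2 * pi * real a / k + pi / k" unfolding \<theta> by linarith+
  have "2 * pi * real (2 * N * a + r + N) / L = \<theta> + pi / k" unfolding \<theta>_def L using k0 N0 by (simp add: field_simps)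
  then have p: "pt N (2 * N * a + r) = cis \<theta>" "pt N (2 * N * a + r + N) = cis (\<theta> + pi / k)"
    using N0 by (simp_all only: pt_def \<theta>_def) simp_all
  show ?thesis unfolding p
    by (rule glue_rel_glue) (use b assms in \<open>auto simp: glue_def\<close>)
qed

lemma pt_corner: "0 < k \<Longrightarrow> c \<le> 2 * k \<Longrightarrow> (pt N 0, pt N (c * N)) \<in> glue_rel k"
proof (induction c)
  case 0 then show ?case by (simp add: glue_rel_refl)
next
  case (Suc c)
  have "(pt N (c * N), pt N (Suc c * N)) \<in> glue_rel k"
  proof (cases "even c")
    case True
    then obtain a where a: "c = 2 * a" by (auto elim: evenE)
    show ?thesis using pt_glue[of a 0] Suc.prems by (simp add: a algebra_simps)
  next
    case False
    then obtain a where a: "c = 2 * a + 1" by (auto elim: oddE)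
    show ?thesis using pt_glue[of a N] Suc.prems by (simp add: a algebra_simps)
  qed
  then show ?case using Suc glue_rel_trans by simp
qed

lemma pt_kap: "(pt N l, pt N (kap l)) \<in> glue_rel k"
proof (cases "k = 0")
  case True
  have "norm (pt N i) = 1" for i using N by (simp add: pt_def norm_mult)
  then show ?thesis using True by (intro glue_rel_glue) (simp add: glue_def)
next
  case False
  then have k: "0 < k" by simp
  define i where "i = l mod L"
  have "i < L" unfolding i_def using L_pos by simp
  then obtain a r where i: "i = 2 * N * a + r" "a < k" "r < 2 * N" using arc_decomp k by blast
  have "(pt N i, pt N (kap i)) \<in> glue_rel k"
  proof (cases "i mod N = 0")
    case True
    then obtain c where "i = N * c" by (auto elim: dvdE simp: mod_eq_0_iff_dvd)
    then have c: "i = c * N" by simp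
    have "c * N < (2 * k) * N" using \<open>i < L\<close> k unfolding c L_def by simp
    then have "c < 2 * k" by simp
    then show ?thesis using pt_corner[OF k, of c] True c glue_rel_sym by (simp add: kap_def)
  next
    case False
    have m: "i mod N = r mod N" unfolding i(1) by (metis mod_mult_self4 mult.commute mult.assoc)
    have "i mod L = i" "i div (2 * N) = a" using \<open>i < L\<close> i N by simp_all
    then have kp: "kap i = 2 * N * a + r mod N" using False k m by (simp add: kap_def)
    show ?thesis
    proof (cases "r < N")
      case True
      then show ?thesis using kp i(1) by (simp add: glue_rel_refl)
    next
      case False
      then have "r mod N = r - N" using i(3) by (simp add: mod_if)
      moreover have "i = 2 * N * a + (r - N) + N" using False i(1) by simp
      ultimately show ?thesis using pt_glue[OF i(2), of "r - N"] i(3) kp glue_rel_sym by simp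
    qed
  qed
  then show ?thesis unfolding i_def pt_mod kap_mod .
qed

text \<open>The vertices of the triangulation are no coarser than the gluing: two squares with a
  common vertex contain glued points, which is how distances are compared in
  \<open>nb_disjoint\<close>.\<close>

lemma vt_pt:
  assumes "j \<le> N" "j' \<le> N" "vt j l = vt j' l'"
  shows "(pt j l, pt j' l') \<in> glue_rel k"
proof -
  have jj: "j = j'" using assms(3) N by (auto simp: vt_def split: if_splits)
  consider "j = 0" | "j = N" "kap l = kap l'" | "l mod L = l' mod L"
    using assms(3) N unfolding jj by (auto simp: vt_def split: if_splits)
  then show ?thesis
  proof cases
    case 1 then show ?thesis using jj by (simp add: pt_def glue_rel_refl)
  next
    case 2
    have "(pt N (kap l'), pt N l') \<in> glue_rel k" by (rule glue_rel_sym[OF pt_kap])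
    then show ?thesis using pt_kap[of l] 2 jj glue_rel_trans by metis
  next
    case 3
    then have "pt j l = pt j' l'" using pt_mod[of j l] pt_mod[of j' l'] jj by simp
    then show ?thesis by (simp add: glue_rel_refl)
  qed
qed

text \<open>The radius contributes at most 1 / N and the angle at most 2 pi / L, which is at most 8
  / N.\<close>

lemma sq_diam:
  assumes "fst s < N" "z \<in> sq s" "w \<in> sq s" shows "dist z w \<le> 9 / N"
proof -
  obtain r \<theta> :: real where z: "z = of_real r * cis \<theta>" "real (fst s) \<le> N * r" "N * r \<le> real (fst s) + 1"
    "real (snd s) \<le> L * \<theta> / (2 * pi)" "L * \<theta> / (2 * pi) \<le> real (snd s) + 1" "0 \<le> r" by (rule sqE[OF assms(2)])
  obtain q \<phi> :: real where w: "w = of_real q * cis \<phi>" "real (fst s) \<le> N * q" "N * q \<le> real (fst s) + 1"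
    "real (snd s) \<le> L * \<phi> / (2 * pi)" "L * \<phi> / (2 * pi) \<le> real (snd s) + 1" "0 \<le> q" "norm w = q" by (rule sqE[OF assms(3)])
  have N0: "0 < real N" using N by simp
  have L0: "0 < real L" using L_pos by simp
  have q1: "q \<le> 1" using sq_disc[OF assms(1)] assms(3) w(7) by (auto simp: disc_def)
  have "N \<le> L" unfolding L_def using N by (cases "k = 0") simp_all
  then have LN: "1 / real L \<le> 1 / real N" using N0 L0 by (simp add: field_simps)
  have "real N * \<bar>r - q\<bar> \<le> 1" using z(2,3) w(2,3) by (simp add: abs_if algebra_simps)
  then have rq: "\<bar>r - q\<bar> \<le> 1 / N" using N0 by (simp add: field_simps)
  have "\<bar>L * \<theta> / (2 * pi) - L * \<phi> / (2 * pi)\<bar> \<le> 1" using z(4,5) w(4,5) by linarith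
  moreover have "L * \<theta> / (2 * pi) - L * \<phi> / (2 * pi) = (L / (2 * pi)) * (\<theta> - \<phi>)" by (simp add: field_simps)
  ultimately have "(L / (2 * pi)) * \<bar>\<theta> - \<phi>\<bar> \<le> 1" using L0 by (simp add: abs_mult)
  then have "\<bar>\<theta> - \<phi>\<bar> \<le> 2 * pi * (1 / L)" using L0 by (simp add: field_simps)
  also have "\<dots> \<le> 8 * (1 / N)" using LN pi_less_4 L0 by (intro mult_mono) simp_all
  finally have tp: "\<bar>\<theta> - \<phi>\<bar> \<le> 8 * (1 / N)" .
  have "z - w = of_real (r - q) * cis \<theta> + of_real q * (cis \<theta> - cis \<phi>)" by (simp add: z(1) w(1) algebra_simps)
  then have "norm (z - w) \<le> norm (of_real (r - q) * cis \<theta>) + norm (of_real q * (cis \<theta> - cis \<phi>))"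
    by (simp only: norm_triangle_ineq)
  also have "\<dots> = \<bar>r - q\<bar> + q * norm (cis \<theta> - cis \<phi>)" using w(6) by (simp add: norm_mult del: of_real_diff)
  also have "\<dots> \<le> 1 / N + 1 * (8 * (1 / N))"
    using rq q1 w(6) order_trans[OF dist_cis tp] by (intro add_mono mult_mono) simp_all
  finally show ?thesis by (simp add: dist_norm)
qed

definition nb :: "complex set set \<Rightarrow> (nat \<times> nat) set" where
  "nb A = {v. \<exists>s. fst s < N \<and> snd s < L \<and> v \<in> cor s \<and> prj k ` sq s \<inter> A \<noteq> {}}"

lemma nb_gverts: "nb A \<subseteq> gverts"
  unfolding nb_def using cor_gverts by blast

lemma nbI:
  assumes "fst s < N" "snd s < L" "z \<in> sq s" "prj k z \<in> A" shows "cor s \<subseteq> nb A"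
proof -
  have "prj k ` sq s \<inter> A \<noteq> {}" using assms(3,4) by blast
  then show ?thesis unfolding nb_def using assms(1,2) by blast
qed

lemma rho_nb:
  assumes "z \<in> disc" "prj k z \<in> A" shows "rho z \<in> nb A"
proof -
  obtain s where s: "fst s < N" "snd s < L" "z \<in> sq s" by (rule sq_cover[OF assms(1)])
  then show ?thesis using nbI[OF s assms(2)] rho_cor[OF s] by blast
qed

lemma nb_meet:
  assumes "A \<inter> B \<noteq> {}" "A \<subseteq> topspace (Nsurf k)" shows "nb A \<inter> nb B \<noteq> {}"
proof -
  obtain x where x: "x \<in> A" "x \<in> B" using assms(1) by blast
  then obtain z where "z \<in> disc" "x = prj k z" using assms(2) unfolding topspace_Nsurf by blast
  then show ?thesis using rho_nb[of z A] rho_nb[of z B] x by blast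
qed

text \<open>By \<open>cor_connected\<close> a square meeting \<open>A\<close> has all its corners in
  \<open>W\<close> or none. The two families of squares give closed sets covering \<open>A\<close>,
  and these are disjoint within \<open>A\<close>, because all squares over a point share the vertex
  \<open>rho\<close>. Connectedness of \<open>A\<close> leaves only the family of
  \<open>W\<close>.\<close>

lemma conn_nb:
  assumes A: "connectedin (Nsurf k) A" shows "conn (nb A)"
  unfolding conn_def
proof (intro conjI allI impI)
  show "nb A \<subseteq> gverts" by (rule nb_gverts)
  fix W assume W: "W \<subseteq> nb A" "W \<noteq> {}" "\<forall>e\<in>gedges. src e \<in> nb A \<longrightarrow> tgt e \<in> nb A \<longrightarrow> (src e \<in> W \<longleftrightarrow> tgt e \<in> W)"
  have AX: "A \<subseteq> topspace (Nsurf k)" by (rule connectedin_subset_topspace[OF A])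
  define Sq where "Sq = {s. fst s < N \<and> snd s < L}"
  have "Sq \<subseteq> {..<N} \<times> {..<L}" unfolding Sq_def by (auto simp: mem_Times_iff)
  then have finSq: "finite Sq" by (rule finite_subset) simp
  define C where "C P = prj k ` \<Union>(sq ` {s \<in> Sq. P (cor s \<subseteq> W)})" for P
  have closed: "closedin (Nsurf k) (C P)" for P
  proof -
    have f: "finite {s \<in> Sq. P (cor s \<subseteq> W)}" using finSq by simp
    have "compact (\<Union>(sq ` {s \<in> Sq. P (cor s \<subseteq> W)}))" by (intro compact_UN f compact_sq)
    moreover have "\<Union>(sq ` {s \<in> Sq. P (cor s \<subseteq> W)}) \<subseteq> disc" using sq_disc unfolding Sq_def by blast
    ultimately have "closedin (top_of_set disc) (\<Union>(sq ` {s \<in> Sq. P (cor s \<subseteq> W)}))"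
      by (intro closed_subset compact_imp_closed)
    then show ?thesis using closed_map_prj[of k] unfolding C_def closed_map_def by blast
  qed
  have all: "w \<in> W" if s: "s \<in> Sq" "z \<in> sq s" "prj k z \<in> A" "v \<in> cor s" "v \<in> W" "w \<in> cor s" for s z v w
  proof -
    have s': "fst s < N" "snd s < L" using s(1) by (simp_all add: Sq_def)
    show ?thesis by (rule cor_connected[OF s' nbI[OF s' s(2,3)] W(3) s(4,6,5)])
  qed
  have "A \<subseteq> C (\<lambda>b. b) \<union> C Not"
  proof
    fix x assume "x \<in> A"
    then obtain z where z: "z \<in> disc" "x = prj k z" using AX unfolding topspace_Nsurf by blast
    obtain s where s: "fst s < N" "snd s < L" "z \<in> sq s" by (rule sq_cover[OF z(1)])
    then show "x \<in> C (\<lambda>b. b) \<union> C Not" unfolding C_def Sq_def z(2) by blast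
  qed
  moreover have "C (\<lambda>b. b) \<inter> C Not \<inter> A = {}"
  proof -
    have False if x: "x \<in> C (\<lambda>b. b)" "x \<in> C Not" "x \<in> A" for x
    proof -
      obtain s z where z: "s \<in> Sq" "cor s \<subseteq> W" "z \<in> sq s" "x = prj k z" using x(1) unfolding C_def by blast
      obtain t w where w: "t \<in> Sq" "\<not> cor t \<subseteq> W" "w \<in> sq t" "x = prj k w" using x(2) unfolding C_def by blast
      have "prj k z = prj k w" using z(4) w(4) by simp
      then have "rho z = rho w" unfolding prj_eq_iff by (rule rho_rel)
      moreover have "rho z \<in> cor s" "rho w \<in> cor t" using z w rho_cor unfolding Sq_def by blast+
      ultimately have "rho w \<in> cor t" "rho w \<in> W" using z(2) by auto
      then have "cor t \<subseteq> W" using all[OF w(1,3)] x(3) w(4) by blast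
      then show False using w(2) by blast
    qed
    then show ?thesis by blast
  qed
  ultimately have or: "C (\<lambda>b. b) \<inter> A = {} \<or> C Not \<inter> A = {}"
    using A closed unfolding connectedin_closedin by metis
  obtain v where v: "v \<in> W" using W(2) by blast
  then obtain s z where s: "s \<in> Sq" "v \<in> cor s" "z \<in> sq s" "prj k z \<in> A" using W(1) unfolding nb_def Sq_def by blast
  then have "cor s \<subseteq> W" using all[OF s(1,3,4,2) v] by blast
  then have "prj k z \<in> C (\<lambda>b. b)" using s unfolding C_def by blast
  then have no: "C Not \<inter> A = {}" using or s(4) by blast
  have "nb A \<subseteq> W"
  proof
    fix w assume "w \<in> nb A"
    then obtain t y where t: "t \<in> Sq" "w \<in> cor t" "y \<in> sq t" "prj k y \<in> A" unfolding nb_def Sq_def by blast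
    have "cor t \<subseteq> W"
    proof (rule ccontr)
      assume "\<not> cor t \<subseteq> W"
      then have "prj k y \<in> C Not" using t unfolding C_def by blast
      then show False using no t(4) by blast
    qed
    then show "w \<in> W" using t(2) by blast
  qed
  then show "W = nb A" using W(1) by blast
qed

text \<open>A common vertex would give glued points in a square meeting \<open>A\<close> and a
  square meeting \<open>B\<close>; both have diameter at most 9 / N, together 18 / N.\<close>

lemma nb_disjoint:
  assumes sep: "\<And>z w a b. z \<in> disc \<Longrightarrow> w \<in> disc \<Longrightarrow> prj k z \<in> A \<Longrightarrow> prj k w \<in> B \<Longrightarrow> a \<in> disc \<Longrightarrow> b \<in> disc
    \<Longrightarrow> (a, b) \<in> glue_rel k \<Longrightarrow> d \<le> dist z a + dist w b" and d: "18 / N < d"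
  shows "nb A \<inter> nb B = {}"
proof -
  have cpt: "\<exists>j l. v = vt j l \<and> j \<le> N \<and> pt j l \<in> sq s" if "v \<in> cor s" "fst s < N" for v s
  proof -
    have p: "pt j l \<in> sq s" if "j = fst s \<or> j = Suc (fst s)" "l = snd s \<or> l = Suc (snd s)" for j l
      using pt_sq[OF that] by simp
    have "fst s \<le> N" "Suc (fst s) \<le> N" using that(2) by simp_all
    then show ?thesis using that(1) p unfolding cor_def by blast
  qed
  have False if v: "v \<in> nb A" "v \<in> nb B" for v
  proof -
    obtain s z where s: "fst s < N" "v \<in> cor s" "z \<in> sq s" "prj k z \<in> A" using v(1) unfolding nb_def by blast
    obtain t w where t: "fst t < N" "v \<in> cor t" "w \<in> sq t" "prj k w \<in> B" using v(2) unfolding nb_def by blast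
    obtain j l where jl: "v = vt j l" "j \<le> N" "pt j l \<in> sq s" using cpt[OF s(2,1)] by blast
    obtain j' l' where jl': "v = vt j' l'" "j' \<le> N" "pt j' l' \<in> sq t" using cpt[OF t(2,1)] by blast
    have "(pt j l, pt j' l') \<in> glue_rel k" by (rule vt_pt[OF jl(2) jl'(2)]) (use jl(1) jl'(1) in simp)
    then have "d \<le> dist z (pt j l) + dist w (pt j' l')"
      using sep s t jl(3) jl'(3) sq_disc by blast
    moreover have "dist z (pt j l) \<le> 9 / N" "dist w (pt j' l') \<le> 9 / N"
      using sq_diam s t jl(3) jl'(3) by blast+
    ultimately show False using d by simp
  qed
  then show ?thesis by blast
qed

end

lemma eventually_nb_disjoint:
  assumes "closedin (Nsurf k) A" "closedin (Nsurf k) B" "A \<inter> B = {}"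
  shows "eventually (\<lambda>N. grid.nb k N A \<inter> grid.nb k N B = {}) sequentially"
proof -
  obtain d where d: "0 < d" "\<And>z w a b. z \<in> disc \<Longrightarrow> w \<in> disc \<Longrightarrow> prj k z \<in> A \<Longrightarrow> prj k w \<in> B \<Longrightarrow> a \<in> disc \<Longrightarrow> b \<in> disc
    \<Longrightarrow> (a, b) \<in> glue_rel k \<Longrightarrow> d \<le> dist z a + dist w b" by (rule disjoint_closed_separated[OF assms]) blast
  have "(\<lambda>N. 18 * (1 / real N)) \<longlonglongrightarrow> 18 * 0" by (intro tendsto_mult tendsto_const lim_1_over_n)
  then have "eventually (\<lambda>N. 18 * (1 / real N) < d) sequentially" by (rule order_tendstoD(2)) (use d(1) in simp)
  moreover have "eventually (\<lambda>N. 2 \<le> N) sequentially" by (rule eventually_ge_at_top)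
  ultimately show ?thesis
  proof eventually_elim
    case (elim N)
    then interpret grid k N by unfold_locales
    show ?case by (rule nb_disjoint[where d = d, OF d(2)]) (use elim in simp_all)
  qed
qed

section \<open>The lower bound\<close>

lemma compactin_arc:
  assumes "continuous_map (top_of_set {0..1}) X \<gamma>" "compact I" "I \<subseteq> {0..1 :: real}"
  shows "compactin X (\<gamma> ` I)"
proof (rule image_compactin[OF _ assms(1)])
  show "compactin (top_of_set {0..1}) I" using assms(2,3) by (simp add: compactin_subtopology)
qed

lemma connectedin_arc:
  assumes "continuous_map (top_of_set {0..1}) X \<gamma>" "connected I" "I \<subseteq> {0..1 :: real}"
  shows "connectedin X (\<gamma> ` I)"
proof (rule connectedin_continuous_map_image[OF assms(1)])
  show "connectedin (top_of_set {0..1}) I" using assms(2,3) by (simp add: connectedin_subtopology)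
qed

text \<open>A vertex becomes the star \<open>S x\<close> of the adjoining outer thirds of its edges,
  an edge its middle third \<open>M e\<close>. Among these sets only a middle third and the stars at
  its two ends meet. All are compact, hence closed in the Hausdorff space, so the remaining pairs
  have disjoint neighbourhoods in a fine triangulation.\<close>

theorem embedding_bound:
  assumes d: "drawing (Nsurf k) (X \<union> Y) K p \<gamma>" and nc: "crossings K \<gamma> = {}"
    and K: "K \<subseteq> X \<times> Y" "X \<inter> Y = {}" "finite X" "finite Y" "2 \<le> card K"
  shows "2 * (2 - int k - int (card (X \<union> Y)) + int (card K)) \<le> int (card K)"
proof -
  define V where "V = X \<union> Y"
  have finV: "finite V" using K by (simp add: V_def)
  have finK: "finite K" using K finite_subset by blast
  have KV: "fst e \<in> V" "snd e \<in> V" if "e \<in> K" for e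
    using subsetD[OF K(1) that] by (auto simp: V_def mem_Times_iff)
  have d1: "p ` V \<subseteq> topspace (Nsurf k)" "inj_on p V" using d unfolding drawing_def V_def by blast+
  have d2: "continuous_map (top_of_set {0..1}) (Nsurf k) (\<gamma> e)" "\<gamma> e 0 = p (fst e)" "\<gamma> e 1 = p (snd e)"
      if "e \<in> K" for e
    using d that unfolding drawing_def V_def by blast+
  have d3: "\<gamma> e t \<noteq> p x" if "e \<in> K" "0 < t" "t < 1" "x \<in> V" for e t x
    using d that unfolding drawing_def V_def by blast
  have d4: "e = f \<and> s = t" if "e \<in> K" "f \<in> K" "0 < s" "s < 1" "0 < t" "t < 1" "\<gamma> e s = \<gamma> f t" for e f s t
  proof (rule ccontr)
    assume "\<not> ?thesis"
    then have "GE e s \<noteq> GE f t" by simp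
    then have "{GE e s, GE f t} \<in> crossings K \<gamma>" using that unfolding crossings_def by blast
    then show False using nc by simp
  qed
  \<comment> \<open>Without crossings the realisation of the whole graph is injective, so
    disjointness on the surface can be read off from the sets \<open>S'\<close> and
    \<open>M'\<close> in the abstract graph.\<close>
  have inj: "g = h" if g: "g \<in> gpoints V K" "h \<in> gpoints V K" "realize p \<gamma> g = realize p \<gamma> h" for g h
  proof -
    have gc: "(\<exists>x\<in>V. g = GV x) \<or> (\<exists>e s. g = GE e s \<and> e \<in> K \<and> 0 < s \<and> s < 1)" if "g \<in> gpoints V K" for g
      using that unfolding gpoints_def by blast
    from gc[OF g(1)] gc[OF g(2)] show ?thesis
    proof (elim disjE exE bexE conjE)
      fix x y assume "x \<in> V" "y \<in> V" "g = GV x" "h = GV y"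
      then show ?thesis using g(3) d1(2) by (simp add: inj_on_eq_iff)
    next
      fix x e s assume "x \<in> V" "g = GV x" "h = GE e s" "e \<in> K" "0 < s" "s < 1"
      then show ?thesis using g(3) d3[of e s x] by simp
    next
      fix x e s assume "x \<in> V" "h = GV x" "g = GE e s" "e \<in> K" "0 < s" "s < 1"
      then show ?thesis using g(3) d3[of e s x] by simp
    next
      fix e s f t assume "g = GE e s" "e \<in> K" "0 < s" "s < 1" "h = GE f t" "f \<in> K" "0 < t" "t < 1"
      then show ?thesis using g(3) d4[of e f s t] by simp
    qed
  qed
  define F where "F x = insert {p x} ((\<lambda>e. \<gamma> e ` {0..1/3}) ` {e \<in> K. fst e = x} \<union> (\<lambda>e. \<gamma> e ` {2/3..1}) ` {e \<in> K. snd e = x})" for x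
  define S where "S x = \<Union>(F x)" for x
  define M where "M e = \<gamma> e ` {1/3..2/3}" for e
  define S' where "S' x = insert (GV x) {GE e s | e s. e \<in> K \<and> (fst e = x \<and> 0 < s \<and> s \<le> 1/3 \<or> snd e = x \<and> 2/3 \<le> s \<and> s < 1)}" for x
  define M' where "M' e = {GE e s | s. 1/3 \<le> s \<and> s \<le> 2/3}" for e :: "'a \<times> 'a"
  have F: "connectedin (Nsurf k) C \<and> compactin (Nsurf k) C \<and> p x \<in> C \<and> C \<subseteq> realize p \<gamma> ` S' x"
    if x: "x \<in> V" and C: "C \<in> F x" for x C
  proof -
    from C consider "C = {p x}" | e where "e \<in> K" "fst e = x" "C = \<gamma> e ` {0..1/3}"
      | e where "e \<in> K" "snd e = x" "C = \<gamma> e ` {2/3..1}" unfolding F_def by blast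
    then show ?thesis
    proof cases
      case 1
      have t: "p x \<in> topspace (Nsurf k)" using d1(1) x by blast
      have "p x = realize p \<gamma> (GV x)" "GV x \<in> S' x" by (simp_all add: S'_def)
      then have "p x \<in> realize p \<gamma> ` S' x" by (rule image_eqI)
      then show ?thesis unfolding 1 using t by (simp only: connectedin_sing compactin_sing singletonI insert_subset empty_subsetI simp_thms)
    next
      case (2 e)
      have "\<gamma> e t \<in> realize p \<gamma> ` S' x" if "t \<in> {0..1/3}" for t
      proof (cases "t = 0")
        case True
        then have "\<gamma> e t = realize p \<gamma> (GV x)" using d2(2)[OF 2(1)] 2(2) by simp
        then show ?thesis unfolding S'_def by blast
      next
        case False
        then have "0 < t" "t \<le> 1/3" using that by simp_all
        then have "GE e t \<in> S' x" using 2(1,2) unfolding S'_def by blast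
        moreover have "\<gamma> e t = realize p \<gamma> (GE e t)" by simp
        ultimately show ?thesis by blast
      qed
      moreover have "p x \<in> C" using d2(2)[OF 2(1)] 2(2) unfolding 2(3) by (intro image_eqI[of _ _ 0]) simp_all
      moreover have "connectedin (Nsurf k) C" unfolding 2(3) by (rule connectedin_arc[OF d2(1)[OF 2(1)]]) simp_all
      moreover have "compactin (Nsurf k) C" unfolding 2(3) by (rule compactin_arc[OF d2(1)[OF 2(1)]]) simp_all
      ultimately show ?thesis unfolding 2(3) by blast
    next
      case (3 e)
      have "\<gamma> e t \<in> realize p \<gamma> ` S' x" if "t \<in> {2/3..1}" for t
      proof (cases "t = 1")
        case True
        then have "\<gamma> e t = realize p \<gamma> (GV x)" using d2(3)[OF 3(1)] 3(2) by simp
        then show ?thesis unfolding S'_def by blast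
      next
        case False
        then have "2/3 \<le> t" "t < 1" using that by simp_all
        then have "GE e t \<in> S' x" using 3(1,2) unfolding S'_def by blast
        moreover have "\<gamma> e t = realize p \<gamma> (GE e t)" by simp
        ultimately show ?thesis by blast
      qed
      moreover have "p x \<in> C" using d2(3)[OF 3(1)] 3(2) unfolding 3(3) by (intro image_eqI[of _ _ 1]) simp_all
      moreover have "connectedin (Nsurf k) C" unfolding 3(3) by (rule connectedin_arc[OF d2(1)[OF 3(1)]]) simp_all
      moreover have "compactin (Nsurf k) C" unfolding 3(3) by (rule compactin_arc[OF d2(1)[OF 3(1)]]) simp_all
      ultimately show ?thesis unfolding 3(3) by blast
    qed
  qed
  have S: "connectedin (Nsurf k) (S x)" "closedin (Nsurf k) (S x)" "p x \<in> S x" "S x \<subseteq> realize p \<gamma> ` S' x"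
    if x: "x \<in> V" for x
  proof -
    have "p x \<in> \<Inter>(F x)" using F[OF x] by blast
    then show "connectedin (Nsurf k) (S x)" unfolding S_def using F[OF x] by (intro connectedin_Union) blast+
    have "finite (F x)" unfolding F_def using finK by simp
    then have "compactin (Nsurf k) (S x)" unfolding S_def using F[OF x] by (intro compactin_Union) blast+
    then show "closedin (Nsurf k) (S x)" by (rule compactin_imp_closedin[OF Hausdorff_Nsurf])
    show "p x \<in> S x" unfolding S_def F_def by blast
    show "S x \<subseteq> realize p \<gamma> ` S' x" unfolding S_def using F[OF x] by blast
  qed
  have M: "connectedin (Nsurf k) (M e)" "closedin (Nsurf k) (M e)" "M e \<subseteq> realize p \<gamma> ` M' e" if e: "e \<in> K" for e
  proof -
    show "connectedin (Nsurf k) (M e)" unfolding M_def by (rule connectedin_arc[OF d2(1)[OF e]]) auto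
    have "compactin (Nsurf k) (M e)" unfolding M_def by (rule compactin_arc[OF d2(1)[OF e]]) auto
    then show "closedin (Nsurf k) (M e)" by (rule compactin_imp_closedin[OF Hausdorff_Nsurf])
    show "M e \<subseteq> realize p \<gamma> ` M' e"
    proof
      fix x assume "x \<in> M e"
      then obtain t where t: "1/3 \<le> t" "t \<le> 2/3" "x = \<gamma> e t" unfolding M_def by auto
      then have "x = realize p \<gamma> (GE e t)" "GE e t \<in> M' e" unfolding M'_def by simp_all
      then show "x \<in> realize p \<gamma> ` M' e" by (rule image_eqI)
    qed
  qed
  have S'E: "g = GV x \<or> (\<exists>e s. g = GE e s \<and> e \<in> K \<and> (fst e = x \<and> 0 < s \<and> s \<le> 1/3 \<or> snd e = x \<and> 2/3 \<le> s \<and> s < 1))"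
    if "g \<in> S' x" for g x using that unfolding S'_def by blast
  have M'E: "\<exists>s. g = GE e s \<and> 1/3 \<le> s \<and> s \<le> 2/3" if "g \<in> M' e" for g e using that unfolding M'_def by blast
  have gpI: "GV x \<in> gpoints V K" if "x \<in> V" for x using that unfolding gpoints_def by blast
  have gpE: "GE e s \<in> gpoints V K" if "e \<in> K" "0 < s" "s < 1" for e s using that unfolding gpoints_def by blast
  have S'g: "S' x \<subseteq> gpoints V K" if x: "x \<in> V" for x
  proof
    fix g assume "g \<in> S' x"
    from S'E[OF this] show "g \<in> gpoints V K"
    proof (elim disjE exE conjE)
      assume "g = GV x" then show ?thesis using gpI[OF x] by simp
    next
      fix e s assume "g = GE e s" "e \<in> K" "0 < s" "s \<le> 1/3"
      then show ?thesis using gpE[of e s] by simp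
    next
      fix e s assume "g = GE e s" "e \<in> K" "2/3 \<le> s" "s < 1"
      then show ?thesis using gpE[of e s] by simp
    qed
  qed
  have M'g: "M' e \<subseteq> gpoints V K" if e: "e \<in> K" for e
  proof
    fix g assume "g \<in> M' e"
    then obtain s where "g = GE e s" "1/3 \<le> s" "s \<le> 2/3" using M'E by blast
    then show "g \<in> gpoints V K" using gpE[OF e, of s] by simp
  qed
  have dis: "A \<inter> B = {}" if "A \<subseteq> realize p \<gamma> ` A'" "B \<subseteq> realize p \<gamma> ` B'" "A' \<subseteq> gpoints V K" "B' \<subseteq> gpoints V K" "A' \<inter> B' = {}" for A B A' B'
  proof -
    have False if x: "x \<in> A" "x \<in> B" for x
    proof -
      obtain g h where gh: "g \<in> A'" "h \<in> B'" "x = realize p \<gamma> g" "x = realize p \<gamma> h"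
        using x \<open>A \<subseteq> _\<close> \<open>B \<subseteq> _\<close> by blast
      then have "g = h" using inj[of g h] \<open>A' \<subseteq> _\<close> \<open>B' \<subseteq> _\<close> by auto
      then show False using gh(1,2) \<open>A' \<inter> B' = {}\<close> by blast
    qed
    then show ?thesis by blast
  qed
  have SS: "S x \<inter> S y = {}" if xy: "x \<in> V" "y \<in> V" "x \<noteq> y" for x y
  proof (rule dis[OF S(4)[OF xy(1)] S(4)[OF xy(2)] S'g[OF xy(1)] S'g[OF xy(2)]])
    have False if g: "g \<in> S' x" "g \<in> S' y" for g
      using S'E[OF g(1)] S'E[OF g(2)] xy(3) by (elim disjE exE conjE) simp_all
    then show "S' x \<inter> S' y = {}" by blast
  qed
  have MM: "M e \<inter> M f = {}" if ef: "e \<in> K" "f \<in> K" "e \<noteq> f" for e f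
  proof (rule dis[OF M(3)[OF ef(1)] M(3)[OF ef(2)] M'g[OF ef(1)] M'g[OF ef(2)]])
    have False if g: "g \<in> M' e" "g \<in> M' f" for g
      using M'E[OF g(1)] M'E[OF g(2)] ef(3) by (elim exE conjE) simp
    then show "M' e \<inter> M' f = {}" by blast
  qed
  have MS: "M e \<inter> S x = {}" if ex: "e \<in> K" "x \<in> V" "x \<noteq> fst e" "x \<noteq> snd e" for e x
  proof (rule dis[OF M(3)[OF ex(1)] S(4)[OF ex(2)] M'g[OF ex(1)] S'g[OF ex(2)]])
    have False if g: "g \<in> M' e" "g \<in> S' x" for g
      using M'E[OF g(1)] S'E[OF g(2)] ex(3,4) by (elim disjE exE conjE) simp_all
    then show "M' e \<inter> S' x = {}" by blast
  qed
  let ?nb = "grid.nb k"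
  \<comment> \<open>Finitely many pairs have to be separated, so one N serves them all.\<close>
  have "eventually (\<lambda>N. 2 \<le> N \<and> (\<forall>q\<in>{q \<in> V \<times> V. fst q \<noteq> snd q}. ?nb N (S (fst q)) \<inter> ?nb N (S (snd q)) = {}) \<and>
      (\<forall>q\<in>{q \<in> K \<times> K. fst q \<noteq> snd q}. ?nb N (M (fst q)) \<inter> ?nb N (M (snd q)) = {}) \<and>
      (\<forall>q\<in>{q \<in> K \<times> V. snd q \<noteq> fst (fst q) \<and> snd q \<noteq> snd (fst q)}. ?nb N (M (fst q)) \<inter> ?nb N (S (snd q)) = {})) sequentially"
  proof (intro eventually_conj eventually_ball_finite ballI eventually_ge_at_top)
    fix q assume q: "q \<in> {q \<in> V \<times> V. fst q \<noteq> snd q}"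
    then have "fst q \<in> V" "snd q \<in> V" "fst q \<noteq> snd q" by auto
    then show "eventually (\<lambda>N. ?nb N (S (fst q)) \<inter> ?nb N (S (snd q)) = {}) sequentially"
      by (intro eventually_nb_disjoint S(2) SS)
  next
    fix q assume q: "q \<in> {q \<in> K \<times> K. fst q \<noteq> snd q}"
    then have "fst q \<in> K" "snd q \<in> K" "fst q \<noteq> snd q" by auto
    then show "eventually (\<lambda>N. ?nb N (M (fst q)) \<inter> ?nb N (M (snd q)) = {}) sequentially"
      by (intro eventually_nb_disjoint M(2) MM)
  next
    fix q assume q: "q \<in> {q \<in> K \<times> V. snd q \<noteq> fst (fst q) \<and> snd q \<noteq> snd (fst q)}"
    then have "fst q \<in> K" "snd q \<in> V" "snd q \<noteq> fst (fst q)" "snd q \<noteq> snd (fst q)" by auto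
    then show "eventually (\<lambda>N. ?nb N (M (fst q)) \<inter> ?nb N (S (snd q)) = {}) sequentially"
      by (intro eventually_nb_disjoint M(2) S(2) MS)
  qed (use finV finK in simp_all)
  then obtain N where fine: "2 \<le> N"
    "\<forall>q\<in>{q \<in> V \<times> V. fst q \<noteq> snd q}. ?nb N (S (fst q)) \<inter> ?nb N (S (snd q)) = {}"
    "\<forall>q\<in>{q \<in> K \<times> K. fst q \<noteq> snd q}. ?nb N (M (fst q)) \<inter> ?nb N (M (snd q)) = {}"
    "\<forall>q\<in>{q \<in> K \<times> V. snd q \<noteq> fst (fst q) \<and> snd q \<noteq> snd (fst q)}. ?nb N (M (fst q)) \<inter> ?nb N (S (snd q)) = {}"
    using eventually_happens'[OF sequentially_bot] by blast
  interpret grid k N by unfold_locales (rule fine(1))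
  have "2 * (int (card gverts) - int (card gedges) + int (card gfaces) - int (card (X \<union> Y)) + int (card K)) \<le> int (card K)"
  proof (rule fat_embedding[where B = "\<lambda>x. nb (S x)" and M = "\<lambda>e. nb (M e)", OF K conn_gverts])
    fix x assume "x \<in> X \<union> Y"
    then have x: "x \<in> V" by (simp add: V_def)
    have "S x \<inter> S x \<noteq> {}" using S(3)[OF x] by blast
    from nb_meet[OF this connectedin_subset_topspace[OF S(1)[OF x]]] conn_nb[OF S(1)[OF x]]
    show "conn (nb (S x)) \<and> nb (S x) \<noteq> {}" by simp
  next
    fix x y assume "x \<in> X \<union> Y" "y \<in> X \<union> Y" "x \<noteq> y"
    then show "nb (S x) \<inter> nb (S y) = {}" using bspec[OF fine(2), of "(x, y)"] by (simp add: V_def)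
  next
    fix e assume e: "e \<in> K"
    have "\<gamma> e (1/3) \<in> \<gamma> e ` {0..1/3}" "\<gamma> e (2/3) \<in> \<gamma> e ` {2/3..1}"
      "\<gamma> e (1/3) \<in> M e" "\<gamma> e (2/3) \<in> M e" unfolding M_def by (intro imageI; simp)+
    moreover have "\<gamma> e ` {0..1/3} \<in> F (fst e)" "\<gamma> e ` {2/3..1} \<in> F (snd e)" using e unfolding F_def by blast+
    ultimately have "M e \<inter> S (fst e) \<noteq> {}" "M e \<inter> S (snd e) \<noteq> {}" unfolding S_def by blast+
    then show "conn (nb (M e)) \<and> nb (M e) \<inter> nb (S (fst e)) \<noteq> {} \<and> nb (M e) \<inter> nb (S (snd e)) \<noteq> {}"
      using nb_meet[OF _ connectedin_subset_topspace[OF M(1)[OF e]]] conn_nb[OF M(1)[OF e]] by blast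
  next
    fix e f assume "e \<in> K" "f \<in> K" "e \<noteq> f"
    then show "nb (M e) \<inter> nb (M f) = {}" using bspec[OF fine(3), of "(e, f)"] by simp
  next
    fix e x assume "e \<in> K" "x \<in> X \<union> Y" "x \<noteq> fst e" "x \<noteq> snd e"
    then show "nb (M e) \<inter> nb (S x) = {}" using bspec[OF fine(4), of "(e, x)"] by (simp add: V_def)
  qed
  then show ?thesis unfolding euler .
qed

section \<open>The crossing number\<close>

theorem mainTheorem18:
  fixes m n :: nat
  assumes "m \<ge> 3" and "n \<ge> 3" and "odd m" and "odd n"
  shows "ncr ((m - 2) * (n - 2) div 2) (Kmn_V m n) (Kmn_E m n) = 1"
proof -
  define k where "k = (m - 2) * (n - 2) div 2"
  define X where "X = (Inl ` {..<m} :: (nat + nat) set)"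
  define Y where "Y = (Inr ` {..<n} :: (nat + nat) set)"
  have V: "Kmn_V m n = X \<union> Y" by (simp add: Kmn_V_def X_def Y_def)
  have E: "Kmn_E m n = X \<times> Y" by (auto simp: Kmn_E_def X_def Y_def)
  have dj: "X \<inter> Y = {}" and fin: "finite X" "finite Y" and cX: "card X = m" and cY: "card Y = n"
    by (auto simp: X_def Y_def card_image)
  have no: "card (crossings (Kmn_E m n) \<gamma>) \<noteq> 0" if d: "drawing (Nsurf k) (Kmn_V m n) (Kmn_E m n) p \<gamma>" for p \<gamma>
  proof
    assume "card (crossings (Kmn_E m n) \<gamma>) = 0"
    moreover have "finite (crossings (Kmn_E m n) \<gamma>)" using d unfolding drawing_def by blast
    ultimately have nc: "crossings (Kmn_E m n) \<gamma> = {}" by simp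
    have mn: "card (X \<times> Y) = m * n" "card (X \<union> Y) = m + n"
      using dj fin cX cY by (simp_all add: card_cartesian_product card_Un_disjoint)
    have "3 * 3 \<le> m * n" using assms by (intro mult_le_mono)
    then have "2 \<le> card (X \<times> Y)" unfolding mn by simp
    from embedding_bound[OF d[unfolded V E] nc[unfolded E] subset_refl dj fin this]
    have b: "2 * (2 - int k - int (m + n) + int (m * n)) \<le> int (m * n)" unfolding mn .
    have "odd ((m - 2) * (n - 2))" using assms by simp
    then have "(m - 2) * (n - 2) = 2 * k + 1" unfolding k_def by simp
    then have "int (m - 2) * int (n - 2) = 2 * int k + 1" by (metis of_nat_1 of_nat_add of_nat_mult of_nat_numeral)
    then have "(int m - 2) * (int n - 2) = 2 * int k + 1" using assms by (simp add: of_nat_diff)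
    \<comment> \<open>\<open>b\<close> amounts to (m - 2) (n - 2) \<le> 2 k, but the product is 2 k
      + 1.\<close>
    then show False using b by (simp add: algebra_simps)
  qed
  obtain p \<gamma> where d: "drawing (Nsurf k) (Kmn_V m n) (Kmn_E m n) p \<gamma>" and c: "card (crossings (Kmn_E m n) \<gamma>) \<le> 1"
    using Kmn_drawing[OF assms] unfolding k_def by blast
  have "card (crossings (Kmn_E m n) \<gamma>) = 1" using no[OF d] c by linarith
  then show ?thesis unfolding ncr_def k_def[symmetric]
    using d no by (intro Least_equality) (blast, force simp: Suc_le_eq)
qed

end
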